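(* There exist a compact interval $I\subset\mathbb{R}$ and a non-degenerate smooth map $f:I\to I$ that is topologically exact on its Julia set $J(f)$, that satisfies $\chi_{\inf}(f)>0$, and that has the following property: there is a fixed point $p$ of $f$ in the boundary of a Fatou component of $f$ such that for every $\delta>0$ we have $$\limsup_{n\to+\infty}\frac1n\ln\max\left\{|W| : W \text{ connected component of } f^{-n}(B(p,\delta))\right\} > -\chi_{\inf}(f).$$
   Context: Let $I$ be a compact interval of $\mathbb{R}$. A non-injective smooth ($C^\infty$) map $f:I\to I$ is *non-degenerate* if the set of points at which the derivative of $f$ vanishes is finite and if at each of these points a higher order derivative of $f$ is non-zero. The *Fatou set* of $f$ is the largest (relatively) open subset of $I$ on which the family of iterates $(f^n)_{n\ge1}$ is normal (locally equicontinuous). The *Julia set* $J(f)$ is the complement in $I$ of the Fatou set. A *Fatou component* is a connected component of the Fatou set. The map $f$ is *topologically exact on $J(f)$* if $J(f)$ is not reduced to a single point and for every open subset $U$ of $I$ intersecting $J(f)$ there is an integer $n\ge1$ such that $f^n(U)\supset J(f)$. Define $$\chi_{\inf}(f)=\inf\left\{\int\ln|Df|\,d\mu : \mu \text{ Borel probability measure on } J(f) \text{ invariant by } f\right\},$$ with $\ln 0=-\infty$. For an interval $W$, $|W|$ denotes its length, and $B(p,\delta)$ is the open ball in $I$ of center $p$ and radius $\delta$. *)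

theory Defs
  imports "HOL-Probability.Probability"
begin

text \<open>An interval map is a total function \<^term>\<open>f :: real \<Rightarrow> real\<close> considered only on a set \<^term>\<open>I\<close>:
  no definition below depends on the values of \<^term>\<open>f\<close> outside \<^term>\<open>I\<close>, provided
  \<^term>\<open>f\<close> maps \<^term>\<open>I\<close> into itself.  In particular derivatives are taken within \<^term>\<open>I\<close>, hence
  they are one-sided at the endpoints.\<close>

primrec nderiv_within :: "real set \<Rightarrow> nat \<Rightarrow> (real \<Rightarrow> real) \<Rightarrow> real \<Rightarrow> real" where
  "nderiv_within I 0 f = f"
| "nderiv_within I (Suc k) f = (\<lambda>x. vector_derivative (nderiv_within I k f) (at x within I))"

abbreviation deriv_within :: "real set \<Rightarrow> (real \<Rightarrow> real) \<Rightarrow> real \<Rightarrow> real" where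
  "deriv_within I f \<equiv> nderiv_within I 1 f"

definition smooth_within :: "real set \<Rightarrow> (real \<Rightarrow> real) \<Rightarrow> bool" where
  "smooth_within I f \<longleftrightarrow> (\<forall>k. \<forall>x\<in>I. nderiv_within I k f differentiable (at x within I))"

definition nondegenerate_smooth_map :: "real set \<Rightarrow> (real \<Rightarrow> real) \<Rightarrow> bool" where
  "nondegenerate_smooth_map I f \<longleftrightarrow>
     f ` I \<subseteq> I \<and> smooth_within I f \<and> \<not> inj_on f I \<and>
     finite {x\<in>I. deriv_within I f x = 0} \<and>
     (\<forall>x\<in>I. deriv_within I f x = 0 \<longrightarrow> (\<exists>k\<ge>2. nderiv_within I k f x \<noteq> 0))"

definition equicontinuous_on :: "real set \<Rightarrow> (real \<Rightarrow> real) set \<Rightarrow> bool" where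
  "equicontinuous_on S F \<longleftrightarrow>
     (\<forall>x\<in>S. \<forall>e>0. \<exists>d>0. \<forall>g\<in>F. \<forall>y\<in>S. dist y x < d \<longrightarrow> dist (g y) (g x) < e)"

definition locally_equicontinuous_on :: "real set \<Rightarrow> (real \<Rightarrow> real) set \<Rightarrow> bool" where
  "locally_equicontinuous_on S F \<longleftrightarrow>
     (\<forall>x\<in>S. \<exists>V. openin (top_of_set S) V \<and> x \<in> V \<and> equicontinuous_on V F)"

definition iterates :: "(real \<Rightarrow> real) \<Rightarrow> (real \<Rightarrow> real) set" where
  "iterates f = {f ^^ n | n. n \<ge> 1}"

definition Fatou :: "real set \<Rightarrow> (real \<Rightarrow> real) \<Rightarrow> real set" where
  "Fatou I f = \<Union>{U. openin (top_of_set I) U \<and> locally_equicontinuous_on U (iterates f)}"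

lemma Fatou_greatest:
  shows "openin (top_of_set I) (Fatou I f)"
    and "locally_equicontinuous_on (Fatou I f) (iterates f)"
    and "\<lbrakk>openin (top_of_set I) U; locally_equicontinuous_on U (iterates f)\<rbrakk> \<Longrightarrow> U \<subseteq> Fatou I f"
proof -
  show op: "openin (top_of_set I) (Fatou I f)"
    unfolding Fatou_def by (rule openin_Union) auto
  show "\<lbrakk>openin (top_of_set I) U; locally_equicontinuous_on U (iterates f)\<rbrakk> \<Longrightarrow> U \<subseteq> Fatou I f"
    unfolding Fatou_def by blast
  show "locally_equicontinuous_on (Fatou I f) (iterates f)"
    unfolding locally_equicontinuous_on_def
  proof
    fix x assume "x \<in> Fatou I f"
    then obtain U where U: "openin (top_of_set I) U" "locally_equicontinuous_on U (iterates f)" "x \<in> U"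
      unfolding Fatou_def by blast
    then obtain V where V: "openin (top_of_set U) V" "x \<in> V" "equicontinuous_on V (iterates f)"
      unfolding locally_equicontinuous_on_def by blast
    have "openin (top_of_set I) V"
      by (rule openin_trans[OF V(1) U(1)])
    moreover have "V \<subseteq> Fatou I f"
      using U(1,2) openin_imp_subset[OF V(1)] unfolding Fatou_def by blast
    ultimately have "openin (top_of_set (Fatou I f)) V"
      using openin_subset_trans[OF _ _ openin_imp_subset[OF op]] by blast
    with V show "\<exists>V. openin (top_of_set (Fatou I f)) V \<and> x \<in> V \<and> equicontinuous_on V (iterates f)"
      by blast
  qed
qed

definition Julia :: "real set \<Rightarrow> (real \<Rightarrow> real) \<Rightarrow> real set" where
  "Julia I f = I - Fatou I f"

text \<open>The condition that the Julia set is not reduced to a single point is read as excluding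
  also the empty set, on which exactness would be vacuous.\<close>

definition topologically_exact_on_Julia :: "real set \<Rightarrow> (real \<Rightarrow> real) \<Rightarrow> bool" where
  "topologically_exact_on_Julia I f \<longleftrightarrow>
     (\<exists>x\<in>Julia I f. \<exists>y\<in>Julia I f. x \<noteq> y) \<and>
     (\<forall>U. openin (top_of_set I) U \<and> U \<inter> Julia I f \<noteq> {} \<longrightarrow>
        (\<exists>n\<ge>1. Julia I f \<subseteq> (f ^^ n) ` U))"

definition invariant_measures :: "real set \<Rightarrow> (real \<Rightarrow> real) \<Rightarrow> real measure set" where
  "invariant_measures I f =
     {\<mu>. sets \<mu> = sets (restrict_space borel (Julia I f)) \<and> prob_space \<mu> \<and>
         f \<in> \<mu> \<rightarrow>\<^sub>M \<mu> \<and> distr \<mu> \<mu> f = \<mu>}"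

definition eln :: "real \<Rightarrow> ereal" where
  "eln x = (if x \<le> 0 then -\<infinity> else ereal (ln x))"

text \<open>The extended integral: integral of the positive part minus integral of the negative part
  (\<^const>\<open>e2ennreal\<close> sends negative values to 0).  It is used only for functions bounded above
  and probability measures, so that the first term is finite.\<close>

definition eintegral :: "real measure \<Rightarrow> (real \<Rightarrow> ereal) \<Rightarrow> ereal" where
  "eintegral \<mu> g =
     enn2ereal (\<integral>\<^sup>+ x. e2ennreal (g x) \<partial>\<mu>) - enn2ereal (\<integral>\<^sup>+ x. e2ennreal (- g x) \<partial>\<mu>)"

definition chi_inf :: "real set \<Rightarrow> (real \<Rightarrow> real) \<Rightarrow> ereal" where
  "chi_inf I f = (INF \<mu>\<in>invariant_measures I f. eintegral \<mu> (\<lambda>x. eln \<bar>deriv_within I f x\<bar>))"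

text \<open>The maximal length of a connected component of a subset of a bounded interval; it is written
  as a supremum, which is attained by the lemma below.\<close>

definition max_component_length :: "real set \<Rightarrow> real" where
  "max_component_length S = (SUP W\<in>components S. measure lborel W)"

lemma max_component_length_attained:
  assumes "S \<noteq> {}" and "S \<subseteq> {a..b}"
  shows "\<exists>W\<in>components S. measure lborel W = max_component_length S \<and>
           (\<forall>W'\<in>components S. measure lborel W' \<le> measure lborel W)"
proof -
  let ?m = "measure lborel :: real set \<Rightarrow> real"
  have sub: "W \<subseteq> {a..b}" if "W \<in> components S" for W
    using that assms(2) in_components_subset by blast
  have meas: "W \<in> sets borel" if "W \<in> components S" for W
    using in_components_connected[OF that]
    by (simp add: is_interval_connected_1 real_interval_borel_measurable)
  have Icc: "{a..b} \<in> fmeasurable lborel"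
    using fmeasurable_cbox[of a b] by simp
  have fm: "W \<in> fmeasurable lborel" if "W \<in> components S" for W
    using fmeasurableI2[OF Icc sub[OF that]] meas[OF that] by simp
  have fin: "finite {W\<in>components S. e \<le> ?m W}" if e: "e > 0" for e
  proof (rule ccontr)
    assume inf: "infinite {W\<in>components S. e \<le> ?m W}"
    obtain n :: nat where n: "\<bar>b - a\<bar> < real n * e"
      using reals_Archimedean3[OF e] by blast
    obtain F where F: "F \<subseteq> {W\<in>components S. e \<le> ?m W}" "finite F" "card F = n"
      using infinite_arbitrarily_large[OF inf] by blast
    have disj: "pairwise disjnt F"
    proof (rule pairwise_subset)
      show "pairwise disjnt (components S)"
        using pairwise_disjoint_components[of S] by (simp add: disjnt_def pairwise_def)
      show "F \<subseteq> components S" using F(1) by auto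
    qed
    have "real n * e = (\<Sum>W\<in>F. e)" using F by simp
    also have "\<dots> \<le> (\<Sum>W\<in>F. ?m W)" using F by (intro sum_mono) auto
    also have "\<dots> = ?m (\<Union>F)"
      using F(1) fm by (intro measure_Union'[OF F(2) _ disj, symmetric]) auto
    also have "\<dots> \<le> ?m {a..b}"
    proof (rule measure_mono_fmeasurable)
      show "\<Union>F \<subseteq> {a..b}" using F(1) sub by fast
      show "\<Union>F \<in> sets lborel" using F(1,2) meas by (intro sets.finite_Union) auto
    qed (rule Icc)
    also have "\<dots> \<le> \<bar>b - a\<bar>" by (cases "a \<le> b") auto
    finally show False using n by simp
  qed
  obtain W0 where W0: "W0 \<in> components S"
    using assms(1) components_eq_empty[of S] ex_in_conv by blast
  have "\<exists>W\<in>components S. \<forall>W'\<in>components S. ?m W' \<le> ?m W"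
  proof (cases "\<exists>W\<in>components S. ?m W > 0")
    case False
    have "?m W \<le> ?m W0" if "W \<in> components S" for W
      using False that measure_nonneg[of lborel W0] by (meson linorder_not_less order_trans)
    then show ?thesis using W0 by blast
  next
    case True
    then obtain W1 where W1: "W1 \<in> components S" "?m W1 > 0" by blast
    let ?A = "{W\<in>components S. ?m W1 \<le> ?m W}"
    have A: "finite ?A" "?A \<noteq> {}" using fin[OF W1(2)] W1 by auto
    then have "Max (?m ` ?A) \<in> ?m ` ?A" by (intro Max_in) auto
    then obtain W where W: "W \<in> ?A" "?m W = Max (?m ` ?A)" by auto
    have "?m W' \<le> ?m W" if "W' \<in> components S" for W'
    proof (cases "?m W1 \<le> ?m W'")
      case True
      then show ?thesis using A W that by (auto intro!: Max_ge)
    next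
      case False
      then show ?thesis using W by auto
    qed
    then show ?thesis using W by blast
  qed
  then obtain W where W: "W \<in> components S" "\<forall>W'\<in>components S. ?m W' \<le> ?m W" by blast
  then have "max_component_length S = ?m W"
    unfolding max_component_length_def by (intro cSup_eq_maximum) auto
  with W show ?thesis by auto
qed

end

theory Submission
  imports Defs
begin

text \<open>The map is piecewise polynomial on the interval \<open>[0, 3]\<close> up to smooth transitions in the gaps,
  and the Julia set consists of the points whose orbits stay in \<open>[0, 3]\<close>; the fixed point is
  \<open>p = 0\<close>, with the Fatou component on its left.  There are four branches: two full branches of
  derivative about \<open>\<plusminus> 2 ^ 24\<close>, a full branch with a cubic inflection point at 1, and a fold at the
  minimum point 2.  The critical value \<open>v1\<close> of the inflection point has an orbit with longer
  and longer stays near 0.  The critical value \<open>v2\<close> of the fold has an orbit passing the inflection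
  point closer and closer, each time followed by a stay near 0 which is 16 times longer
  than the corresponding stay of \<open>v1\<close>.

  Pulling back a neighbourhood of 0 along a stay near 0 of length \<open>k\<close>, then through the inflection
  point and then through the fold takes a sixth root, and the pullback at the fold has length
  about \<open>2 ^ (- 24 k / 6)\<close>.  Points of the Julia set near the fold do not see this scale: the
  fold keeps only one side of \<open>v2\<close>, which is mapped during a stay near 0 to the side of the
  orbit of \<open>v2\<close> containing the Fatou component.  A point of the Julia set on that side therefore
  leaves the orbit of \<open>v2\<close> either before the stay or after the whole of the longer stay, when most
  of the derivative has been recovered.  This gives an expansion of at least \<open>2 ^ 6\<close> per step along
  suitable iterates of every noncritical point of the Julia set, and a maximal ergodic inequality
  turns this into a lower bound for all invariant measures.\<close>

section \<open>Smooth transitions\<close>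

text \<open>The obstacle is that pullbacks see both sides of a critical orbit while invariant
  measures see only the Julia set; the constants keep the two rates apart. All rates are exponents
  of 2 per step. A step with symbol 0 or 1 expands distances by a rate between 23 and 24. If the
  image of a point near 1 has distance about 2 ^ (- 24 l) from \<open>crit_value1\<close>, its
  derivative is about 2 ^ (- 16 l), since the derivative of a cube is comparable to the power 2/3 of
  its value; what remains is 23 - 16 = 7. Along the orbit of \<open>crit_value2\<close> the schedule
  \<open>times\<close> spreads these losses so thinly that they cost at most 5 per step, leaving 18.
  The square root at the fold costs half of 24, and 18 - 12 = 6. The pullbacks are only claimed to
  have rate 5, which leaves room for crude estimates, and 11/2 is a rate strictly between 5 and 6.
  Each run of zeros exceeds any fixed multiple of the time before it, once its index is large; hence
  Lipschitz constants of the earlier steps do not affect the pullback rate.\<close>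

definition flat_exp :: "nat \<Rightarrow> real \<Rightarrow> real" where
  "flat_exp k x = (if x \<le> 0 then 0 else exp (- 1 / x) / x ^ k)"

lemma flat_exp_nonneg: "0 \<le> flat_exp k x"
  by (simp add: flat_exp_def)

lemma flat_exp_pos: "0 < x \<Longrightarrow> 0 < flat_exp k x"
  by (simp add: flat_exp_def)

text \<open>One term of the series of exp (1 / x) suffices: it is at least (1 / x) ^ (k + 1) / (k +
  1)!.\<close>

lemma flat_exp_le: "flat_exp k x \<le> fact (Suc k) * \<bar>x\<bar>"
proof (cases "x \<le> 0")
  case True
  then show ?thesis by (simp add: flat_exp_def mult_nonneg_nonpos del: fact_Suc)
next
  case False
  then have x: "x > 0" by simp
  have "(1 / x) ^ Suc k / fact (Suc k) \<le> (\<Sum>i\<le>Suc k. (1 / x) ^ i / fact i)"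
    using x by (intro member_le_sum) auto
  also have "\<dots> \<le> exp (1 / x)"
    using sum_le_suminf[OF summable_exp_generic[of "1 / x"], of "{..Suc k}"] x
    by (simp add: exp_def divide_inverse mult.commute del: fact_Suc power_Suc sum.atMost_Suc)
  finally have "(1 / x) ^ Suc k \<le> fact (Suc k) * exp (1 / x)"
    by (simp add: pos_divide_le_eq mult.commute del: fact_Suc power_Suc)
  then have "exp (- (1 / x)) \<le> fact (Suc k) * x ^ Suc k"
    using x by (simp add: exp_minus field_simps del: fact_Suc)
  then show ?thesis
    using x by (simp add: flat_exp_def field_simps del: fact_Suc)
qed

text \<open>The powers in the denominator make the family closed under differentiation up to linear
  combinations. At 0 the difference quotient of \<open>flat_exp k\<close> is
  \<open>flat_exp (Suc k)\<close>, which tends to 0 by \<open>flat_exp_le\<close>.\<close>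

lemma flat_exp_has_derivative:
  "(flat_exp k has_real_derivative (flat_exp (k + 2) x - real k * flat_exp (k + 1) x)) (at x)"
proof -
  consider "x < 0" | "x = 0" | "x > 0" by linarith
  then show ?thesis
  proof cases
    case 1
    have "(flat_exp k has_real_derivative 0) (at x)"
      by (rule has_field_derivative_transform_within_open[of "\<lambda>_. 0" _ _ "{..<0}"])
         (use 1 in \<open>auto simp: flat_exp_def\<close>)
    then show ?thesis using 1 by (simp add: flat_exp_def)
  next
    case 2
    have "((\<lambda>h. flat_exp k h / h) \<longlongrightarrow> 0) (at 0)"
    proof (rule tendsto_0_le[where K = 1 and f = "\<lambda>h. fact (Suc (Suc k)) * h"])
      show "((\<lambda>h. fact (Suc (Suc k)) * h) \<longlongrightarrow> (0::real)) (at 0)"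
        by (auto intro!: tendsto_eq_intros)
      show "\<forall>\<^sub>F h in at 0. norm (flat_exp k h / h) \<le> norm (fact (Suc (Suc k)) * h :: real) * 1"
      proof (rule always_eventually, rule allI)
        fix h :: real
        have "norm (flat_exp k h / h) = flat_exp (Suc k) h"
          by (auto simp: flat_exp_def)
        also have "\<dots> \<le> norm (fact (Suc (Suc k)) * h :: real) * 1"
          using flat_exp_le[of "Suc k" h] by (simp add: abs_mult del: fact_Suc)
        finally show "norm (flat_exp k h / h) \<le> norm (fact (Suc (Suc k)) * h :: real) * 1" .
      qed
    qed
    then have "(flat_exp k has_real_derivative 0) (at 0)"
      by (simp add: has_field_derivative_iff flat_exp_def[of k 0])
    then show ?thesis using 2 by (simp add: flat_exp_def)
  next
    case 3
    have "real k * x ^ (k - 1) = real k * x ^ k / x"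
      using 3 by (cases k) auto
    then have "((\<lambda>x. x ^ k) has_real_derivative real k * x ^ k / x) (at x)"
      using DERIV_pow[of k x] by simp
    moreover have "((\<lambda>x. exp (- 1 / x)) has_real_derivative exp (- 1 / x) / x\<^sup>2) (at x)"
      using 3 by (auto intro!: derivative_eq_intros simp: power2_eq_square)
    ultimately have "((\<lambda>x. exp (- 1 / x) / x ^ k) has_real_derivative
        (exp (- 1 / x) / x\<^sup>2 * x ^ k - exp (- 1 / x) * (real k * x ^ k / x)) / (x ^ k * x ^ k)) (at x)"
      using 3 by (intro DERIV_divide) auto
    also have "(exp (- 1 / x) / x\<^sup>2 * x ^ k - exp (- 1 / x) * (real k * x ^ k / x)) / (x ^ k * x ^ k)
        = flat_exp (k + 2) x - real k * flat_exp (k + 1) x"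
      using 3 by (simp add: flat_exp_def field_simps power2_eq_square)
    finally have "((\<lambda>x. exp (- 1 / x) / x ^ k) has_real_derivative
        (flat_exp (k + 2) x - real k * flat_exp (k + 1) x)) (at x)" .
    then show ?thesis
      by (rule has_field_derivative_transform_within_open[of _ _ _ "{0<..}"])
         (use 3 in \<open>auto simp: flat_exp_def\<close>)
  qed
qed

section \<open>A class of smooth functions closed under differentiation\<close>

text \<open>A syntactic class stands in for smoothness: derivatives of members are members, so all
  higher derivatives exist by iteration. Composition enters only through affine arguments of
  \<open>flat_exp\<close>, which suffices for \<open>step\<close>.\<close>

inductive_set smooth_funs :: "(real \<Rightarrow> real) set" where
  const: "(\<lambda>_. c) \<in> smooth_funs"
| id: "(\<lambda>x. x) \<in> smooth_funs"
| flat: "(\<lambda>x. flat_exp k (a * x + b)) \<in> smooth_funs"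
| add: "g \<in> smooth_funs \<Longrightarrow> h \<in> smooth_funs \<Longrightarrow> (\<lambda>x. g x + h x) \<in> smooth_funs"
| mult: "g \<in> smooth_funs \<Longrightarrow> h \<in> smooth_funs \<Longrightarrow> (\<lambda>x. g x * h x) \<in> smooth_funs"
| inverse: "g \<in> smooth_funs \<Longrightarrow> (\<And>x. g x \<noteq> 0) \<Longrightarrow> (\<lambda>x. inverse (g x)) \<in> smooth_funs"

lemma smooth_funs_uminus: "g \<in> smooth_funs \<Longrightarrow> (\<lambda>x. - g x) \<in> smooth_funs"
  using smooth_funs.mult[OF smooth_funs.const[of "-1"]] by simp

lemma smooth_funs_diff: "g \<in> smooth_funs \<Longrightarrow> h \<in> smooth_funs \<Longrightarrow> (\<lambda>x. g x - h x) \<in> smooth_funs"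
  using smooth_funs.add[OF _ smooth_funs_uminus] by simp

lemma smooth_funs_power: "g \<in> smooth_funs \<Longrightarrow> (\<lambda>x. g x ^ n) \<in> smooth_funs"
  by (induction n) (auto intro: smooth_funs.intros)

lemma smooth_funs_divide:
  "g \<in> smooth_funs \<Longrightarrow> h \<in> smooth_funs \<Longrightarrow> (\<And>x. h x \<noteq> 0) \<Longrightarrow> (\<lambda>x. g x / h x) \<in> smooth_funs"
  unfolding divide_inverse by (intro smooth_funs.mult smooth_funs.inverse)

lemma smooth_funs_derivative:
  assumes "g \<in> smooth_funs"
  shows "\<exists>g'\<in>smooth_funs. \<forall>x. (g has_real_derivative g' x) (at x)"
  using assms
proof induction
  case (const c)
  show ?case by (rule bexI[of _ "\<lambda>_. 0"]) (auto intro: smooth_funs.const)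
next
  case id
  show ?case by (rule bexI[of _ "\<lambda>_. 1"]) (auto intro: smooth_funs.const)
next
  case (flat k a b)
  let ?g' = "\<lambda>x. (flat_exp (k + 2) (a * x + b) - real k * flat_exp (k + 1) (a * x + b)) * a"
  have "((\<lambda>x. flat_exp k (a * x + b)) has_real_derivative ?g' x) (at x)" for x
    by (rule DERIV_chain2[OF flat_exp_has_derivative]) (auto intro!: derivative_eq_intros)
  moreover have "?g' \<in> smooth_funs"
    by (intro smooth_funs.mult smooth_funs_diff smooth_funs.flat smooth_funs.const)
  ultimately show ?case by (intro bexI[of _ ?g']) auto
next
  case (add g h)
  then obtain g' h' where "g' \<in> smooth_funs" "h' \<in> smooth_funs"
    "\<And>x. (g has_real_derivative g' x) (at x)" "\<And>x. (h has_real_derivative h' x) (at x)" by blast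
  then show ?case
    by (intro bexI[of _ "\<lambda>x. g' x + h' x"] allI DERIV_add smooth_funs.add)
next
  case (mult g h)
  then obtain g' h' where "g' \<in> smooth_funs" "h' \<in> smooth_funs"
    "\<And>x. (g has_real_derivative g' x) (at x)" "\<And>x. (h has_real_derivative h' x) (at x)" by blast
  with mult show ?case
    by (intro bexI[of _ "\<lambda>x. g' x * h x + h' x * g x"] allI DERIV_mult
        smooth_funs.add smooth_funs.mult)
next
  case (inverse g)
  then obtain g' where g': "g' \<in> smooth_funs" "\<And>x. (g has_real_derivative g' x) (at x)" by blast
  have "((\<lambda>x. inverse (g x)) has_real_derivative
      - (inverse (g x) * g' x * inverse (g x))) (at x)" for x
    using DERIV_inverse'[OF g'(2) inverse.hyps(2)] .
  moreover have "(\<lambda>x. - (inverse (g x) * g' x * inverse (g x))) \<in> smooth_funs"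
    by (intro smooth_funs_uminus smooth_funs.mult smooth_funs.inverse inverse.hyps g'(1))
  ultimately show ?case
    by (intro bexI[of _ "\<lambda>x. - (inverse (g x) * g' x * inverse (g x))"]) auto
qed

lemma smooth_funs_deriv:
  assumes "g \<in> smooth_funs"
  shows "deriv g \<in> smooth_funs" and "(g has_real_derivative deriv g x) (at x)"
proof -
  obtain g' where g': "g' \<in> smooth_funs" "\<And>x. (g has_real_derivative g' x) (at x)"
    using smooth_funs_derivative[OF assms] by blast
  then have "deriv g = g'"
    by (auto intro: DERIV_imp_deriv)
  with g' show "deriv g \<in> smooth_funs" "(g has_real_derivative deriv g x) (at x)" by auto
qed

lemma smooth_funs_higher_deriv: "g \<in> smooth_funs \<Longrightarrow> (deriv ^^ k) g \<in> smooth_funs"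
  by (induction k) (auto intro: smooth_funs_deriv)

text \<open>Derivatives within a nondegenerate closed interval are unique, so the one-sided
  derivatives at the endpoints are those of the extension to the real line.\<close>

lemma nderiv_within_eq:
  assumes "g \<in> smooth_funs" "a < b" "x \<in> {a..b}"
  shows "nderiv_within {a..b} k g x = (deriv ^^ k) g x"
  using assms(3)
proof (induction k arbitrary: x)
  case 0
  then show ?case by simp
next
  case (Suc k)
  let ?D = "deriv ((deriv ^^ k) g) x"
  have "((deriv ^^ k) g has_vector_derivative ?D) (at x within {a..b})"
    using smooth_funs_deriv(2)[OF smooth_funs_higher_deriv[OF assms(1)]]
    by (metis has_real_derivative_iff_has_vector_derivative has_vector_derivative_at_within)
  then have "(nderiv_within {a..b} k g has_vector_derivative ?D) (at x within {a..b})"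
    by (rule has_vector_derivative_transform[rotated 2]) (use Suc in auto)
  then show ?case
    using vector_derivative_within_cbox[of a b] assms(2) Suc.prems by simp
qed

lemma smooth_within_Icc:
  assumes "g \<in> smooth_funs" "a < b"
  shows "smooth_within {a..b} g"
  unfolding smooth_within_def
proof (intro allI ballI)
  fix k x assume x: "x \<in> {a..b}"
  have "(deriv ^^ k) g differentiable (at x within {a..b})"
    using smooth_funs_deriv(2)[OF smooth_funs_higher_deriv[OF assms(1)]]
    by (metis real_differentiable_def differentiable_at_withinI)
  then show "nderiv_within {a..b} k g differentiable (at x within {a..b})"
    using nderiv_within_eq[OF assms] x
    by (metis (no_types, lifting) differentiable_transform_within zero_less_one)
qed

lemma higher_deriv_cong:
  fixes g h :: "real \<Rightarrow> real"
  assumes "open S" "\<And>x. x \<in> S \<Longrightarrow> g x = h x" "x \<in> S"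
  shows "(deriv ^^ k) g x = (deriv ^^ k) h x"
  using assms(3)
proof (induction k arbitrary: x)
  case 0
  then show ?case using assms(2) by simp
next
  case (Suc k)
  have "\<forall>\<^sub>F y in nhds x. (deriv ^^ k) g y = (deriv ^^ k) h y"
    using eventually_nhds_in_open[OF assms(1) Suc.prems] by eventually_elim (rule Suc.IH)
  then show ?case by (simp add: deriv_cong_ev)
qed

text \<open>All critical points will lie where the map is a cubic polynomial, so a nonzero leading
  coefficient settles nondegeneracy.\<close>

lemma higher_deriv_cubic:
  fixes a b c d :: real
  assumes "\<And>x. p x = a + b * x + c * x\<^sup>2 + d * x ^ 3"
  shows "(deriv ^^ 3) p x = 6 * d"
proof -
  have p: "p = (\<lambda>x. a + b * x + c * x\<^sup>2 + d * x ^ 3)" using assms by blast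
  have 1: "deriv p = (\<lambda>x. b + 2 * c * x + 3 * d * x\<^sup>2)"
    unfolding p by (intro ext DERIV_imp_deriv) (auto intro!: derivative_eq_intros simp: algebra_simps)
  have 2: "deriv (deriv p) = (\<lambda>x. 2 * c + 6 * d * x)"
    unfolding 1 by (intro ext DERIV_imp_deriv) (auto intro!: derivative_eq_intros simp: algebra_simps)
  have "deriv (deriv (deriv p)) = (\<lambda>x. 6 * d)"
    unfolding 2 by (intro ext DERIV_imp_deriv) (auto intro!: derivative_eq_intros simp: algebra_simps)
  then show ?thesis by (simp add: numeral_3_eq_3)
qed

section \<open>Monotone smooth gluing\<close>

definition step :: "real \<Rightarrow> real \<Rightarrow> real \<Rightarrow> real" where
  "step a b x = flat_exp 0 (x - a) / (flat_exp 0 (x - a) + flat_exp 0 (b - x))"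

definition glue :: "real \<Rightarrow> real \<Rightarrow> (real \<Rightarrow> real) \<Rightarrow> (real \<Rightarrow> real) \<Rightarrow> real \<Rightarrow> real" where
  "glue a b g h x = g x + step a b x * (h x - g x)"

context
  fixes a b :: real
  assumes ab: "a < b"
begin

lemma step_denominator_pos: "0 < flat_exp 0 (x - a) + flat_exp 0 (b - x)"
proof (cases "x > a")
  case True
  then show ?thesis using flat_exp_pos[of "x - a" 0] flat_exp_nonneg[of 0 "b - x"] by simp
next
  case False
  then show ?thesis using ab flat_exp_pos[of "b - x" 0] flat_exp_nonneg[of 0 "x - a"] by simp
qed

lemma step_left: "x \<le> a \<Longrightarrow> step a b x = 0"
  by (simp add: step_def flat_exp_def)

lemma step_right: "x \<ge> b \<Longrightarrow> step a b x = 1"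
  using step_denominator_pos[of x] by (simp add: step_def flat_exp_def)

lemma step_bounds: "0 \<le> step a b x" "step a b x \<le> 1"
  using step_denominator_pos[of x] flat_exp_nonneg by (auto simp: step_def)

lemma flat_exp_0_mono: "x \<le> y \<Longrightarrow> flat_exp 0 x \<le> flat_exp 0 y"
  by (auto simp: flat_exp_def frac_le)

lemma step_mono: "x \<le> y \<Longrightarrow> step a b x \<le> step a b y"
proof -
  assume xy: "x \<le> y"
  have frac: "p / (p + q) \<le> p' / (p' + q')"
    if "0 \<le> p" "p \<le> p'" "q' \<le> q" "0 \<le> q'" "0 < p + q" "0 < p' + q'" for p q p' q' :: real
  proof -
    have "p * q' \<le> p' * q" using that by (intro mult_mono) auto
    then show ?thesis using that by (simp add: divide_simps algebra_simps)
  qed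
  show ?thesis
    unfolding step_def
    by (rule frac) (use xy in \<open>auto intro!: flat_exp_0_mono flat_exp_nonneg step_denominator_pos\<close>)
qed

lemma step_smooth: "step a b \<in> smooth_funs"
proof -
  have 1: "(\<lambda>x. flat_exp 0 (x - a)) \<in> smooth_funs" "(\<lambda>x. flat_exp 0 (b - x)) \<in> smooth_funs"
    using smooth_funs.flat[of 0 1 "- a"] smooth_funs.flat[of 0 "-1" b] by simp_all
  have "(\<lambda>x. flat_exp 0 (x - a) / (flat_exp 0 (x - a) + flat_exp 0 (b - x))) \<in> smooth_funs"
    using step_denominator_pos by (intro smooth_funs_divide smooth_funs.add 1) (metis less_irrefl)
  then show ?thesis by (simp add: step_def[abs_def])
qed

lemma glue_left: "x \<le> a \<Longrightarrow> glue a b g h x = g x"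
  by (simp add: glue_def step_left)

lemma glue_right: "x \<ge> b \<Longrightarrow> glue a b g h x = h x"
  by (simp add: glue_def step_right)

lemma glue_smooth: "g \<in> smooth_funs \<Longrightarrow> h \<in> smooth_funs \<Longrightarrow> glue a b g h \<in> smooth_funs"
  unfolding glue_def[abs_def]
  by (intro smooth_funs.add smooth_funs.mult smooth_funs_diff step_smooth)

lemma glue_bounds:
  assumes "g x \<le> h x"
  shows "g x \<le> glue a b g h x" "glue a b g h x \<le> h x"
proof -
  show "g x \<le> glue a b g h x"
    using assms step_bounds(1)[of x] by (simp add: glue_def)
  have "step a b x * (h x - g x) \<le> 1 * (h x - g x)"
    using assms step_bounds(2)[of x] by (intro mult_right_mono) auto
  then show "glue a b g h x \<le> h x" by (simp add: glue_def)
qed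

text \<open>The derivative is a convex combination of \<open>g'\<close> and \<open>h'\<close> plus
  \<open>s' * (h x - g x)\<close>, and the last term is nonnegative because \<open>step\<close>
  increases and g lies below h. With the lower function on the left, a transition between increasing
  pieces thus creates no critical point.\<close>

lemma glue_deriv_pos:
  assumes "(g has_real_derivative g') (at x)" "(h has_real_derivative h') (at x)"
    and "0 < g'" "0 < h'" "g x \<le> h x"
  shows "0 < deriv (glue a b g h) x"
proof -
  obtain s' where s': "(step a b has_real_derivative s') (at x)"
    using smooth_funs_deriv(2)[OF step_smooth] by blast
  have s'_nonneg: "0 \<le> s'"
  proof (rule ccontr)
    assume "\<not> 0 \<le> s'"
    then obtain d where "d > 0" "\<forall>e>0. e < d \<longrightarrow> step a b x > step a b (x + e)"
      using DERIV_neg_dec_right[OF s'] by auto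
    then show False
      using step_mono[of x "x + d / 2"] by (metis add_less_cancel_left field_sum_of_halves
          half_gt_zero le_add_same_cancel1 less_add_same_cancel2 less_eq_real_def linorder_not_less)
  qed
  let ?s = "step a b x"
  have D: "(glue a b g h has_real_derivative ((1 - ?s) * g' + ?s * h' + s' * (h x - g x))) (at x)"
    unfolding glue_def[abs_def]
    by (rule DERIV_cong, (rule derivative_intros s' assms(1,2))+) (simp add: algebra_simps)
  have "0 < (1 - ?s) * g' + ?s * h'"
  proof (cases "?s = 0")
    case True
    then show ?thesis using assms by simp
  next
    case False
    then have "0 < ?s * h'" "0 \<le> (1 - ?s) * g'"
      using assms step_bounds[of x] by auto
    then show ?thesis by simp
  qed
  moreover have "0 \<le> s' * (h x - g x)" using s'_nonneg assms(5) by simp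
  ultimately show ?thesis using DERIV_imp_deriv[OF D] by linarith
qed

end

section \<open>Itineraries\<close>

lemma strict_mono_interval_index:
  fixes T :: "nat \<Rightarrow> nat"
  assumes "strict_mono T" "T 0 \<le> t"
  obtains i where "T i \<le> t" "t < T (Suc i)"
proof -
  define i where "i = (LEAST i. t < T (Suc i))"
  have "t < T (Suc t)"
    using seq_suble[OF assms(1), of "Suc t"] by simp
  then have 1: "t < T (Suc i)"
    unfolding i_def by (rule LeastI)
  have "T i \<le> t"
  proof (cases i)
    case 0
    then show ?thesis using assms(2) by simp
  next
    case (Suc j)
    then have "\<not> t < T (Suc j)"
      using not_less_Least[of j "\<lambda>i. t < T (Suc i)"] by (simp add: i_def)
    then show ?thesis using Suc by simp
  qed
  with 1 that show ?thesis by blast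
qed

definition interval_index :: "(nat \<Rightarrow> nat) \<Rightarrow> nat \<Rightarrow> nat" where
  "interval_index T t = (LEAST i. t < T (Suc i))"

lemma interval_index_eq:
  assumes "strict_mono T" "T i \<le> t" "t < T (Suc i)"
  shows "interval_index T t = i"
  unfolding interval_index_def
proof (rule Least_equality)
  show "t < T (Suc i)" by fact
  show "i \<le> j" if "t < T (Suc j)" for j
    using that assms by (meson le_less_trans not_less_eq_eq not_le strict_mono_less)
qed

section \<open>The schedule of runs and visits\<close>

text \<open>The pair is (\<open>run_start i\<close>, \<open>visit i\<close>), and \<open>k\<close>
  is \<open>half_run i\<close>. The recursion is joint because \<open>k\<close> has to dominate
  both. The final \<open>+ 2\<close> in each component makes room for two symbols 1, which cancel in
  the orientation. The initial value 21 is odd, so that the orientation at the visits is negative,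
  and large enough to start \<open>loss_visit\<close>.\<close>

fun times :: "nat \<Rightarrow> nat \<times> nat" where
  "times 0 = (0, 21)"
| "times (Suc i) = (let (n, T) = times i; k = Suc i * (T + n + 1)
     in (n + 2 * k + 2, T + 1 + n + 32 * k + 2))"

definition run_start :: "nat \<Rightarrow> nat" where "run_start i = fst (times i)"
definition visit :: "nat \<Rightarrow> nat" where "visit i = snd (times i)"
definition half_run :: "nat \<Rightarrow> nat" where
  "half_run i = Suc i * (visit i + run_start i + 1)"

lemma run_start_0 [simp]: "run_start 0 = 0"
  by (simp add: run_start_def)

lemma visit_0 [simp]: "visit 0 = 21"
  by (simp add: visit_def)

lemma run_start_Suc: "run_start (Suc i) = run_start i + 2 * half_run i + 2"
  by (simp add: run_start_def half_run_def visit_def Let_def case_prod_unfold)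

lemma visit_Suc: "visit (Suc i) = visit i + 1 + run_start i + 32 * half_run i + 2"
  by (simp add: run_start_def half_run_def visit_def Let_def case_prod_unfold)

lemma strict_mono_run_start: "strict_mono run_start"
  by (simp add: strict_mono_Suc_iff run_start_Suc)

lemma strict_mono_visit: "strict_mono visit"
  by (simp add: strict_mono_Suc_iff visit_Suc)

lemma visit_ge: "21 \<le> visit i"
  using strict_mono_less_eq[OF strict_mono_visit, of 0 i] by simp

text \<open>The bound on the derivative at the i-th visit falls short of 2 ^ (23 *
  \<open>visit i\<close>) by the factor 2 ^ (16 * \<open>loss i\<close>). Visit j contributes the
  time during which its image follows \<open>itin1\<close>, plus 1 for the inflection step
  itself.\<close>

definition loss :: "nat \<Rightarrow> nat" where
  "loss i = (\<Sum>j<i. run_start j + 2 * half_run j + 1)"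

lemma loss_0 [simp]: "loss 0 = 0"
  by (simp add: loss_def)

lemma loss_Suc: "loss (Suc i) = loss i + (run_start i + 2 * half_run i + 1)"
  by (simp add: loss_def)

lemma half_run_ge: "visit i + run_start i + 1 \<le> half_run i"
  by (simp add: half_run_def)

text \<open>In the induction step \<open>half_run i\<close> enters with factor 16 * 4 on the left
  and 5 * 32 on the right; the surplus absorbs the rest. The additional
  \<open>run_start i + 1\<close> covers a point that separates within the copied part of block
  i.\<close>

lemma loss_visit: "16 * (loss i + run_start i + 1) \<le> 5 * visit i"
proof (induction i)
  case 0
  then show ?case by simp
next
  case (Suc i)
  then show ?case
    using half_run_ge[of i] visit_ge[of i] unfolding loss_Suc run_start_Suc visit_Suc
    by (simp add: algebra_simps)
qed

lemma loss_run_end: "16 * loss (Suc i) \<le> 5 * (visit i + 1 + run_start i + 32 * half_run i)"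
  using loss_visit[of i] unfolding loss_Suc by (simp add: algebra_simps)

text \<open>The two critical itineraries.  Symbol 0 is the branch at the fixed point 0, symbol 1 the
  orientation reversing branch, symbol 2 the branch containing the inflection point.  The block
  following the \<open>i\<close>-th symbol 2 of the second itinerary copies the first itinerary up to the
  \<open>i\<close>-th run of zeros, but its run is 16 times longer.\<close>

definition itin1 :: "nat \<Rightarrow> nat" where
  "itin1 j = (let i = interval_index run_start j in if j < run_start i + 2 * half_run i then 0 else 1)"

definition itin2 :: "nat \<Rightarrow> nat" where
  "itin2 j = (if j < 21 then 1 else
     let i = interval_index visit j; r = j - visit i in
       if r = 0 then 2 else if r \<le> run_start i then itin1 (r - 1)
       else if r \<le> run_start i + 32 * half_run i then 0 else 1)"

lemma itin1_run: "run_start i \<le> j \<Longrightarrow> j < run_start i + 2 * half_run i \<Longrightarrow> itin1 j = 0"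
  using interval_index_eq[OF strict_mono_run_start, of i j]
  by (simp add: itin1_def run_start_Suc)

lemma itin1_end:
  "itin1 (run_start i + 2 * half_run i) = 1" "itin1 (Suc (run_start i + 2 * half_run i)) = 1"
  using interval_index_eq[OF strict_mono_run_start, of i "run_start i + 2 * half_run i"]
    interval_index_eq[OF strict_mono_run_start, of i "Suc (run_start i + 2 * half_run i)"]
  by (simp_all add: itin1_def run_start_Suc)

lemma itin1_le: "itin1 j \<le> 1"
  by (simp add: itin1_def Let_def)

lemma itin2_init: "j < 21 \<Longrightarrow> itin2 j = 1"
  by (simp add: itin2_def)

lemma itin2_block:
  assumes "visit i \<le> j" "j < visit (Suc i)"
  shows "itin2 j = (let r = j - visit i in
       if r = 0 then 2 else if r \<le> run_start i then itin1 (r - 1)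
       else if r \<le> run_start i + 32 * half_run i then 0 else 1)"
  using interval_index_eq[OF strict_mono_visit assms] visit_ge[of i] assms
  by (simp add: itin2_def Let_def)

lemma itin2_visit: "itin2 (visit i) = 2"
  using itin2_block[of i "visit i"] by (simp add: visit_Suc)

lemma itin2_copy: "j < run_start i \<Longrightarrow> itin2 (visit i + 1 + j) = itin1 j"
  using itin2_block[of i "visit i + 1 + j"] by (simp add: visit_Suc)

lemma itin2_run:
  assumes "j < 32 * half_run i"
  shows "itin2 (visit i + 1 + run_start i + j) = 0"
  using itin2_block[of i "visit i + 1 + run_start i + j"] assms by (simp add: visit_Suc)

lemma itin2_end:
  "itin2 (visit i + 1 + run_start i + 32 * half_run i) = 1"
  "itin2 (Suc (visit i + 1 + run_start i + 32 * half_run i)) = 1"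
  using itin2_block[of i "visit i + 1 + run_start i + 32 * half_run i"]
    itin2_block[of i "Suc (visit i + 1 + run_start i + 32 * half_run i)"]
  by (simp_all add: visit_Suc)

lemma itin2_agrees: "j < run_start i + 2 * half_run i \<Longrightarrow> itin2 (visit i + 1 + j) = itin1 j"
proof (cases "j < run_start i")
  case True
  then show ?thesis by (rule itin2_copy)
next
  case False
  assume "j < run_start i + 2 * half_run i"
  with False show ?thesis
    using itin2_run[of "j - run_start i" i] itin1_run[of i j] by simp
qed

lemma itin2_le: "itin2 j \<le> 2"
  using itin1_le by (auto simp: itin2_def Let_def intro: le_trans[of _ 1])

lemma itin2_not_visit:
  assumes "visit i < j" "j < visit (Suc i)"
  shows "itin2 j \<le> 1"
  using itin2_block[of i j] assms itin1_le by (auto simp: Let_def)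

section \<open>Orientation along an itinerary\<close>

definition orientation :: "(nat \<Rightarrow> nat) \<Rightarrow> nat \<Rightarrow> real" where
  "orientation s t = (\<Prod>j<t. if s j = 1 then -1 else 1)"

lemma orientation_0 [simp]: "orientation s 0 = 1"
  by (simp add: orientation_def)

lemma orientation_Suc: "orientation s (Suc t) = orientation s t * (if s t = 1 then -1 else 1)"
  by (simp add: orientation_def)

lemma orientation_cases: "orientation s t = 1 \<or> orientation s t = -1"
  by (induction t) (auto simp: orientation_Suc)

lemma orientation_add: "orientation s (t + r) = orientation s t * orientation (\<lambda>j. s (t + j)) r"
  by (induction r) (simp_all add: orientation_Suc algebra_simps)

lemma orientation_cong: "(\<And>j. j < t \<Longrightarrow> s j = s' j) \<Longrightarrow> orientation s t = orientation s' t"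
  unfolding orientation_def by (intro prod.cong) auto

lemma orientation_eq_1: "(\<And>j. j < t \<Longrightarrow> s j \<noteq> 1) \<Longrightarrow> orientation s t = 1"
  unfolding orientation_def by (intro prod.neutral) auto

lemma orientation_itin1_run:
  assumes "orientation itin1 (run_start i) = 1" "r \<le> 2 * half_run i"
  shows "orientation itin1 (run_start i + r) = 1"
proof -
  have "orientation (\<lambda>j. itin1 (run_start i + j)) r = 1"
    by (rule orientation_eq_1) (use assms(2) itin1_run[of i] in auto)
  then show ?thesis using assms(1) by (simp add: orientation_add)
qed

text \<open>Zeros do not change the sign, and the two symbols 1 after each run cancel.\<close>

lemma orientation_itin1: "orientation itin1 (run_start i) = 1"
proof (induction i)
  case 0
  then show ?case by simp
next
  case (Suc i)
  have "orientation itin1 (run_start i + 2 * half_run i) = 1"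
    using orientation_itin1_run[OF Suc] by simp
  then show ?case
    using itin1_end[of i] by (simp add: run_start_Suc orientation_Suc)
qed

lemma orientation_itin2_block:
  assumes "orientation itin2 (visit i) = -1" "r \<le> 32 * half_run i"
  shows "orientation itin2 (visit i + 1 + run_start i + r) = -1"
proof -
  have "orientation itin2 (visit i + 1) = -1"
    using assms(1) itin2_visit[of i] by (simp add: orientation_Suc)
  moreover have "orientation (\<lambda>j. itin2 (visit i + 1 + j)) (run_start i) = orientation itin1 (run_start i)"
    by (rule orientation_cong) (rule itin2_copy)
  ultimately have "orientation itin2 (visit i + 1 + run_start i) = -1"
    using orientation_add[of itin2 "visit i + 1" "run_start i"] orientation_itin1[of i] by simp
  moreover have "orientation (\<lambda>j. itin2 (visit i + 1 + run_start i + j)) r = 1"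
    by (rule orientation_eq_1) (use assms(2) itin2_run[of _ i] in auto)
  ultimately show ?thesis using orientation_add[of itin2 "visit i + 1 + run_start i" r] by simp
qed

text \<open>The 21 initial symbols 1 give the sign -1. Each block preserves it: the copied part of
  \<open>itin1\<close> has sign 1, and the two closing symbols cancel.\<close>

lemma orientation_itin2: "orientation itin2 (visit i) = -1"
proof (induction i)
  case 0
  have "orientation itin2 21 = (\<Prod>j<21::nat. -1)"
    unfolding orientation_def by (intro prod.cong) (auto simp: itin2_init)
  then show ?case by simp
next
  case (Suc i)
  have "orientation itin2 (visit i + 1 + run_start i + 32 * half_run i) = -1"
    using orientation_itin2_block[OF Suc] by simp
  then show ?case
    using itin2_end[of i] by (simp add: visit_Suc orientation_Suc)
qed

section \<open>The map\<close>

text \<open>The points realizing the first n symbols form a decreasing sequence of compact sets.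
  They are nonempty since a point of \<open>R n\<close> can be pulled back step by step through the
  covers.\<close>

lemma itinerary_realized:
  fixes F :: "real \<Rightarrow> real" and R :: "nat \<Rightarrow> real set"
  assumes compact: "\<And>j. compact (R j)" and ne: "\<And>j. R j \<noteq> {}"
    and cont: "\<And>j. continuous_on (R j) F"
    and cover: "\<And>j. R (Suc j) \<subseteq> F ` R j"
  shows "\<exists>x. \<forall>j. (F ^^ j) x \<in> R j"
proof -
  define C where "C n = {x. \<forall>j\<le>n. (F ^^ j) x \<in> R j}" for n
  have C_Suc: "C (Suc n) = C n \<inter> (F ^^ Suc n) -` R (Suc n)" for n
    by (auto simp: C_def le_Suc_eq)
  have C: "closed (C n) \<and> continuous_on (C n) (F ^^ Suc n)" for n
  proof (induction n)
    case 0
    have "C 0 = R 0" by (auto simp: C_def)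
    then show ?case using compact_imp_closed[OF compact[of 0]] cont[of 0] by (simp add: o_def)
  next
    case (Suc n)
    have "closed (C (Suc n))"
      unfolding C_Suc using Suc compact_imp_closed[OF compact] by (intro continuous_closed_preimage) auto
    moreover have "continuous_on (C (Suc n)) (F \<circ> (F ^^ Suc n))"
    proof (rule continuous_on_compose)
      show "continuous_on (C (Suc n)) (F ^^ Suc n)"
        using Suc by (auto simp: C_Suc intro: continuous_on_subset)
      show "continuous_on ((F ^^ Suc n) ` C (Suc n)) F"
        by (rule continuous_on_subset[OF cont[of "Suc n"]]) (auto simp: C_Suc)
    qed
    ultimately show ?case by simp
  qed
  have reach: "\<exists>x\<in>C n. (F ^^ n) x = y" if "y \<in> R n" for n y
    using that
  proof (induction n arbitrary: y)
    case 0
    then show ?case by (auto simp: C_def)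
  next
    case (Suc n)
    then obtain z where z: "z \<in> R n" "F z = y" using cover[of n] by auto
    then obtain x where "x \<in> C n" "(F ^^ n) x = z" using Suc.IH by blast
    with z Suc.prems show ?case by (intro bexI[of _ x]) (auto simp: C_Suc)
  qed
  have "\<exists>a. \<forall>n. a \<in> C n"
  proof (rule bounded_closed_nest[of C])
    show "closed (C n)" for n using C by blast
    show "C n \<noteq> {}" for n using reach ne[of n] by blast
    show "C n \<subseteq> C m" if "m \<le> n" for m n using that by (auto simp: C_def)
    show "bounded (C 0)" using compact_imp_bounded[OF compact[of 0]] by (simp add: C_def)
  qed blast
  then show ?thesis by (auto simp: C_def)
qed

definition slope :: real where "slope = 2 ^ 24"
definition radius :: real where "radius = 1000 * slope"

definition hump :: "real \<Rightarrow> real" where "hump x = slope * x * (1 - 4 * x) * (1 - x)"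
definition inflection :: "real \<Rightarrow> real \<Rightarrow> real" where "inflection v x = v + slope * (x - 1) ^ 3"
definition valley :: "real \<Rightarrow> real \<Rightarrow> real" where "valley v x = v + slope * (x - 2)\<^sup>2 * (x - 1)"

text \<open>Rational enclosures of the parts of {0..3} that return to {0..3}; the two inner
  transition zones lie in the gaps between them.\<close>

definition branch :: "nat \<Rightarrow> real set" where
  "branch c = (if c = 0 then {0..1/20} else if c = 1 then {1/5..1/4}
     else if c = 2 then {17/20..23/20} else {19/10..21/10})"

lemma compact_branch: "compact (branch c)"
  by (simp add: branch_def)

lemma branch_nonempty: "branch c \<noteq> {}"
  by (simp add: branch_def)

lemma branch_subset: "branch c \<subseteq> {0..3}"
  by (auto simp: branch_def)

lemma continuous_on_hump: "continuous_on S hump"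
  unfolding hump_def[abs_def] by (intro continuous_intros)

lemma continuous_on_inflection: "continuous_on S (inflection v)"
  unfolding inflection_def[abs_def] by (intro continuous_intros)

lemma hump_branch:
  assumes "c \<le> 1"
  shows "{0..3} \<subseteq> hump ` branch c"
proof
  fix y :: real assume y: "y \<in> {0..3}"
  have "c = 0 \<or> c = 1" using assms by auto
  then show "y \<in> hump ` branch c"
  proof
    assume c: "c = 0"
    have "\<exists>x\<ge>0. x \<le> 1/20 \<and> hump x = y"
      using y continuous_on_hump by (intro IVT') (auto simp: hump_def slope_def)
    then show ?thesis using c by (auto simp: branch_def)
  next
    assume c: "c = 1"
    have "\<exists>x\<ge>1/5. x \<le> 1/4 \<and> hump x = y"
      using y continuous_on_hump by (intro IVT2') (auto simp: hump_def slope_def)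
    then show ?thesis using c by (auto simp: branch_def)
  qed
qed

lemma inflection_branch:
  assumes "0 \<le> v" "v \<le> 1"
  shows "{0..3} \<subseteq> inflection v ` branch 2"
proof
  fix y :: real assume y: "y \<in> {0..3}"
  have "\<exists>x\<ge>17/20. x \<le> 23/20 \<and> inflection v x = y"
    using y assms continuous_on_inflection
    by (intro IVT') (auto simp: inflection_def slope_def power3_eq_cube)
  then show "y \<in> inflection v ` branch 2" by (auto simp: branch_def)
qed

text \<open>The map contains this value as a parameter. There is no circularity: the itinerary uses
  only symbols 0 and 1, where the map is \<open>hump\<close>.\<close>

definition crit_value1 :: real where
  "crit_value1 = (SOME x. \<forall>j. (hump ^^ j) x \<in> branch (itin1 j))"

lemma hump_crit_value1: "(hump ^^ j) crit_value1 \<in> branch (itin1 j)"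
proof -
  have "\<exists>x. \<forall>j. (hump ^^ j) x \<in> branch (itin1 j)"
  proof (rule itinerary_realized)
    show "branch (itin1 (Suc j)) \<subseteq> hump ` branch (itin1 j)" for j
      using hump_branch[OF itin1_le] branch_subset by blast
  qed (simp_all add: compact_branch branch_nonempty continuous_on_hump)
  from someI_ex[OF this] show ?thesis unfolding crit_value1_def by blast
qed

lemma crit_value1_bounds: "0 \<le> crit_value1" "crit_value1 \<le> 1/4"
  using hump_crit_value1[of 0] itin1_le[of 0] by (auto simp: branch_def split: if_splits)

text \<open>As much of the map as is known before the second critical value is chosen. It suffices
  because \<open>itin2\<close> never uses the fold.\<close>

definition pre_map :: "real \<Rightarrow> real" where
  "pre_map x = (if x \<le> 1/2 then hump x else inflection crit_value1 x)"

lemma pre_map_branch: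
  "c \<le> 1 \<Longrightarrow> x \<in> branch c \<Longrightarrow> pre_map x = hump x"
  "x \<in> branch 2 \<Longrightarrow> pre_map x = inflection crit_value1 x"
  by (auto simp: pre_map_def branch_def split: if_splits)

definition crit_value2 :: real where
  "crit_value2 = (SOME x. \<forall>j. (pre_map ^^ j) x \<in> branch (itin2 j))"

lemma pre_map_crit_value2: "(pre_map ^^ j) crit_value2 \<in> branch (itin2 j)"
proof -
  have *: "continuous_on (branch c) pre_map \<and> {0..3} \<subseteq> pre_map ` branch c" if "c \<le> 2" for c
  proof (cases "c = 2")
    case True
    have "pre_map x = inflection crit_value1 x" if "x \<in> branch c" for x
      using pre_map_branch(2) that True by blast
    then show ?thesis
      using True inflection_branch[of crit_value1] crit_value1_bounds continuous_on_inflection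
      by (simp cong: continuous_on_cong image_cong)
  next
    case False
    with \<open>c \<le> 2\<close> have "c \<le> 1" by simp
    moreover have "pre_map x = hump x" if "x \<in> branch c" for x
      using pre_map_branch(1) that \<open>c \<le> 1\<close> by blast
    ultimately show ?thesis
      using hump_branch continuous_on_hump by (simp cong: continuous_on_cong image_cong)
  qed
  have "\<exists>x. \<forall>j. (pre_map ^^ j) x \<in> branch (itin2 j)"
  proof (rule itinerary_realized)
    show "branch (itin2 (Suc j)) \<subseteq> pre_map ` branch (itin2 j)" for j
      using *[OF itin2_le] branch_subset by blast
  qed (simp_all add: compact_branch branch_nonempty * itin2_le)
  from someI_ex[OF this] show ?thesis unfolding crit_value2_def by blast
qed

lemma crit_value2_bounds: "0 \<le> crit_value2" "crit_value2 \<le> 1/4"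
  using pre_map_crit_value2[of 0] by (auto simp: branch_def itin2_init)

section \<open>Assembling the map\<close>

text \<open>A contraction by 1/2 towards the fixed point \<open>- radius\<close>. As
  \<open>radius\<close> is 1000 * \<open>slope\<close>, the line lies far below \<open>hump\<close>
  on the left transition zone, the order that \<open>glue_deriv_pos\<close> requires;
  \<open>right_line\<close> plays the same part above \<open>valley\<close>.\<close>

definition left_line :: "real \<Rightarrow> real" where "left_line x = (x - radius) / 2"
definition right_line :: "real \<Rightarrow> real" where "right_line x = (x + radius) / 2"

definition f0 :: "real \<Rightarrow> real" where
  "f0 = glue 3 4 (glue (6/5) (5/4) (glue (3/4) (4/5)
     (glue (-2) (-1) left_line hump) (inflection crit_value1)) (valley crit_value2)) right_line"

lemma hump_smooth: "hump \<in> smooth_funs"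
  unfolding hump_def[abs_def]
  by (intro smooth_funs.mult smooth_funs_diff smooth_funs.const smooth_funs.id)

lemma inflection_smooth: "inflection v \<in> smooth_funs"
  unfolding inflection_def[abs_def]
  by (intro smooth_funs.add smooth_funs.mult smooth_funs_diff smooth_funs_power smooth_funs.const smooth_funs.id)

lemma valley_smooth: "valley v \<in> smooth_funs"
  unfolding valley_def[abs_def]
  by (intro smooth_funs.add smooth_funs.mult smooth_funs_diff smooth_funs_power smooth_funs.const smooth_funs.id)

lemma line_smooth: "left_line \<in> smooth_funs" "right_line \<in> smooth_funs"
  unfolding left_line_def[abs_def] right_line_def[abs_def] divide_inverse
  by (intro smooth_funs.add smooth_funs.mult smooth_funs_diff smooth_funs.const smooth_funs.id)+

lemma f0_smooth: "f0 \<in> smooth_funs"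
  unfolding f0_def
  by (intro glue_smooth hump_smooth inflection_smooth valley_smooth line_smooth) simp_all

lemma hump_deriv: "(hump has_real_derivative slope * (1 - 10 * x + 12 * x\<^sup>2)) (at x)"
  unfolding hump_def[abs_def]
  by (auto intro!: derivative_eq_intros simp: algebra_simps power2_eq_square)

lemma inflection_deriv: "(inflection v has_real_derivative 3 * slope * (x - 1)\<^sup>2) (at x)"
  unfolding inflection_def[abs_def]
  by (auto intro!: derivative_eq_intros)

lemma valley_deriv: "(valley v has_real_derivative slope * (x - 2) * (3 * x - 4)) (at x)"
  unfolding valley_def[abs_def]
  by (auto intro!: derivative_eq_intros simp: algebra_simps power2_eq_square)

lemma line_deriv:
  "(left_line has_real_derivative 1/2) (at x)" "(right_line has_real_derivative 1/2) (at x)"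
  unfolding left_line_def[abs_def] right_line_def[abs_def]
  by (auto intro!: derivative_eq_intros)

lemma f0_left: "x < 3/4 \<Longrightarrow> f0 x = glue (-2) (-1) left_line hump x"
  by (simp add: f0_def glue_left)

lemma f0_mid1: "-1 < x \<Longrightarrow> x < 6/5 \<Longrightarrow> f0 x = glue (3/4) (4/5) hump (inflection crit_value1) x"
  by (simp add: f0_def glue_left) (simp add: glue_def[of "3/4"] glue_right)

lemma f0_mid2: "4/5 < x \<Longrightarrow> x < 3 \<Longrightarrow>
    f0 x = glue (6/5) (5/4) (inflection crit_value1) (valley crit_value2) x"
  by (simp add: f0_def glue_left) (simp add: glue_def[of "6/5"] glue_right)

lemma f0_right: "5/4 < x \<Longrightarrow> f0 x = glue 3 4 (valley crit_value2) right_line x"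
  by (simp add: f0_def glue_def[of 3] glue_right)

lemma f0_eqs:
  "x \<le> -2 \<Longrightarrow> f0 x = left_line x"
  "-1 \<le> x \<Longrightarrow> x \<le> 3/4 \<Longrightarrow> f0 x = hump x"
  "4/5 \<le> x \<Longrightarrow> x \<le> 6/5 \<Longrightarrow> f0 x = inflection crit_value1 x"
  "5/4 \<le> x \<Longrightarrow> x \<le> 3 \<Longrightarrow> f0 x = valley crit_value2 x"
  "4 \<le> x \<Longrightarrow> f0 x = right_line x"
  by (simp_all add: f0_def glue_left glue_right)

lemma f0_deriv_hump:
  "-1 < x \<Longrightarrow> x < 3/4 \<Longrightarrow> deriv f0 x = slope * (1 - 10 * x + 12 * x\<^sup>2)"
  by (rule DERIV_imp_deriv, rule has_field_derivative_transform_within_open[OF hump_deriv, of "{-1<..<3/4}"])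
     (auto simp: f0_eqs)

lemma f0_deriv_inflection:
  "4/5 < x \<Longrightarrow> x < 6/5 \<Longrightarrow> deriv f0 x = 3 * slope * (x - 1)\<^sup>2"
  by (rule DERIV_imp_deriv, rule has_field_derivative_transform_within_open[OF inflection_deriv, of "{4/5<..<6/5}"])
     (auto simp: f0_eqs)

lemma f0_deriv_valley:
  "5/4 < x \<Longrightarrow> x < 3 \<Longrightarrow> deriv f0 x = slope * (x - 2) * (3 * x - 4)"
  by (rule DERIV_imp_deriv, rule has_field_derivative_transform_within_open[OF valley_deriv, of "{5/4<..<3}"])
     (auto simp: f0_eqs)

lemma deriv_f0_cong:
  assumes "open S" "x \<in> S" "\<And>y. y \<in> S \<Longrightarrow> f0 y = g y"
  shows "deriv f0 x = deriv g x"
  using higher_deriv_cong[OF assms(1,3,2), where k = 1] by simp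

lemma left_zone: "-2 \<le> x \<Longrightarrow> x \<le> -1 \<Longrightarrow> left_line x \<le> hump x"
proof -
  assume x: "-2 \<le> x" "x \<le> -1"
  have "- x * ((1 - 4 * x) * (1 - x)) \<le> 2 * (9 * 3)"
    using x by (intro mult_mono) auto
  then have "slope * (- x * ((1 - 4 * x) * (1 - x))) \<le> slope * 54"
    by (intro mult_left_mono) (auto simp: slope_def)
  moreover have "hump x = - (slope * (- x * ((1 - 4 * x) * (1 - x))))"
    by (simp add: hump_def algebra_simps)
  moreover have "left_line x \<le> - (slope * 54)"
    using x by (simp add: left_line_def radius_def slope_def)
  ultimately show ?thesis by linarith
qed

lemma mid_zone1: "3/4 \<le> x \<Longrightarrow> x \<le> 4/5 \<Longrightarrow> hump x \<le> inflection crit_value1 x"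
proof -
  assume x: "3/4 \<le> x" "x \<le> 4/5"
  have "3/4 * (2 * (1/5)) \<le> x * ((4 * x - 1) * (1 - x))"
    using x by (intro mult_mono) auto
  moreover have "(1 - x) ^ 3 \<le> (1/4) ^ 3"
    using x by (intro power_mono) auto
  then have "- 1/64 \<le> (x - 1) ^ 3"
    by (simp add: power3_eq_cube algebra_simps)
  ultimately show ?thesis
    using crit_value1_bounds by (simp add: inflection_def hump_def slope_def algebra_simps)
qed

lemma mid_zone2: "6/5 \<le> x \<Longrightarrow> x \<le> 5/4 \<Longrightarrow> inflection crit_value1 x \<le> valley crit_value2 x"
proof -
  assume x: "6/5 \<le> x" "x \<le> 5/4"
  have "(3/4)\<^sup>2 \<le> (2 - x)\<^sup>2"
    using x by (intro power_mono) auto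
  then have "(3/4)\<^sup>2 * (1/5) \<le> (x - 2)\<^sup>2 * (x - 1)"
    using x by (intro mult_mono) (auto simp: power2_commute)
  moreover have "(x - 1) ^ 3 \<le> (1/4) ^ 3"
    using x by (intro power_mono) auto
  ultimately show ?thesis
    using crit_value1_bounds crit_value2_bounds
    by (simp add: inflection_def valley_def slope_def power_divide)
qed

lemma right_zone: "3 \<le> x \<Longrightarrow> x \<le> 4 \<Longrightarrow> valley crit_value2 x \<le> right_line x"
proof -
  assume x: "3 \<le> x" "x \<le> 4"
  have "(x - 2)\<^sup>2 * (x - 1) \<le> 2\<^sup>2 * 3"
    using x by (intro mult_mono power_mono) auto
  then show ?thesis
    using x crit_value2_bounds by (simp add: valley_def right_line_def radius_def slope_def)
qed

lemma slope_pos: "0 < slope"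
  by (simp add: slope_def)

lemma hump_deriv_pos: "x \<le> 0 \<or> 3/4 \<le> x \<Longrightarrow> 0 < slope * (1 - 10 * x + 12 * x\<^sup>2)"
proof -
  assume "x \<le> 0 \<or> 3/4 \<le> x"
  then have "0 < 1 - 10 * x + 12 * x\<^sup>2"
  proof
    assume "3/4 \<le> x"
    then have "0 \<le> (x - 3/4) * (12 * x - 1)"
      by (intro mult_nonneg_nonneg) auto
    then show ?thesis by (simp add: algebra_simps power2_eq_square)
  qed (auto intro: add_pos_nonneg)
  then show ?thesis using slope_pos by simp
qed

lemma f0_deriv_left:
  assumes "x < 0"
  shows "0 < deriv f0 x"
proof -
  consider "x < -2" | "-2 \<le> x" "x \<le> -1" | "-1 < x" by linarith
  then show ?thesis
  proof cases
    case 1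
    have "(f0 has_real_derivative 1/2) (at x)"
      by (rule has_field_derivative_transform_within_open[OF line_deriv(1), of "{..<-2}"])
         (use 1 in \<open>auto simp: f0_eqs\<close>)
    then show ?thesis by (simp add: DERIV_imp_deriv)
  next
    case 2
    have "deriv f0 x = deriv (glue (-2) (-1) left_line hump) x"
      by (rule deriv_f0_cong[of "{..<0}"]) (use assms in \<open>auto intro: f0_left\<close>)
    then show ?thesis
      using glue_deriv_pos[OF _ line_deriv(1) hump_deriv, of "-2" "-1" x] hump_deriv_pos[of x] left_zone[of x] 2
      by simp
  next
    case 3
    then show ?thesis using f0_deriv_hump[of x] hump_deriv_pos[of x] assms by simp
  qed
qed

lemma f0_deriv_mid1:
  assumes "3/4 \<le> x" "x \<le> 4/5"
  shows "0 < deriv f0 x"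
proof -
  have "deriv f0 x = deriv (glue (3/4) (4/5) hump (inflection crit_value1)) x"
    by (rule deriv_f0_cong[of "{-1<..<6/5}"]) (use assms in \<open>auto intro: f0_mid1\<close>)
  then show ?thesis
    using glue_deriv_pos[OF _ hump_deriv inflection_deriv, of "3/4" "4/5" x crit_value1]
      hump_deriv_pos[of x] mid_zone1[of x] assms slope_pos by simp
qed

lemma f0_deriv_mid2:
  assumes "6/5 \<le> x" "x \<le> 5/4"
  shows "0 < deriv f0 x"
proof -
  have "deriv f0 x = deriv (glue (6/5) (5/4) (inflection crit_value1) (valley crit_value2)) x"
    by (rule deriv_f0_cong[of "{4/5<..<3}"]) (use assms in \<open>auto intro: f0_mid2\<close>)
  moreover have "0 < slope * (x - 2) * (3 * x - 4)"
    using assms slope_pos mult_neg_neg[of "x - 2" "3 * x - 4"] by (simp add: mult.assoc)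
  ultimately show ?thesis
    using glue_deriv_pos[OF _ inflection_deriv valley_deriv, of "6/5" "5/4" x crit_value1 crit_value2]
      mid_zone2[of x] assms slope_pos by simp
qed

lemma f0_deriv_right:
  assumes "2 < x"
  shows "0 < deriv f0 x"
proof -
  have v: "0 < slope * (x - 2) * (3 * x - 4)"
    using assms slope_pos by simp
  consider "x < 3" | "3 \<le> x" "x \<le> 4" | "4 < x" by linarith
  then show ?thesis
  proof cases
    case 1
    then show ?thesis using f0_deriv_valley[of x] assms v by simp
  next
    case 2
    have "deriv f0 x = deriv (glue 3 4 (valley crit_value2) right_line) x"
      by (rule deriv_f0_cong[of "{5/4<..}"]) (use assms in \<open>auto intro: f0_right\<close>)
    then show ?thesis
      using glue_deriv_pos[OF _ valley_deriv line_deriv(2), of 3 4 x crit_value2] v right_zone[of x] 2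
      by simp
  next
    case 3
    have "(f0 has_real_derivative 1/2) (at x)"
      by (rule has_field_derivative_transform_within_open[OF line_deriv(2), of "{4<..}"])
         (use 3 in \<open>auto simp: f0_eqs\<close>)
    then show ?thesis by (simp add: DERIV_imp_deriv)
  qed
qed

lemma f0_has_deriv: "(f0 has_real_derivative deriv f0 x) (at x)"
  by (rule smooth_funs_deriv(2)[OF f0_smooth])

lemma continuous_on_f0: "continuous_on S f0"
  using f0_has_deriv by (meson DERIV_isCont continuous_at_imp_continuous_on)

text \<open>The derivative is positive on the outer parts and on the inner transition zones, so
  critical points occur only where the map is a cubic polynomial.\<close>

lemma f0_crit:
  assumes "deriv f0 x = 0"
  shows "x \<in> {0<..<3/4} \<union> {4/5<..<6/5} \<union> {5/4<..2}"
proof (rule ccontr)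
  assume "\<not> ?thesis"
  then consider "x < 0" | "x = 0" | "3/4 \<le> x \<and> x \<le> 4/5" | "6/5 \<le> x \<and> x \<le> 5/4" | "2 < x"
    by force
  then show False
    using f0_deriv_left[of x] f0_deriv_mid1[of x] f0_deriv_mid2[of x]
      f0_deriv_right[of x] f0_deriv_hump[of x] assms
    by cases (auto simp: slope_def)
qed

lemma f0_third_deriv:
  assumes "deriv f0 x = 0"
  shows "(deriv ^^ 3) f0 x \<noteq> 0"
proof -
  consider "x \<in> {0<..<3/4}" | "x \<in> {4/5<..<6/5}" | "x \<in> {5/4<..<3}"
    using f0_crit[OF assms] by force
  then show ?thesis
  proof cases
    case 1
    have "(deriv ^^ 3) f0 x = (deriv ^^ 3) hump x"
      by (rule higher_deriv_cong[of "{0<..<3/4}"]) (use 1 in \<open>auto simp: f0_eqs\<close>)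
    also have "\<dots> = 6 * (4 * slope)"
      by (rule higher_deriv_cubic[of _ 0 slope "- 5 * slope"])
         (simp add: hump_def algebra_simps power2_eq_square power3_eq_cube)
    finally show ?thesis by (simp add: slope_def)
  next
    case 2
    have "(deriv ^^ 3) f0 x = (deriv ^^ 3) (inflection crit_value1) x"
      by (rule higher_deriv_cong[of "{4/5<..<6/5}"]) (use 2 in \<open>auto simp: f0_eqs\<close>)
    also have "\<dots> = 6 * slope"
      by (rule higher_deriv_cubic[of _ "crit_value1 - slope" "3 * slope" "- 3 * slope"])
         (simp add: inflection_def algebra_simps power2_eq_square power3_eq_cube)
    finally show ?thesis by (simp add: slope_def)
  next
    case 3
    have "(deriv ^^ 3) f0 x = (deriv ^^ 3) (valley crit_value2) x"
      by (rule higher_deriv_cong[of "{5/4<..<3}"]) (use 3 in \<open>auto simp: f0_eqs\<close>)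
    also have "\<dots> = 6 * slope"
      by (rule higher_deriv_cubic[of _ "crit_value2 - 4 * slope" "8 * slope" "- 5 * slope"])
         (simp add: valley_def algebra_simps power2_eq_square power3_eq_cube)
    finally show ?thesis by (simp add: slope_def)
  qed
qed

lemma finite_crit: "finite {x. deriv f0 x = 0}"
proof (rule finite_subset)
  let ?p = "[:1, -10, 12:] :: real poly"
  show "{x. deriv f0 x = 0} \<subseteq> {x. poly ?p x = 0} \<union> {1, 2, 4/3}"
  proof
    fix x assume "x \<in> {x. deriv f0 x = 0}"
    then have x: "deriv f0 x = 0" by simp
    consider "x \<in> {0<..<3/4}" | "x \<in> {4/5<..<6/5}" | "x \<in> {5/4<..<3}"
      using f0_crit[OF x] by force
    then show "x \<in> {x. poly ?p x = 0} \<union> {1, 2, 4/3}"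
    proof cases
      case 1
      then have "1 - 10 * x + 12 * x\<^sup>2 = 0" using x f0_deriv_hump[of x] slope_pos by simp
      then show ?thesis by (simp add: algebra_simps power2_eq_square)
    next
      case 2
      then show ?thesis using x f0_deriv_inflection[of x] slope_pos by simp
    next
      case 3
      then show ?thesis using x f0_deriv_valley[of x] slope_pos by auto
    qed
  qed
  show "finite ({x. poly ?p x = 0} \<union> {1, 2, 4/3})"
    using poly_roots_finite[of ?p] by simp
qed

abbreviation I0 :: "real set" where "I0 \<equiv> {- radius..radius}"

lemma radius_ge: "16777216000 \<le> radius"
  by (simp add: radius_def slope_def)

lemma f0_bounds:
  assumes "x \<in> I0"
  shows "f0 x \<in> I0"
proof -
  have rad: "radius = 1000 * slope" "1 \<le> slope" by (simp_all add: radius_def slope_def)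
  have h: "\<bar>hump x\<bar> \<le> 10 * slope" if "\<bar>x\<bar> \<le> 1"
  proof -
    have "\<bar>x\<bar> * (\<bar>1 - 4 * x\<bar> * \<bar>1 - x\<bar>) \<le> 1 * (5 * 2)"
      using that by (intro mult_mono) auto
    then show ?thesis using slope_pos by (simp add: hump_def abs_mult mult.assoc)
  qed
  have i: "\<bar>inflection crit_value1 x\<bar> \<le> 1 + slope" if "\<bar>x - 1\<bar> \<le> 1"
  proof -
    have "\<bar>x - 1\<bar> ^ 3 \<le> 1" using that by (simp add: power_le_one)
    then have "\<bar>slope * (x - 1) ^ 3\<bar> \<le> slope" using slope_pos by (simp add: abs_mult power_abs)
    then show ?thesis using crit_value1_bounds by (simp add: inflection_def)
  qed
  have v: "\<bar>valley crit_value2 x\<bar> \<le> 1 + 12 * slope" if "1 \<le> x" "x \<le> 4"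
  proof -
    have "(x - 2)\<^sup>2 \<le> 2\<^sup>2" using that by (intro power2_le_iff_abs_le[THEN iffD2]) auto
    then have "(x - 2)\<^sup>2 * (x - 1) \<le> 2\<^sup>2 * 3" using that by (intro mult_mono) auto
    then have "slope * ((x - 2)\<^sup>2 * (x - 1)) \<le> slope * 12" using slope_pos by (intro mult_left_mono) auto
    moreover have "0 \<le> slope * ((x - 2)\<^sup>2 * (x - 1))" using that slope_pos by simp
    ultimately show ?thesis
      using crit_value2_bounds unfolding valley_def mult.assoc abs_le_iff by linarith
  qed
  consider "x \<le> -2" | "-2 \<le> x" "x \<le> -1" | "-1 \<le> x" "x \<le> 3/4" | "3/4 \<le> x" "x \<le> 4/5"
    | "4/5 \<le> x" "x \<le> 6/5" | "6/5 \<le> x" "x \<le> 5/4" | "5/4 \<le> x" "x \<le> 3" | "3 \<le> x" "x \<le> 4" | "4 \<le> x"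
    by linarith
  then show ?thesis
  proof cases
    case 1
    then show ?thesis using assms rad by (simp add: f0_eqs left_line_def)
  next
    case 2
    have "hump x \<le> 0" using 2 slope_pos by (simp add: hump_def mult_nonneg_nonpos mult_nonpos_nonneg)
    then show ?thesis
      using 2 rad glue_bounds[of "-2" "-1" left_line x hump] left_zone[of x]
      by (simp add: f0_left left_line_def)
  next
    case 3
    then show ?thesis using h rad by (simp add: f0_eqs abs_le_iff)
  next
    case 4
    then show ?thesis
      using h i rad glue_bounds[of "3/4" "4/5" hump x "inflection crit_value1"] mid_zone1[of x]
      by (simp add: f0_mid1 abs_le_iff)
  next
    case 5
    then show ?thesis using i rad by (simp add: f0_eqs abs_le_iff)
  next
    case 6
    then show ?thesis
      using v i rad glue_bounds[of "6/5" "5/4" "inflection crit_value1" x "valley crit_value2"] mid_zone2[of x]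
      by (simp add: f0_mid2 abs_le_iff)
  next
    case 7
    then show ?thesis using v rad by (simp add: f0_eqs abs_le_iff)
  next
    case 8
    then show ?thesis
      using v rad glue_bounds[of 3 4 "valley crit_value2" x right_line] right_zone[of x]
      by (simp add: f0_right abs_le_iff right_line_def)
  next
    case 9
    then show ?thesis using assms rad by (simp add: f0_eqs right_line_def)
  qed
qed

lemma f0_nondegenerate: "nondegenerate_smooth_map I0 f0"
  unfolding nondegenerate_smooth_map_def
proof (intro conjI ballI impI)
  have ab: "- radius < radius" using radius_ge by simp
  have D: "deriv_within I0 f0 x = deriv f0 x" if "x \<in> I0" for x
    using nderiv_within_eq[OF f0_smooth ab that, of 1] by simp
  show "f0 ` I0 \<subseteq> I0" using f0_bounds by blast
  show "smooth_within I0 f0" by (rule smooth_within_Icc[OF f0_smooth ab])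
  have "f0 0 = f0 (1/4)" by (simp add: f0_eqs hump_def)
  then show "\<not> inj_on f0 I0"
    using radius_ge by (auto dest!: inj_onD[of _ _ 0 "1/4"])
  show "finite {x \<in> I0. deriv_within I0 f0 x = 0}"
    by (rule finite_subset[OF _ finite_crit]) (use D in auto)
  fix x assume x: "x \<in> I0" "deriv_within I0 f0 x = 0"
  have "nderiv_within I0 3 f0 x \<noteq> 0"
    using nderiv_within_eq[OF f0_smooth ab x(1), of 3] f0_third_deriv[of x] D x by simp
  then show "\<exists>k\<ge>2. nderiv_within I0 k f0 x \<noteq> 0" by (intro exI[of _ 3]) simp
qed

section \<open>Expansion on the surviving set\<close>

definition survivors :: "real set" where
  "survivors = {x. \<forall>n. (f0 ^^ n) x \<in> {0..3}}"

definition symbol :: "real \<Rightarrow> nat" where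
  "symbol x = (if x < 1/10 then 0 else if x < 1/2 then 1 else if x < 3/2 then 2 else 3)"

lemma symbol_branch: "x \<in> branch c \<Longrightarrow> c \<le> 3 \<Longrightarrow> symbol x = c"
  by (auto simp: branch_def symbol_def split: if_splits)

lemma survivors_funpow: "x \<in> survivors \<Longrightarrow> (f0 ^^ n) x \<in> survivors"
  unfolding survivors_def by (auto simp flip: funpow_add[unfolded o_def, THEN fun_cong])

lemma survivors_step: "x \<in> survivors \<Longrightarrow> f0 x \<in> survivors"
  using survivors_funpow[of x 1] by simp

lemma survivors_bounds: "x \<in> survivors \<Longrightarrow> 0 \<le> x \<and> x \<le> 3"
  unfolding survivors_def by (auto dest: spec[of _ 0])

text \<open>The gaps leave {0..3} in one step: the map is above 3 between 1/20 and 1/5, below 0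
  between 1/4 and 17/20, and above 3 again between 23/20 and 3 outside a neighbourhood of the
  fold.\<close>

lemma return_branch:
  assumes "x \<in> {0..3}" "f0 x \<in> {0..3}"
  shows "x \<in> branch (symbol x)"
proof -
  have x: "0 \<le> x" "x \<le> 3" and fx: "0 \<le> f0 x" "f0 x \<le> 3" using assms by auto
  consider "x < 1/10" | "1/10 \<le> x" "x < 1/2" | "1/2 \<le> x" "x < 3/2" | "3/2 \<le> x" by linarith
  then show ?thesis
  proof cases
    case 1
    have "x \<le> 1/20"
    proof (rule ccontr)
      assume "\<not> x \<le> 1/20"
      then have "1/20 * (1/2 * (1/2)) \<le> x * ((1 - 4 * x) * (1 - x))"
        using 1 by (intro mult_mono) auto
      then show False using fx 1 x by (simp add: f0_eqs hump_def slope_def)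
    qed
    then show ?thesis using 1 x by (simp add: symbol_def branch_def)
  next
    case 2
    have "x \<le> 1/4"
    proof (rule ccontr)
      assume "\<not> x \<le> 1/4"
      then have "0 < x * ((4 * x - 1) * (1 - x))" using 2 by auto
      then show False using fx 2 by (simp add: f0_eqs hump_def slope_def algebra_simps)
    qed
    moreover have "1/5 \<le> x"
    proof (rule ccontr)
      assume "\<not> 1/5 \<le> x"
      then have "1/10 * (1/5 * (4/5)) \<le> x * ((1 - 4 * x) * (1 - x))"
        using 2 by (intro mult_mono) auto
      then show False using fx 2 by (simp add: f0_eqs hump_def slope_def)
    qed
    ultimately show ?thesis using 2 by (simp add: symbol_def branch_def)
  next
    case 3
    have "17/20 \<le> x"
    proof (rule ccontr)
      assume "\<not> 17/20 \<le> x"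
      then have x': "x < 17/20" by simp
      have h: "hump x < 0"
      proof -
        have "0 < x * ((4 * x - 1) * (1 - x))" using 3 x' by auto
        then show ?thesis by (simp add: hump_def slope_def algebra_simps)
      qed
      have i: "inflection crit_value1 x < 0"
      proof -
        have "(3/20) ^ 3 \<le> (1 - x) ^ 3" using x' by (intro power_mono) auto
        then have "(x - 1) ^ 3 \<le> - ((3/20) ^ 3)"
          by (simp add: power3_eq_cube algebra_simps)
        then show ?thesis using crit_value1_bounds by (simp add: inflection_def slope_def power3_eq_cube)
      qed
      consider "x \<le> 3/4" | "3/4 \<le> x" "x \<le> 4/5" | "4/5 \<le> x" by linarith
      then show False
        by cases (use h i 3 x' fx mid_zone1[of x] glue_bounds(2)[of "3/4" "4/5" hump x "inflection crit_value1"]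
            in \<open>auto simp: f0_eqs f0_mid1\<close>)
    qed
    moreover have "x \<le> 23/20"
    proof (rule ccontr)
      assume "\<not> x \<le> 23/20"
      then have x': "23/20 < x" by simp
      have i: "3 < inflection crit_value1 x"
      proof -
        have "(3/20) ^ 3 \<le> (x - 1) ^ 3" using x' by (intro power_mono) auto
        then show ?thesis
          using crit_value1_bounds by (simp add: inflection_def slope_def power_divide)
      qed
      have v: "3 < valley crit_value2 x"
      proof -
        have "(1/2)\<^sup>2 \<le> (2 - x)\<^sup>2" using 3 by (intro power_mono) auto
        then have "(1/2)\<^sup>2 * (3/20) \<le> (x - 2)\<^sup>2 * (x - 1)"
          using x' by (intro mult_mono) (auto simp: power2_commute)
        then show ?thesis
          using crit_value2_bounds by (simp add: valley_def slope_def power2_eq_square)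
      qed
      consider "x \<le> 6/5" | "6/5 \<le> x" "x \<le> 5/4" | "5/4 \<le> x" by linarith
      then show False
        by cases (use v i 3 x' fx mid_zone2[of x]
              glue_bounds(1)[of "6/5" "5/4" "inflection crit_value1" x "valley crit_value2"]
            in \<open>auto simp: f0_eqs f0_mid2\<close>)
    qed
    ultimately show ?thesis using 3 by (simp add: symbol_def branch_def)
  next
    case 4
    have "\<bar>x - 2\<bar> \<le> 1/10"
    proof (rule ccontr)
      assume "\<not> \<bar>x - 2\<bar> \<le> 1/10"
      then have "(1/10)\<^sup>2 \<le> \<bar>x - 2\<bar>\<^sup>2" by (intro power_mono) auto
      then have "(1/10)\<^sup>2 * (1/2) \<le> (x - 2)\<^sup>2 * (x - 1)"
        using 4 by (intro mult_mono) auto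
      then show False
        using 4 x fx crit_value2_bounds by (simp add: f0_eqs valley_def slope_def power2_eq_square)
    qed
    then show ?thesis using 4 unfolding abs_le_iff by (auto simp: symbol_def branch_def)
  qed
qed

lemma survivors_branch: "x \<in> survivors \<Longrightarrow> x \<in> branch (symbol x)"
  using return_branch survivors_bounds survivors_step by (metis atLeastAtMost_iff)

lemma symbol_le: "symbol x \<le> 3"
  by (simp add: symbol_def)

lemma f0_branch:
  "c \<le> 1 \<Longrightarrow> x \<in> branch c \<Longrightarrow> f0 x = hump x"
  "x \<in> branch 2 \<Longrightarrow> f0 x = inflection crit_value1 x"
  "x \<in> branch 3 \<Longrightarrow> f0 x = valley crit_value2 x"
  by (auto simp: f0_eqs branch_def split: if_splits)

lemma crit_value1_orbit: "(f0 ^^ j) crit_value1 \<in> branch (itin1 j)"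
proof -
  have "(f0 ^^ j) crit_value1 = (hump ^^ j) crit_value1"
    by (induction j) (use hump_crit_value1 itin1_le f0_branch(1) in auto)
  then show ?thesis using hump_crit_value1 by simp
qed

lemma crit_value2_orbit: "(f0 ^^ j) crit_value2 \<in> branch (itin2 j)"
proof -
  have eq: "f0 x = pre_map x" if "x \<in> branch c" "c \<le> 2" for x c
  proof (cases "c = 2")
    case True
    then show ?thesis using that f0_branch(2) pre_map_branch(2) by simp
  next
    case False
    then have "c \<le> 1" using that by simp
    then show ?thesis using that f0_branch(1) pre_map_branch(1) by simp
  qed
  have "(f0 ^^ j) crit_value2 = (pre_map ^^ j) crit_value2"
    by (induction j) (use pre_map_crit_value2 itin2_le eq in auto)
  then show ?thesis using pre_map_crit_value2 by simp
qed

lemma crit_value1_survivor: "crit_value1 \<in> survivors"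
  unfolding survivors_def using crit_value1_orbit branch_subset by blast

lemma crit_value2_survivor: "crit_value2 \<in> survivors"
  unfolding survivors_def using crit_value2_orbit branch_subset by blast

section \<open>Expansion and order on single branches\<close>

text \<open>The divided difference of the cubic is \<open>slope * P\<close>, where \<open>P\<close>
  is at least 1/2 on branch 0 and at most -1/2 on branch 1. The factor 2 given away here is the
  reason for 23 instead of 24 in the lower bounds.\<close>

lemma branch_expand:
  assumes "u \<in> branch c" "w \<in> branch c" "c \<le> 1"
  shows "2 ^ 23 * \<bar>u - w\<bar> \<le> \<bar>f0 u - f0 w\<bar>"
proof -
  define P where "P = 1 - 5 * (u + w) + 4 * (u\<^sup>2 + u * w + w\<^sup>2)"
  have E: "f0 u - f0 w = slope * (u - w) * P"
    using f0_branch(1)[OF assms(3,1)] f0_branch(1)[OF assms(3,2)]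
    by (simp add: hump_def P_def algebra_simps power2_eq_square)
  have "1/2 \<le> \<bar>P\<bar>"
  proof (cases "c = 0")
    case True
    then have uw: "0 \<le> u" "u \<le> 1/20" "0 \<le> w" "w \<le> 1/20" using assms by (auto simp: branch_def)
    then have "0 \<le> u\<^sup>2" "0 \<le> u * w" "0 \<le> w\<^sup>2" by auto
    then have "1/2 \<le> P" using uw unfolding P_def distrib_left by linarith
    then show ?thesis by simp
  next
    case False
    then have uw: "1/5 \<le> u" "u \<le> 1/4" "1/5 \<le> w" "w \<le> 1/4" using assms by (auto simp: branch_def)
    have "0 \<le> (u - 1/5) * (1/4 - u)" "0 \<le> (w - 1/5) * (1/4 - w)"
      using uw by (auto intro: mult_nonneg_nonneg)
    moreover have "2 * (u * w) \<le> u\<^sup>2 + w\<^sup>2"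
      using zero_le_power2[of "u - w"] by (simp add: power2_eq_square algebra_simps)
    ultimately have "P \<le> - 1/2"
      using uw by (simp add: P_def power2_eq_square algebra_simps)
    then show ?thesis by simp
  qed
  then have "\<bar>u - w\<bar> * (1/2) \<le> \<bar>u - w\<bar> * \<bar>P\<bar>" by (intro mult_left_mono) auto
  then have "slope * (\<bar>u - w\<bar> * (1/2)) \<le> slope * (\<bar>u - w\<bar> * \<bar>P\<bar>)"
    by (rule mult_left_mono[OF _ less_imp_le[OF slope_pos]])
  also have "\<dots> = \<bar>f0 u - f0 w\<bar>"
    unfolding E using slope_pos by (simp add: abs_mult)
  finally show ?thesis by (simp add: slope_def)
qed

lemma branch_lipschitz:
  assumes "u \<in> branch c" "w \<in> branch c" "c \<le> 2"
  shows "\<bar>f0 u - f0 w\<bar> \<le> 2 ^ 24 * \<bar>u - w\<bar>"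
proof -
  have "\<exists>P. \<bar>P\<bar> \<le> 1 \<and> f0 u - f0 w = slope * (u - w) * P"
  proof (cases "c = 2")
    case True
    let ?P = "(u - 1)\<^sup>2 + (u - 1) * (w - 1) + (w - 1)\<^sup>2"
    have 1: "\<bar>u - 1\<bar> \<le> 1/5" "\<bar>w - 1\<bar> \<le> 1/5" using True assms unfolding abs_le_iff by (auto simp: branch_def)
    have "\<bar>a * b\<bar> \<le> 1/25" if "\<bar>a\<bar> \<le> 1/5" "\<bar>b\<bar> \<le> 1/5" for a b :: real
      using mult_mono[OF that] by (simp add: abs_mult)
    from this[OF 1(1) 1(1)] this[OF 1] this[OF 1(2) 1(2)] have "\<bar>?P\<bar> \<le> 1"
      unfolding power2_eq_square by linarith
    moreover have "f0 u - f0 w = slope * (u - w) * ?P"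
      using f0_branch(2)[of u] f0_branch(2)[of w] assms True
      by (simp add: inflection_def algebra_simps power2_eq_square power3_eq_cube)
    ultimately show ?thesis by blast
  next
    case False
    then have c: "c \<le> 1" using assms by simp
    let ?P = "1 - 5 * (u + w) + 4 * (u\<^sup>2 + u * w + w\<^sup>2)"
    have uw: "0 \<le> u" "u \<le> 1/4" "0 \<le> w" "w \<le> 1/4" using c assms by (auto simp: branch_def split: if_splits)
    have "u\<^sup>2 \<le> u * (1/4)" "u * w \<le> u * (1/4)" "w\<^sup>2 \<le> w * (1/4)" "0 \<le> u * w"
      using mult_left_mono[OF uw(2,1)] mult_left_mono[OF uw(4,1)] mult_left_mono[OF uw(4,3)] uw
      by (auto simp: power2_eq_square)
    then have "?P \<le> 1" using uw by (simp add: algebra_simps)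
    moreover have "-1 \<le> ?P"
      using uw zero_le_power2[of "u + w - 1/2"] zero_le_power2[of "u - w"]
      by (simp add: power2_eq_square algebra_simps)
    moreover have "f0 u - f0 w = slope * (u - w) * ?P"
      using f0_branch(1)[OF c assms(1)] f0_branch(1)[OF c assms(2)]
      by (simp add: hump_def algebra_simps power2_eq_square)
    ultimately show ?thesis by (intro exI[of _ ?P]) auto
  qed
  then obtain P where P: "\<bar>P\<bar> \<le> 1" "f0 u - f0 w = slope * (u - w) * P" by blast
  have "\<bar>u - w\<bar> * \<bar>P\<bar> \<le> \<bar>u - w\<bar> * 1" using P(1) by (intro mult_left_mono) auto
  moreover have "\<bar>slope * (u - w) * P\<bar> = slope * (\<bar>u - w\<bar> * \<bar>P\<bar>)"
    using slope_pos by (simp add: abs_mult)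
  ultimately show ?thesis using P(2) by (simp add: slope_def)
qed

lemma branch_deriv:
  assumes "u \<in> branch c" "c \<le> 1"
  shows "2 ^ 23 \<le> \<bar>deriv f0 u\<bar>"
proof -
  have u: "0 \<le> u" "u \<le> 1/4" "u \<le> 1/20 \<or> 1/5 \<le> u" using assms by (auto simp: branch_def split: if_splits)
  have "1/2 \<le> \<bar>1 - 10 * u + 12 * u\<^sup>2\<bar>"
  proof (cases "u \<le> 1/20")
    case True
    have "0 \<le> u\<^sup>2" by simp
    then show ?thesis using True by linarith
  next
    case False
    then have "0 \<le> (u - 1/5) * (1/4 - u)" using u by (intro mult_nonneg_nonneg) auto
    then have "1 - 10 * u + 12 * u\<^sup>2 \<le> - 1/2"
      using u False by (simp add: power2_eq_square algebra_simps)
    then show ?thesis by simp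
  qed
  moreover have "\<bar>deriv f0 u\<bar> = slope * \<bar>1 - 10 * u + 12 * u\<^sup>2\<bar>"
    using f0_deriv_hump[of u] u slope_pos by (simp add: abs_mult)
  ultimately show ?thesis by (simp add: slope_def)
qed

lemma branch_mono:
  assumes "u \<in> branch c" "w \<in> branch c" "u \<le> w"
  shows "c = 0 \<or> c = 2 \<Longrightarrow> f0 u \<le> f0 w" and "c = 1 \<Longrightarrow> f0 w \<le> f0 u"
proof -
  show "f0 u \<le> f0 w" if "c = 0 \<or> c = 2"
  proof (rule DERIV_nonneg_imp_nondecreasing[OF assms(3)])
    fix x assume x: "u \<le> x" "x \<le> w"
    have "0 \<le> deriv f0 x"
    proof (cases "c = 0")
      case True
      then have "0 \<le> x" "x \<le> 1/20" using x assms by (auto simp: branch_def)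
      moreover have "0 \<le> x\<^sup>2" by simp
      ultimately have "0 \<le> 1 - 10 * x + 12 * x\<^sup>2" by linarith
      then show ?thesis
        using f0_deriv_hump[of x] slope_pos \<open>0 \<le> x\<close> \<open>x \<le> 1/20\<close> by simp
    next
      case False
      then have "17/20 \<le> x" "x \<le> 23/20" using x assms that by (auto simp: branch_def)
      then show ?thesis using f0_deriv_inflection[of x] slope_pos by simp
    qed
    then show "\<exists>y. (f0 has_real_derivative y) (at x) \<and> 0 \<le> y"
      using f0_has_deriv by blast
  qed
  show "f0 w \<le> f0 u" if c: "c = 1"
  proof (rule DERIV_nonpos_imp_nonincreasing[OF assms(3)])
    fix x assume "u \<le> x" "x \<le> w"
    then have x: "1/5 \<le> x" "x \<le> 1/4" using assms c by (auto simp: branch_def)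
    then have "0 \<le> (x - 1/5) * (1/4 - x)" by (intro mult_nonneg_nonneg) auto
    then have "1 - 10 * x + 12 * x\<^sup>2 \<le> 0"
      using x by (simp add: power2_eq_square algebra_simps)
    then have "deriv f0 x \<le> 0"
      using x f0_deriv_hump[of x] slope_pos by (simp add: mult_nonneg_nonpos)
    then show "\<exists>y. (f0 has_real_derivative y) (at x) \<and> y \<le> 0"
      using f0_has_deriv by blast
  qed
qed

lemma branch_separation:
  assumes "u \<in> branch c" "w \<in> branch d" "c \<noteq> d" "c \<le> 3" "d \<le> 3"
  shows "1/8 \<le> \<bar>u - w\<bar>"
  using assms by (auto simp: branch_def split: if_splits)

section \<open>Orbits that follow an itinerary\<close>

definition shadows :: "(nat \<Rightarrow> nat) \<Rightarrow> nat \<Rightarrow> real \<Rightarrow> bool" where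
  "shadows s t x \<longleftrightarrow> (\<forall>j<t. (f0 ^^ j) x \<in> branch (s j))"

lemma shadows_Suc: "shadows s (Suc t) x \<longleftrightarrow> shadows s t x \<and> (f0 ^^ t) x \<in> branch (s t)"
  by (auto simp: shadows_def less_Suc_eq)

lemma shadows_shift:
  "shadows s (t + r) x \<Longrightarrow> shadows (\<lambda>j. s (t + j)) r ((f0 ^^ t) x)"
proof -
  have "(f0 ^^ j) ((f0 ^^ t) x) = (f0 ^^ (t + j)) x" for j
    by (metis add.commute comp_apply funpow_add)
  then show "shadows s (t + r) x \<Longrightarrow> ?thesis" by (auto simp: shadows_def)
qed

lemma shadows_le: "shadows s t x \<Longrightarrow> r \<le> t \<Longrightarrow> shadows s r x"
  by (simp add: shadows_def)

lemma shadows_survivor: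
  "x \<in> survivors \<Longrightarrow> (\<And>j. j < t \<Longrightarrow> symbol ((f0 ^^ j) x) = s j) \<Longrightarrow> shadows s t x"
  unfolding shadows_def using survivors_branch survivors_funpow by metis

lemma shadows_lipschitz:
  "shadows s t x \<Longrightarrow> shadows s t y \<Longrightarrow> (\<And>j. j < t \<Longrightarrow> s j \<le> 2) \<Longrightarrow>
    \<bar>(f0 ^^ t) x - (f0 ^^ t) y\<bar> \<le> 2 ^ (24 * t) * \<bar>x - y\<bar>"
proof (induction t)
  case (Suc t)
  then have IH: "\<bar>(f0 ^^ t) x - (f0 ^^ t) y\<bar> \<le> 2 ^ (24 * t) * \<bar>x - y\<bar>"
    by (auto simp: shadows_Suc)
  have "\<bar>(f0 ^^ Suc t) x - (f0 ^^ Suc t) y\<bar> \<le> 2 ^ 24 * \<bar>(f0 ^^ t) x - (f0 ^^ t) y\<bar>"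
    using branch_lipschitz[of "(f0 ^^ t) x" "s t" "(f0 ^^ t) y"] Suc.prems by (simp add: shadows_Suc)
  also have "\<dots> \<le> 2 ^ 24 * (2 ^ (24 * t) * \<bar>x - y\<bar>)" using IH by (intro mult_left_mono) auto
  finally show ?case by (simp add: power_add)
qed simp

lemma shadows_expand:
  "shadows s t x \<Longrightarrow> shadows s t y \<Longrightarrow> (\<And>j. j < t \<Longrightarrow> s j \<le> 1) \<Longrightarrow>
    2 ^ (23 * t) * \<bar>x - y\<bar> \<le> \<bar>(f0 ^^ t) x - (f0 ^^ t) y\<bar>"
proof (induction t)
  case (Suc t)
  then have IH: "2 ^ (23 * t) * \<bar>x - y\<bar> \<le> \<bar>(f0 ^^ t) x - (f0 ^^ t) y\<bar>"
    by (auto simp: shadows_Suc)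
  have "2 ^ (23 * Suc t) * \<bar>x - y\<bar> = 2 ^ 23 * (2 ^ (23 * t) * \<bar>x - y\<bar>)"
    by (simp add: power_add)
  also have "\<dots> \<le> 2 ^ 23 * \<bar>(f0 ^^ t) x - (f0 ^^ t) y\<bar>"
    using IH by (intro mult_left_mono) auto
  also have "\<dots> \<le> \<bar>(f0 ^^ Suc t) x - (f0 ^^ Suc t) y\<bar>"
    using branch_expand[of "(f0 ^^ t) x" "s t" "(f0 ^^ t) y"] Suc.prems by (simp add: shadows_Suc)
  finally show ?case .
qed simp

lemma shadows_order:
  assumes "x \<le> y"
  shows "shadows s t x \<Longrightarrow> shadows s t y \<Longrightarrow> (\<And>j. j < t \<Longrightarrow> s j \<le> 2) \<Longrightarrow>
    0 \<le> orientation s t * ((f0 ^^ t) y - (f0 ^^ t) x)"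
proof (induction t)
  case 0
  then show ?case using assms by simp
next
  case (Suc t)
  let ?x = "(f0 ^^ t) x" and ?y = "(f0 ^^ t) y"
  have IH: "0 \<le> orientation s t * (?y - ?x)" using Suc by (auto simp: shadows_Suc)
  have xy: "?x \<in> branch (s t)" "?y \<in> branch (s t)" using Suc.prems by (auto simp: shadows_Suc)
  have "(orientation s t = 1 \<and> ?x \<le> ?y) \<or> (orientation s t = -1 \<and> ?y \<le> ?x)"
    using IH orientation_cases[of s t] by auto
  moreover have "s t = 0 \<or> s t = 1 \<or> s t = 2" using Suc.prems(3)[of t] by auto
  ultimately show ?case
    using branch_mono[OF xy] branch_mono[OF xy(2,1)] by (auto simp: orientation_Suc)
qed

text \<open>The absolute value of the derivative of \<open>f0 ^^ t\<close>, see
  \<open>funpow_has_deriv\<close>.\<close>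

definition expansion :: "nat \<Rightarrow> real \<Rightarrow> real" where
  "expansion t x = (\<Prod>j<t. \<bar>deriv f0 ((f0 ^^ j) x)\<bar>)"

lemma expansion_0 [simp]: "expansion 0 x = 1"
  by (simp add: expansion_def)

lemma expansion_1 [simp]: "expansion (Suc 0) x = \<bar>deriv f0 x\<bar>"
  by (simp add: expansion_def)

lemma expansion_nonneg: "0 \<le> expansion t x"
  unfolding expansion_def by (intro prod_nonneg) auto

lemma expansion_add: "expansion (t + r) x = expansion t x * expansion r ((f0 ^^ t) x)"
  by (induction r) (simp_all add: expansion_def funpow_add add.commute[of t])

lemma shadows_expansion:
  "shadows s t x \<Longrightarrow> (\<And>j. j < t \<Longrightarrow> s j \<le> 1) \<Longrightarrow> 2 ^ (23 * t) \<le> expansion t x"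
proof (induction t)
  case (Suc t)
  then have IH: "2 ^ (23 * t) \<le> expansion t x" by (auto simp: shadows_Suc)
  have "2 ^ (23 * t) * 2 ^ 23 \<le> expansion t x * \<bar>deriv f0 ((f0 ^^ t) x)\<bar>"
    using IH branch_deriv[of "(f0 ^^ t) x" "s t"] Suc.prems expansion_nonneg
    by (intro mult_mono) (auto simp: shadows_Suc)
  then show ?case by (simp add: expansion_def power_add)
qed simp

lemma deriv_inflection_branch: "x \<in> branch 2 \<Longrightarrow> deriv f0 x = 3 * slope * (x - 1)\<^sup>2"
  by (rule f0_deriv_inflection) (auto simp: branch_def)

section \<open>Loss of derivative at the inflection point\<close>

text \<open>With a = \<bar>x - 1\<bar> the derivative is 3 slope a^2 and the distance of the images
  is slope a^3. The cube of the derivative is therefore 27 slope times the square of the distance,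
  and the claim follows by comparing cubes.\<close>

lemma inflection_factor:
  assumes "x \<in> branch 2" "1 \<le> 8 * 2 ^ (24 * l) * \<bar>f0 x - crit_value1\<bar>"
  shows "2 ^ 7 \<le> \<bar>deriv f0 x\<bar> * 2 ^ (16 * l)"
proof -
  let ?d = "\<bar>f0 x - crit_value1\<bar>"
  define a where "a = \<bar>x - 1\<bar>"
  define p :: real where "p = 2 ^ (8 * l)"
  have D: "\<bar>deriv f0 x\<bar> = 3 * slope * a\<^sup>2"
    using deriv_inflection_branch[OF assms(1)] slope_pos by (simp add: abs_mult a_def)
  have d: "?d = slope * a ^ 3"
    using assms(1) slope_pos by (simp add: f0_branch inflection_def abs_mult power_abs a_def)
  have p: "2 ^ (24 * l) = p ^ 3" "2 ^ (16 * l) = p\<^sup>2"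
    by (simp_all add: p_def mult.commute flip: power_mult)
  have "(2 ^ 7) ^ 3 * 64 \<le> (27 * slope :: real)" by (simp add: slope_def)
  also have "\<dots> = 27 * slope * 1" by simp
  also have "\<dots> \<le> 27 * slope * (8 * 2 ^ (24 * l) * ?d)\<^sup>2"
    using assms(2) slope_pos by (intro mult_left_mono one_le_power) auto
  also have "\<dots> = (\<bar>deriv f0 x\<bar> * 2 ^ (16 * l)) ^ 3 * 64"
    unfolding D d p by (simp add: power_mult_distrib algebra_simps power2_eq_square power3_eq_cube)
  finally have "(2 ^ 7) ^ Suc 2 \<le> (\<bar>deriv f0 x\<bar> * 2 ^ (16 * l)) ^ Suc 2" by simp
  then show ?thesis by (rule power_le_imp_le_base) simp
qed

text \<open>The derivative decreases on the left of 1, so the mean slope on an interval there is at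
  least the derivative at its right end. This turns the derivative bound on the critical orbit into
  growth of distances.\<close>

lemma inflection_contraction:
  assumes "u \<in> branch 2" "w \<in> branch 2" "u \<le> w" "w \<le> 1"
  shows "\<bar>deriv f0 w\<bar> * \<bar>u - w\<bar> \<le> \<bar>f0 u - f0 w\<bar>"
proof -
  let ?P = "(w - 1)\<^sup>2 + (w - 1) * (u - 1) + (u - 1)\<^sup>2"
  have "(1 - w) * (1 - w) \<le> (1 - w) * (1 - u)" "(1 - w) * (1 - w) \<le> (1 - u) * (1 - u)"
    using assms by (auto intro!: mult_mono)
  then have P: "3 * (w - 1)\<^sup>2 \<le> ?P" by (simp add: power2_eq_square algebra_simps)
  have "f0 w - f0 u = slope * (w - u) * ?P"
    using assms by (simp add: f0_branch inflection_def algebra_simps power2_eq_square power3_eq_cube)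
  moreover have "slope * (w - u) * (3 * (w - 1)\<^sup>2) \<le> slope * (w - u) * ?P"
    using P assms slope_pos by (intro mult_left_mono) auto
  moreover have "\<bar>deriv f0 w\<bar> * \<bar>u - w\<bar> = slope * (w - u) * (3 * (w - 1)\<^sup>2)"
    using deriv_inflection_branch[OF assms(2)] assms slope_pos by (simp add: abs_mult algebra_simps)
  ultimately show ?thesis by linarith
qed

text \<open>Two orbits following \<open>itin1\<close> forever would separate exponentially inside an
  interval of length 3.\<close>

lemma crit_value1_separates:
  assumes "y \<in> survivors" "y \<noteq> crit_value1"
  shows "\<exists>t. symbol ((f0 ^^ t) y) \<noteq> itin1 t"
proof (rule ccontr)
  assume "\<nexists>t. symbol ((f0 ^^ t) y) \<noteq> itin1 t"
  then have y: "shadows itin1 t y" for t using shadows_survivor[OF assms(1), of t itin1] by auto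
  have v: "shadows itin1 t crit_value1" for t using crit_value1_orbit by (simp add: shadows_def)
  have d: "0 < \<bar>y - crit_value1\<bar>" using assms(2) by simp
  obtain t where t: "3 / \<bar>y - crit_value1\<bar> < 2 ^ t"
    using real_arch_pow[of 2 "3 / \<bar>y - crit_value1\<bar>"] by auto
  have "2 ^ t * \<bar>y - crit_value1\<bar> \<le> 2 ^ (23 * t) * \<bar>y - crit_value1\<bar>"
    by (intro mult_right_mono power_increasing) auto
  also have "\<dots> \<le> \<bar>(f0 ^^ t) y - (f0 ^^ t) crit_value1\<bar>"
    by (rule shadows_expand[OF y v]) (rule itin1_le)
  also have "\<dots> \<le> 3"
    using survivors_bounds[OF survivors_funpow[OF assms(1), of t]]
      survivors_bounds[OF survivors_funpow[OF crit_value1_survivor, of t]] by linarith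
  finally show False using t d by (simp add: field_simps)
qed

text \<open>Different branches are at least 1/8 apart, and the Lipschitz bound carries this back to
  time 0. A differing symbol thereby becomes a lower bound for the distance to a critical
  value.\<close>

lemma separated_distance:
  assumes "shadows s t y" "shadows s t v" "\<And>j. j < t \<Longrightarrow> s j \<le> 2"
    and "(f0 ^^ t) y \<in> survivors" "(f0 ^^ t) v \<in> branch c" "c \<le> 3"
    and "symbol ((f0 ^^ t) y) \<noteq> c"
  shows "1 \<le> 8 * 2 ^ (24 * t) * \<bar>y - v\<bar>"
proof -
  have "1/8 \<le> \<bar>(f0 ^^ t) y - (f0 ^^ t) v\<bar>"
    using branch_separation[OF survivors_branch[OF assms(4)] assms(5,7) symbol_le assms(6)] .
  also have "\<dots> \<le> 2 ^ (24 * t) * \<bar>y - v\<bar>"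
    by (rule shadows_lipschitz[OF assms(1,2,3)])
  finally show ?thesis by simp
qed

lemma crit_value1_shadows: "shadows itin1 t crit_value1"
  using crit_value1_orbit by (simp add: shadows_def)

lemma crit_value2_shadows: "shadows itin2 t crit_value2"
  using crit_value2_orbit by (simp add: shadows_def)

lemma funpow_Suc_left: "(f0 ^^ n) (f0 x) = (f0 ^^ Suc n) x"
  by (simp add: funpow_swap1)

text \<open>The derivative at x is at least 2 ^ (7 - 16 t), and the next t steps contribute 2 ^ (23
  t).\<close>

lemma inflection_expansion:
  assumes "x \<in> survivors" "x \<in> branch 2"
    and same: "\<And>j. j < t \<Longrightarrow> symbol ((f0 ^^ j) (f0 x)) = itin1 j"
    and diff: "symbol ((f0 ^^ t) (f0 x)) \<noteq> itin1 t"
  shows "2 ^ (7 * Suc t) \<le> expansion (Suc t) x"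
proof -
  let ?y = "f0 x"
  have y: "?y \<in> survivors" by (rule survivors_step) fact
  have sh: "shadows itin1 t ?y" using shadows_survivor[OF y same] .
  have i1: "itin1 j \<le> 2" "itin1 j \<le> 3" for j using itin1_le[of j] by auto
  have "1 \<le> 8 * 2 ^ (24 * t) * \<bar>?y - crit_value1\<bar>"
    by (rule separated_distance[OF sh crit_value1_shadows i1(1) survivors_funpow[OF y] crit_value1_orbit i1(2) diff])
  then have 1: "2 ^ 7 \<le> \<bar>deriv f0 x\<bar> * 2 ^ (16 * t)" by (rule inflection_factor[OF assms(2)])
  have 2: "2 ^ (23 * t) \<le> expansion t ?y" by (rule shadows_expansion[OF sh itin1_le])
  have "2 ^ (7 * Suc t) * 2 ^ (16 * t) = (2 ^ (7 + 23 * t) :: real)"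
    unfolding power_add[symmetric] by (rule arg_cong[where f = "(^) 2"]) simp
  also have "\<dots> = 2 ^ 7 * 2 ^ (23 * t)" by (rule power_add)
  also have "\<dots> \<le> (\<bar>deriv f0 x\<bar> * 2 ^ (16 * t)) * expansion t ?y"
    using 1 2 by (intro mult_mono) auto
  also have "\<dots> = expansion (Suc t) x * 2 ^ (16 * t)"
    using expansion_add[of 1 t x] by simp
  finally show ?thesis by simp
qed

section \<open>Visits of the second critical orbit to the inflection point\<close>

lemma visit_shadow:
  "shadows (\<lambda>j. itin2 (visit i + 1 + j)) r ((f0 ^^ (visit i + 1)) crit_value2)"
  using shadows_shift[OF crit_value2_shadows] .

lemma visit_copy:
  "r \<le> run_start i + 2 * half_run i \<Longrightarrow> shadows itin1 r ((f0 ^^ (visit i + 1)) crit_value2)"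
  using visit_shadow[of i r] itin2_agrees[of _ i] by (auto simp: shadows_def)

text \<open>When the run of zeros of \<open>itin1\<close> ends, the orbit of
  \<open>crit_value1\<close> is in branch 1 while that of \<open>w i\<close>, whose run is longer,
  is still in branch 0. The order is preserved up to that time, so \<open>w i\<close> is on the
  left; the Lipschitz and expansion bounds give the two estimates of the distance.\<close>

lemma visit_image:
  defines "w \<equiv> \<lambda>i. (f0 ^^ (visit i + 1)) crit_value2"
  shows "w i < crit_value1"
    and "1 \<le> 8 * 2 ^ (24 * (run_start i + 2 * half_run i)) * \<bar>w i - crit_value1\<bar>"
    and "2 ^ (23 * (run_start i + 2 * half_run i)) * \<bar>w i - crit_value1\<bar> \<le> 1/4"
proof -
  let ?r = "run_start i + 2 * half_run i"
  have w: "(f0 ^^ r) (w i) = (f0 ^^ (visit i + 1 + r)) crit_value2" for r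
    unfolding w_def by (metis add.commute comp_apply funpow_add)
  have S: "w i \<in> survivors" unfolding w_def by (rule survivors_funpow[OF crit_value2_survivor])
  have sh: "shadows itin1 ?r (w i)" unfolding w_def by (rule visit_copy) simp
  have "2 * half_run i < 32 * half_run i" using half_run_ge[of i] by simp
  then have "itin2 (visit i + 1 + run_start i + 2 * half_run i) = 0" by (rule itin2_run)
  then have b0: "(f0 ^^ ?r) (w i) \<in> branch 0"
    using crit_value2_orbit[of "visit i + 1 + ?r"] by (simp add: w add.assoc)
  have b1: "(f0 ^^ ?r) crit_value1 \<in> branch 1"
    using crit_value1_orbit[of ?r] itin1_end(1)[of i] by simp
  have i1: "itin1 j \<le> 2" for j using itin1_le[of j] by auto
  have lt: "(f0 ^^ ?r) (w i) < (f0 ^^ ?r) crit_value1"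
    using b0 b1 by (auto simp: branch_def)
  have o: "orientation itin1 ?r = 1" by (rule orientation_itin1_run[OF orientation_itin1]) simp
  show "w i < crit_value1"
  proof (rule ccontr)
    assume "\<not> w i < crit_value1"
    then have "crit_value1 \<le> w i" by simp
    from shadows_order[OF this crit_value1_shadows sh i1] o lt show False by simp
  qed
  have "symbol ((f0 ^^ ?r) (w i)) \<noteq> 1" using symbol_branch[OF b0] by simp
  then show "1 \<le> 8 * 2 ^ (24 * ?r) * \<bar>w i - crit_value1\<bar>"
    by (intro separated_distance[OF sh crit_value1_shadows i1 survivors_funpow[OF S] b1]) auto
  have "2 ^ (23 * ?r) * \<bar>w i - crit_value1\<bar> \<le> \<bar>(f0 ^^ ?r) (w i) - (f0 ^^ ?r) crit_value1\<bar>"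
    by (rule shadows_expand[OF sh crit_value1_shadows itin1_le])
  also have "\<dots> \<le> 1/4" using b0 b1 by (auto simp: branch_def)
  finally show "2 ^ (23 * ?r) * \<bar>w i - crit_value1\<bar> \<le> 1/4" .
qed

lemma visit_branch: "(f0 ^^ visit i) crit_value2 \<in> branch 2"
  using crit_value2_orbit[of "visit i"] itin2_visit[of i] by simp

lemma visit_le_1: "(f0 ^^ visit i) crit_value2 \<le> 1"
proof -
  let ?z = "(f0 ^^ visit i) crit_value2"
  have "slope * (?z - 1) ^ 3 < 0"
    using visit_image(1)[of i] by (simp add: f0_branch(2)[OF visit_branch] inflection_def)
  then have "(?z - 1) ^ 3 < 0" using slope_pos by (simp add: mult_less_0_iff)
  then show ?thesis using zero_le_power[of "?z - 1" 3] by linarith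
qed

text \<open>The fold keeps only the points on the right of the second critical value, and an odd number
  of orientation reversals precedes each visit.\<close>

lemma shadow_visit_le:
  assumes "crit_value2 \<le> y" "shadows itin2 (visit i) y"
  shows "(f0 ^^ visit i) y \<le> (f0 ^^ visit i) crit_value2"
  using shadows_order[OF assms(1) crit_value2_shadows assms(2) itin2_le] orientation_itin2[of i] by simp

lemma shadow_visit_image_le:
  assumes "crit_value2 \<le> y" "shadows itin2 (Suc (visit i)) y"
  shows "(f0 ^^ (visit i + 1)) y \<le> (f0 ^^ (visit i + 1)) crit_value2"
proof -
  have "shadows itin2 (visit i) y" "(f0 ^^ visit i) y \<in> branch 2"
    using assms(2) itin2_visit[of i] by (auto simp: shadows_Suc)
  then show ?thesis
    using branch_mono(1)[OF _ visit_branch[of i] shadow_visit_le[OF assms(1)]] by simp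
qed

text \<open>Raising l to l + 1 in the loss trades 2 ^ 7 for 2 ^ 23, so that the inflection step is
  counted like every other step.\<close>

lemma inflection_factor':
  assumes "x \<in> branch 2" "1 \<le> 8 * 2 ^ (24 * l) * \<bar>f0 x - crit_value1\<bar>"
  shows "2 ^ 23 \<le> \<bar>deriv f0 x\<bar> * 2 ^ (16 * (l + 1))"
  using inflection_factor[OF assms] by (simp add: power_add)

lemma expansion_extend:
  assumes "shadows s (t + r) y" "\<And>j. t \<le> j \<Longrightarrow> j < t + r \<Longrightarrow> s j \<le> 1"
    and "2 ^ (23 * t) \<le> expansion t y * 2 ^ a"
  shows "2 ^ (23 * (t + r)) \<le> expansion (t + r) y * 2 ^ a"
proof -
  have "2 ^ (23 * r) \<le> expansion r ((f0 ^^ t) y)"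
    by (rule shadows_expansion[OF shadows_shift[OF assms(1)]]) (use assms(2) in auto)
  then have "2 ^ (23 * t) * 2 ^ (23 * r) \<le> (expansion t y * 2 ^ a) * expansion r ((f0 ^^ t) y)"
    using assms(3) expansion_nonneg by (intro mult_mono) auto
  then show ?thesis unfolding expansion_add distrib_left power_add by (simp add: mult_ac)
qed

lemma expansion_inflection:
  assumes "(f0 ^^ t) y \<in> branch 2"
    and "1 \<le> 8 * 2 ^ (24 * l) * \<bar>(f0 ^^ (t + 1)) y - crit_value1\<bar>"
    and "2 ^ (23 * t) \<le> expansion t y * 2 ^ (16 * a)"
  shows "2 ^ (23 * (t + 1)) \<le> expansion (t + 1) y * 2 ^ (16 * (a + (l + 1)))"
proof -
  have "2 ^ 23 \<le> \<bar>deriv f0 ((f0 ^^ t) y)\<bar> * 2 ^ (16 * (l + 1))"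
    using assms(2) by (intro inflection_factor'[OF assms(1)]) simp
  then have "2 ^ (23 * t) * 2 ^ 23 \<le> (expansion t y * 2 ^ (16 * a)) *
      (\<bar>deriv f0 ((f0 ^^ t) y)\<bar> * 2 ^ (16 * (l + 1)))"
    using assms(3) expansion_nonneg by (intro mult_mono) auto
  then show ?thesis
    by (simp add: expansion_def power_add algebra_simps)
qed

text \<open>A point to the right of \<open>crit_value2\<close> reaches the inflection branch on the
  left of the critical orbit, which is itself left of 1. It is thus at least as far from the
  inflection point, and the losses of the critical orbit bound its own. The second conclusion, on
  distances, makes the itinerary determine the point.\<close>

lemma visit_growth:
  assumes "crit_value2 \<le> y"
  shows "shadows itin2 (visit i) y \<Longrightarrow>
    2 ^ (23 * visit i) \<le> expansion (visit i) y * 2 ^ (16 * loss i) \<and>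
    2 ^ (23 * visit i) * \<bar>y - crit_value2\<bar>
      \<le> \<bar>(f0 ^^ visit i) y - (f0 ^^ visit i) crit_value2\<bar> * 2 ^ (16 * loss i)"
proof (induction i)
  case 0
  then show ?case
    using shadows_expansion[of itin2 21 y] shadows_expand[of itin2 21 y crit_value2]
      crit_value2_shadows[of 21] itin2_init by auto
next
  case (Suc i)
  let ?T = "visit i" and ?l = "run_start i + 2 * half_run i"
  define r where "r = run_start i + 32 * half_run i + 2"
  have T: "visit (Suc i) = ?T + 1 + r" by (simp add: r_def visit_Suc)
  have sh: "shadows itin2 (?T + 1) y" "shadows itin2 ?T y"
    by (rule shadows_le[OF Suc.prems]; simp add: T)+
  note IH = Suc.IH[OF sh(2)]
  let ?u = "(f0 ^^ ?T) y" and ?z = "(f0 ^^ ?T) crit_value2"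
  have u: "?u \<in> branch 2" using sh(1) itin2_visit[of i] by (simp add: shadows_Suc)
  have uz: "?u \<le> ?z" by (rule shadow_visit_le[OF assms sh(2)])
  have fu: "(f0 ^^ (?T + 1)) y \<le> (f0 ^^ (?T + 1)) crit_value2"
    using shadow_visit_image_le[OF assms] sh(1) by simp
  have z1: "1 \<le> 8 * 2 ^ (24 * ?l) * \<bar>(f0 ^^ (?T + 1)) crit_value2 - crit_value1\<bar>"
    by (rule visit_image(2))
  also have "\<dots> \<le> 8 * 2 ^ (24 * ?l) * \<bar>(f0 ^^ (?T + 1)) y - crit_value1\<bar>"
    using fu visit_image(1)[of i] by (intro mult_left_mono) auto
  finally have u1: "1 \<le> 8 * 2 ^ (24 * ?l) * \<bar>(f0 ^^ (?T + 1)) y - crit_value1\<bar>" .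
  have loss: "loss (Suc i) = loss i + (?l + 1)" by (simp add: loss_Suc)
  have le1: "itin2 j \<le> 1" if "?T + 1 \<le> j" "j < ?T + 1 + r" for j
    using itin2_not_visit[of i j] that T by simp
  have "2 ^ (23 * (?T + 1)) \<le> expansion (?T + 1) y * 2 ^ (16 * loss (Suc i))"
    unfolding loss by (rule expansion_inflection[OF u u1]) (use IH in blast)
  then have A: "2 ^ (23 * (?T + 1 + r)) \<le> expansion (?T + 1 + r) y * 2 ^ (16 * loss (Suc i))"
    \<comment> \<open>Between two visits only symbols 0 and 1 occur, so no further loss
      arises.\<close>
    by (rule expansion_extend[rotated 2]) (use Suc.prems T le1 in auto)
  have "2 ^ 23 \<le> \<bar>deriv f0 ?z\<bar> * 2 ^ (16 * (?l + 1))"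
    using z1 by (intro inflection_factor'[OF visit_branch]) simp
  then have "2 ^ 23 * \<bar>?u - ?z\<bar> \<le> (\<bar>deriv f0 ?z\<bar> * 2 ^ (16 * (?l + 1))) * \<bar>?u - ?z\<bar>"
    by (intro mult_right_mono) auto
  also have "\<dots> = (\<bar>deriv f0 ?z\<bar> * \<bar>?u - ?z\<bar>) * 2 ^ (16 * (?l + 1))" by simp
  also have "\<dots> \<le> \<bar>f0 ?u - f0 ?z\<bar> * 2 ^ (16 * (?l + 1))"
    using inflection_contraction[OF u visit_branch uz visit_le_1] by (intro mult_right_mono) auto
  finally have 1: "2 ^ 23 * \<bar>?u - ?z\<bar> \<le> \<bar>f0 ?u - f0 ?z\<bar> * 2 ^ (16 * (?l + 1))" .
  have 2: "2 ^ (23 * r) * \<bar>f0 ?u - f0 ?z\<bar>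
      \<le> \<bar>(f0 ^^ r) (f0 ?u) - (f0 ^^ r) (f0 ?z)\<bar>"
  proof (rule shadows_expand)
    show "shadows (\<lambda>j. itin2 (?T + 1 + j)) r (f0 ?u)"
      using shadows_shift[of itin2 "?T + 1" r y] Suc.prems T by simp
    show "shadows (\<lambda>j. itin2 (?T + 1 + j)) r (f0 ?z)"
      using visit_shadow[of i r] by simp
  qed (use le1 in auto)
  have last: "(f0 ^^ r) (f0 ((f0 ^^ ?T) x)) = (f0 ^^ (?T + 1 + r)) x" for x
  proof -
    have "?T + 1 + r = r + Suc ?T" by simp
    then show ?thesis by (simp only: funpow_add comp_apply funpow.simps)
  qed
  have "2 ^ (23 * (?T + 1 + r)) * \<bar>y - crit_value2\<bar>
      = 2 ^ (23 * r) * (2 ^ 23 * (2 ^ (23 * ?T) * \<bar>y - crit_value2\<bar>))"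
    by (simp add: power_add)
  also have "\<dots> \<le> 2 ^ (23 * r) * (2 ^ 23 * (\<bar>?u - ?z\<bar> * 2 ^ (16 * loss i)))"
    using IH by (intro mult_left_mono) auto
  also have "\<dots> \<le> 2 ^ (23 * r) * ((\<bar>f0 ?u - f0 ?z\<bar> * 2 ^ (16 * (?l + 1))) * 2 ^ (16 * loss i))"
    using mult_right_mono[OF 1, of "2 ^ (16 * loss i)"] by (intro mult_left_mono) (auto simp: mult.assoc)
  also have "\<dots> = (2 ^ (23 * r) * \<bar>f0 ?u - f0 ?z\<bar>) * 2 ^ (16 * loss (Suc i))"
    unfolding loss by (simp add: algebra_simps flip: power_add)
  also have "\<dots> \<le> \<bar>(f0 ^^ r) (f0 ?u) - (f0 ^^ r) (f0 ?z)\<bar> * 2 ^ (16 * loss (Suc i))"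
    using 2 by (intro mult_right_mono) auto
  finally show ?case using A unfolding T last by simp
qed

text \<open>The budget of 5 per step for losses leaves 23 - 5 = 18.\<close>

lemma power_cancel:
  assumes "(2::real) ^ (23 * t) * d \<le> D * 2 ^ a" "a \<le> 5 * t" "0 \<le> D"
  shows "2 ^ (18 * t) * d \<le> D"
proof -
  have "(2 ^ (18 * t) * d) * 2 ^ (5 * t) = 2 ^ (23 * t) * d"
    by (simp add: mult.commute mult.left_commute flip: power_add)
  also have "\<dots> \<le> D * 2 ^ (5 * t)"
    using assms by (meson order_trans mult_left_mono power_increasing one_le_numeral)
  finally show ?thesis by simp
qed

text \<open>The right side is enough because the fold maps only there. The distances are compared at
  visit times, where \<open>visit_growth\<close> and \<open>loss_visit\<close> apply.\<close>

lemma crit_value2_separates: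
  assumes "y \<in> survivors" "crit_value2 < y"
  shows "\<exists>t. symbol ((f0 ^^ t) y) \<noteq> itin2 t"
proof (rule ccontr)
  assume "\<nexists>t. symbol ((f0 ^^ t) y) \<noteq> itin2 t"
  then have y: "shadows itin2 t y" for t using shadows_survivor[OF assms(1), of t itin2] by auto
  have d: "0 < \<bar>y - crit_value2\<bar>" using assms(2) by simp
  obtain i where i: "3 / \<bar>y - crit_value2\<bar> < 2 ^ i"
    using real_arch_pow[of 2 "3 / \<bar>y - crit_value2\<bar>"] by auto
  let ?T = "visit i"
  have "i \<le> 18 * ?T" using seq_suble[OF strict_mono_visit, of i] by simp
  then have "2 ^ i * \<bar>y - crit_value2\<bar> \<le> 2 ^ (18 * ?T) * \<bar>y - crit_value2\<bar>"
    by (intro mult_right_mono power_increasing) auto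
  also have "\<dots> \<le> \<bar>(f0 ^^ ?T) y - (f0 ^^ ?T) crit_value2\<bar>"
  proof (rule power_cancel)
    show "2 ^ (23 * ?T) * \<bar>y - crit_value2\<bar>
        \<le> \<bar>(f0 ^^ ?T) y - (f0 ^^ ?T) crit_value2\<bar> * 2 ^ (16 * loss i)"
      using visit_growth[OF _ y] assms(2) by simp
    show "16 * loss i \<le> 5 * ?T" using loss_visit[of i] by simp
  qed simp
  also have "\<dots> \<le> 3"
    using survivors_bounds[OF survivors_funpow[OF assms(1), of ?T]]
      survivors_bounds[OF survivors_funpow[OF crit_value2_survivor, of ?T]] by linarith
  finally show False using i d by (simp add: field_simps)
qed

text \<open>The losses before the last visit up to time t are controlled by
  \<open>visit_growth\<close>. The loss at that visit itself remains, and it has to be paid for by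
  the time elapsed until the separation.\<close>

lemma valley_growth:
  assumes "y \<in> survivors" "crit_value2 \<le> y"
    and same: "\<And>j. j < t \<Longrightarrow> symbol ((f0 ^^ j) y) = itin2 j"
    and diff: "symbol ((f0 ^^ t) y) \<noteq> itin2 t"
  shows "2 ^ (18 * t) \<le> expansion t y"
proof -
  have sh: "shadows itin2 t y" using shadows_survivor[OF assms(1) same] .
  show ?thesis
  proof (cases "t < 21")
    case True
    have "2 ^ (18 * t) \<le> (2 ^ (23 * t) :: real)" by (intro power_increasing) auto
    also have "\<dots> \<le> expansion t y"
      by (rule shadows_expansion[OF sh]) (use True itin2_init in auto)
    finally show ?thesis .
  next
    case False
    then obtain i where i: "visit i \<le> t" "t < visit (Suc i)"
      using strict_mono_interval_index[OF strict_mono_visit, of t] by auto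
    let ?T = "visit i"
    have G: "2 ^ (23 * ?T) \<le> expansion ?T y * 2 ^ (16 * loss i)"
      using visit_growth[OF assms(2) shadows_le[OF sh i(1)]] by blast
    show ?thesis
    proof (cases "t = ?T")
      case True
      then show ?thesis
        using power_cancel[of t 1 "expansion t y" "16 * loss i"] G loss_visit[of i] expansion_nonneg
        by simp
    next
      case False
      define r where "r = t - (?T + 1)"
      have t: "t = ?T + 1 + r" using False i by (simp add: r_def)
      have shT: "shadows itin2 (Suc ?T) y" by (rule shadows_le[OF sh]) (simp add: t)
      then have u: "(f0 ^^ ?T) y \<in> branch 2" using itin2_visit[of i] by (simp add: shadows_Suc)
      let ?y = "(f0 ^^ (?T + 1)) y" and ?w = "(f0 ^^ (?T + 1)) crit_value2"
      have yw: "?y \<le> ?w" by (rule shadow_visit_image_le[OF assms(2) shT])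
      have wv: "?w < crit_value1" by (rule visit_image(1))
      \<comment> \<open>Here \<open>l\<close> bounds the time for which the image at the last visit
        follows \<open>itin1\<close>; the second condition says that all losses together fit into
        the budget of 5 per step.\<close>
      obtain l where l: "1 \<le> 8 * 2 ^ (24 * l) * \<bar>?y - crit_value1\<bar>" "16 * (loss i + (l + 1)) \<le> 5 * t"
      proof (cases "r \<le> run_start i")
        case True
        have iter: "(f0 ^^ r) ((f0 ^^ (?T + 1)) x) = (f0 ^^ t) x" for x
          unfolding t by (metis add.commute comp_apply funpow_add)
        have "1 \<le> 8 * 2 ^ (24 * r) * \<bar>?y - ?w\<bar>"
        proof (rule separated_distance)
          show "shadows (\<lambda>j. itin2 (?T + 1 + j)) r ?y"
            using shadows_shift[of itin2 "?T + 1" r y] sh t by simp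
          show "shadows (\<lambda>j. itin2 (?T + 1 + j)) r ?w" by (rule visit_shadow)
          show "(f0 ^^ r) ?y \<in> survivors" unfolding iter by (rule survivors_funpow[OF assms(1)])
          show "(f0 ^^ r) ?w \<in> branch (itin2 t)" unfolding iter by (rule crit_value2_orbit)
          show "symbol ((f0 ^^ r) ?y) \<noteq> itin2 t" unfolding iter by (rule diff)
          show "itin2 t \<le> 3" using itin2_le[of t] by simp
        qed (rule itin2_le)
        \<comment> \<open>As \<open>?y \<le> ?w < crit_value1\<close>, the distance to
          \<open>crit_value1\<close> is at least that to \<open>?w\<close>. The exponent is enlarged
          from \<open>r\<close> to \<open>run_start i\<close>, the form that
          \<open>loss_visit\<close> covers.\<close>
        also have "\<dots> \<le> 8 * 2 ^ (24 * run_start i) * \<bar>?y - crit_value1\<bar>"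
          using yw wv True by (intro mult_mono power_increasing) auto
        finally show thesis
          using that[of "run_start i"] loss_visit[of i] i(1) by simp
      next
        case False
        \<comment> \<open>No separation happens during the long run: by the negative orientation the
          orbit of y lies between 0 and a point of branch 0, hence in branch 0 as well.\<close>
        have "visit i + 1 + run_start i + 32 * half_run i \<le> t"
        proof (rule ccontr)
          define q where "q = r - run_start i"
          assume "\<not> ?thesis"
          then have q: "q < 32 * half_run i" "t = ?T + 1 + run_start i + q"
            using False t by (auto simp: q_def)
          have "itin2 t = 0" unfolding q(2) by (rule itin2_run[OF q(1)])
          have "orientation itin2 t = -1"
            unfolding q(2) by (rule orientation_itin2_block[OF orientation_itin2]) (use q(1) in simp)
          then have "(f0 ^^ t) y \<le> (f0 ^^ t) crit_value2"
            using shadows_order[OF assms(2) crit_value2_shadows sh itin2_le] by simp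
          moreover have "(f0 ^^ t) crit_value2 \<in> branch 0"
            using crit_value2_orbit[of t] \<open>itin2 t = 0\<close> by simp
          moreover have "0 \<le> (f0 ^^ t) y"
            using survivors_bounds[OF survivors_funpow[OF assms(1)]] by blast
          ultimately have "(f0 ^^ t) y \<in> branch 0" by (simp add: branch_def)
          then show False using symbol_branch[of "(f0 ^^ t) y" 0] diff \<open>itin2 t = 0\<close> by simp
        qed
        moreover have "1 \<le> 8 * 2 ^ (24 * (run_start i + 2 * half_run i)) * \<bar>?y - crit_value1\<bar>"
        proof -
          have "1 \<le> 8 * 2 ^ (24 * (run_start i + 2 * half_run i)) * \<bar>?w - crit_value1\<bar>"
            by (rule visit_image(2))
          also have "\<dots> \<le> 8 * 2 ^ (24 * (run_start i + 2 * half_run i)) * \<bar>?y - crit_value1\<bar>"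
            using yw wv by (intro mult_left_mono) auto
          finally show ?thesis .
        qed
        ultimately show thesis
          using that[of "run_start i + 2 * half_run i"] loss_run_end[of i] by (simp add: loss_Suc)
      qed
      have "2 ^ (23 * (?T + 1)) \<le> expansion (?T + 1) y * 2 ^ (16 * (loss i + (l + 1)))"
        by (rule expansion_inflection[OF u l(1) G])
      then have "2 ^ (23 * t) \<le> expansion t y * 2 ^ (16 * (loss i + (l + 1)))"
        unfolding t by (rule expansion_extend[rotated 2]) (use sh t i itin2_not_visit[of i] in auto)
      then show ?thesis
        using power_cancel[of t 1 "expansion t y" "16 * (loss i + (l + 1))"] l(2) expansion_nonneg by simp
    qed
  qed
qed

section \<open>Recovery after the fold\<close>

text \<open>Both sides contain slope^2 (x - 2)^2, with the remaining factors x - 1 and (3 x - 4)^2,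
  and the second is larger near 2. The derivative is thus at least a square root of the distance to
  the critical value.\<close>

lemma valley_factor:
  assumes "x \<in> branch 3"
  shows "slope * (f0 x - crit_value2) \<le> (deriv f0 x)\<^sup>2"
proof -
  have x: "19/10 \<le> x" "x \<le> 21/10" using assms by (auto simp: branch_def)
  have "(17/10)\<^sup>2 \<le> (3 * x - 4)\<^sup>2" using x by (intro power_mono) auto
  then have "x - 1 \<le> (3 * x - 4)\<^sup>2" using x by (simp add: power2_eq_square)
  then have "(slope * (x - 2))\<^sup>2 * (x - 1) \<le> (slope * (x - 2))\<^sup>2 * (3 * x - 4)\<^sup>2"
    by (intro mult_left_mono) auto
  moreover have "deriv f0 x = slope * (x - 2) * (3 * x - 4)"
    using x by (intro f0_deriv_valley) auto
  moreover have "slope * (f0 x - crit_value2) = (slope * (x - 2))\<^sup>2 * (x - 1)"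
    by (simp add: f0_branch(3)[OF assms] valley_def power2_eq_square)
  ultimately show ?thesis by (simp add: power_mult_distrib)
qed

text \<open>The derivative at the fold is at least 2 ^ (10 - 12 t), and \<open>valley_growth\<close>
  supplies 2 ^ (18 t); replacing 10 by 6 gives the exponent 6 (t + 1).\<close>

lemma valley_expansion:
  assumes "x \<in> survivors" "x \<in> branch 3"
    and same: "\<And>j. j < t \<Longrightarrow> symbol ((f0 ^^ j) (f0 x)) = itin2 j"
    and diff: "symbol ((f0 ^^ t) (f0 x)) \<noteq> itin2 t"
  shows "2 ^ (6 * Suc t) \<le> expansion (Suc t) x"
proof -
  let ?y = "f0 x"
  have y: "?y \<in> survivors" by (rule survivors_step) fact
  have sh: "shadows itin2 t ?y" using shadows_survivor[OF y same] .
  have ge: "crit_value2 \<le> ?y"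
    using assms(2) slope_pos by (auto simp: f0_branch valley_def branch_def)
  have i2: "itin2 j \<le> 3" for j using itin2_le[of j] by auto
  have d: "1 \<le> 8 * 2 ^ (24 * t) * \<bar>?y - crit_value2\<bar>"
    by (rule separated_distance[OF sh crit_value2_shadows itin2_le survivors_funpow[OF y] crit_value2_orbit i2 diff])
  define p :: real where "p = 2 ^ (12 * t)"
  have p2: "2 ^ (24 * t) = p\<^sup>2" by (simp add: p_def mult.commute flip: power_mult)
  have "(2 ^ 10)\<^sup>2 \<le> 2 ^ 21 * (8 * p\<^sup>2 * (?y - crit_value2))"
  proof -
    have "1 \<le> 8 * p\<^sup>2 * (?y - crit_value2)" using d ge unfolding p2 by simp
    then have "2 ^ 21 * 1 \<le> 2 ^ 21 * (8 * p\<^sup>2 * (?y - crit_value2))"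
      by (rule mult_left_mono) simp
    moreover have "(2 ^ 10)\<^sup>2 \<le> (2 ^ 21 * 1 :: real)" by simp
    ultimately show ?thesis by (rule order_trans[rotated])
  qed
  also have "\<dots> = p\<^sup>2 * (slope * (?y - crit_value2))" by (simp add: slope_def)
  also have "\<dots> \<le> p\<^sup>2 * (deriv f0 x)\<^sup>2"
    using valley_factor[OF assms(2)] by (intro mult_left_mono) auto
  also have "\<dots> = (\<bar>deriv f0 x\<bar> * p)\<^sup>2" by (simp add: power_mult_distrib mult.commute)
  finally have 1: "2 ^ 10 \<le> \<bar>deriv f0 x\<bar> * p"
    by (rule power2_le_imp_le) (simp add: p_def)
  have 2: "2 ^ (18 * t) \<le> expansion t ?y" by (rule valley_growth[OF y ge same diff])
  have "2 ^ (6 * Suc t) * p = (2 ^ (6 + 18 * t) :: real)"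
    unfolding p_def power_add[symmetric] by (rule arg_cong[where f = "(^) 2"]) simp
  also have "\<dots> \<le> 2 ^ (10 + 18 * t)" by (rule power_increasing) auto
  also have "\<dots> = 2 ^ 10 * 2 ^ (18 * t)" by (rule power_add)
  also have "\<dots> \<le> (\<bar>deriv f0 x\<bar> * p) * expansion t ?y"
    using 1 2 by (intro mult_mono) (auto simp: p_def)
  also have "\<dots> = expansion (Suc t) x * p"
    using expansion_add[of 1 t x] by simp
  finally show ?thesis by (simp add: p_def)
qed

lemma LeastI_minimal:
  fixes P :: "nat \<Rightarrow> bool"
  assumes "\<exists>t. P t"
  obtains t where "P t" "\<And>j. j < t \<Longrightarrow> \<not> P j"
  using assms exists_least_iff[of P] by blast

lemma valley_above: "x \<in> branch 3 \<Longrightarrow> x \<noteq> 2 \<Longrightarrow> crit_value2 < f0 x"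
  using slope_pos by (auto simp: f0_branch valley_def branch_def)

lemma inflection_neq: "x \<in> branch 2 \<Longrightarrow> x \<noteq> 1 \<Longrightarrow> f0 x \<noteq> crit_value1"
  using slope_pos by (auto simp: f0_branch inflection_def)

lemma f0_crit_points: "f0 1 = crit_value1" "f0 2 = crit_value2"
  by (simp_all add: f0_eqs inflection_def valley_def)

text \<open>The time is a function of the itinerary, being determined by the first symbol that
  differs from a critical itinerary. One \<open>t\<close> therefore serves all points of an interval
  of survivors in \<open>survivors_no_interval\<close>.\<close>

lemma uniform_expansion:
  assumes "x \<in> survivors" "x \<noteq> 1" "x \<noteq> 2"
  shows "\<exists>t\<ge>1. \<forall>x'\<in>survivors. (\<forall>n. symbol ((f0 ^^ n) x') = symbol ((f0 ^^ n) x)) \<longrightarrow>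
    2 ^ (6 * t) \<le> expansion t x'"
proof -
  have x: "x \<in> branch (symbol x)" by (rule survivors_branch) fact
  consider "symbol x \<le> 1" | "symbol x = 2" | "symbol x = 3" using symbol_le[of x] by linarith
  then show ?thesis
  proof cases
    case 1
    have "2 ^ 6 \<le> expansion 1 x'"
      if "x' \<in> survivors" "\<forall>n. symbol ((f0 ^^ n) x') = symbol ((f0 ^^ n) x)" for x'
    proof -
      have "x' \<in> branch (symbol x)"
        using survivors_branch[OF that(1)] spec[OF that(2), of 0] by simp
      from branch_deriv[OF this 1] show ?thesis by simp
    qed
    then show ?thesis by (intro exI[of _ 1]) auto
  next
    case 2
    then have "\<exists>t. symbol ((f0 ^^ t) (f0 x)) \<noteq> itin1 t"
      using crit_value1_separates[OF survivors_step[OF assms(1)]] inflection_neq assms(2) x by simp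
    then obtain t where t: "symbol ((f0 ^^ t) (f0 x)) \<noteq> itin1 t"
      "\<And>j. j < t \<Longrightarrow> \<not> symbol ((f0 ^^ j) (f0 x)) \<noteq> itin1 j"
      by (rule LeastI_minimal) blast
    have "2 ^ (6 * Suc t) \<le> expansion (Suc t) x'"
      if x': "x' \<in> survivors" "\<forall>n. symbol ((f0 ^^ n) x') = symbol ((f0 ^^ n) x)" for x'
    proof -
      have eq: "symbol ((f0 ^^ j) (f0 x')) = symbol ((f0 ^^ j) (f0 x))" for j
        using x'(2) unfolding funpow_Suc_left by blast
      have "x' \<in> branch 2" using survivors_branch[OF x'(1)] spec[OF x'(2), of 0] 2 by simp
      then have "2 ^ (7 * Suc t) \<le> expansion (Suc t) x'"
        using inflection_expansion[OF x'(1), of t] t unfolding eq by blast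
      moreover have "2 ^ (6 * Suc t) \<le> (2 ^ (7 * Suc t) :: real)" by (intro power_increasing) auto
      ultimately show ?thesis by linarith
    qed
    then show ?thesis by (intro exI[of _ "Suc t"]) auto
  next
    case 3
    then have "\<exists>t. symbol ((f0 ^^ t) (f0 x)) \<noteq> itin2 t"
      using crit_value2_separates[OF survivors_step[OF assms(1)]] valley_above assms(3) x by simp
    then obtain t where t: "symbol ((f0 ^^ t) (f0 x)) \<noteq> itin2 t"
      "\<And>j. j < t \<Longrightarrow> \<not> symbol ((f0 ^^ j) (f0 x)) \<noteq> itin2 j"
      by (rule LeastI_minimal) blast
    have "2 ^ (6 * Suc t) \<le> expansion (Suc t) x'"
      if x': "x' \<in> survivors" "\<forall>n. symbol ((f0 ^^ n) x') = symbol ((f0 ^^ n) x)" for x'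
    proof -
      have eq: "symbol ((f0 ^^ j) (f0 x')) = symbol ((f0 ^^ j) (f0 x))" for j
        using x'(2) unfolding funpow_Suc_left by blast
      have "x' \<in> branch 3" using survivors_branch[OF x'(1)] spec[OF x'(2), of 0] 3 by simp
      then show ?thesis
        using valley_expansion[OF x'(1), of t] t unfolding eq by blast
    qed
    then show ?thesis by (intro exI[of _ "Suc t"]) auto
  qed
qed

lemma expansion_crit_value1: "2 ^ (23 * t) \<le> expansion t crit_value1"
  by (rule shadows_expansion[OF crit_value1_shadows itin1_le])

lemma expansion_crit_value2: "2 ^ (18 * visit i) \<le> expansion (visit i) crit_value2"
  using power_cancel[of "visit i" 1 "expansion (visit i) crit_value2" "16 * loss i"]
    visit_growth[OF order_refl crit_value2_shadows, of i] loss_visit[of i] expansion_nonneg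
  by simp

section \<open>The Julia set\<close>

lemma funpow_has_deriv:
  "\<exists>D. ((f0 ^^ n) has_real_derivative D) (at x) \<and> \<bar>D\<bar> = expansion n x"
proof (induction n)
  case 0
  have "((f0 ^^ 0) has_real_derivative 1) (at x)" by (simp add: id_def)
  then show ?case by (intro exI[of _ 1]) simp
next
  case (Suc n)
  then obtain D where D: "((f0 ^^ n) has_real_derivative D) (at x)" "\<bar>D\<bar> = expansion n x" by blast
  have "((f0 ^^ Suc n) has_real_derivative deriv f0 ((f0 ^^ n) x) * D) (at x)"
    unfolding funpow.simps by (rule DERIV_chain[OF f0_has_deriv D(1)])
  moreover have "\<bar>deriv f0 ((f0 ^^ n) x) * D\<bar> = expansion (Suc n) x"
    unfolding abs_mult D(2) by (simp add: expansion_def)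
  ultimately show ?case by (intro exI conjI)
qed

lemma continuous_on_funpow: "continuous_on S (f0 ^^ n)"
  using funpow_has_deriv by (meson DERIV_isCont continuous_at_imp_continuous_on)

lemma funpow_plus: "(f0 ^^ (m + n)) x = (f0 ^^ m) ((f0 ^^ n) x)"
  by (simp add: funpow_add)

lemma funpow_zero: "(f0 ^^ n) 0 = 0"
  by (induction n) (simp_all add: f0_eqs hump_def)

lemma image_funpow_plus: "(f0 ^^ m) ` (f0 ^^ n) ` S = (f0 ^^ (m + n)) ` S"
  by (simp add: image_image funpow_plus)

lemma connected_Icc_subset:
  fixes S :: "real set"
  assumes "connected S" "u \<in> S" "w \<in> S"
  shows "{u..w} \<subseteq> S"
  using assms by (meson connected_contains_Icc)

text \<open>The cuts 1/10, 1/2 and 3/2 of \<open>symbol\<close> lie outside all branches, so no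
  interval of survivors crosses them.\<close>

lemma connected_survivors_symbol:
  assumes "connected C" "C \<subseteq> survivors" "u \<in> C" "w \<in> C"
  shows "symbol u = symbol w"
proof -
  have main: "symbol u = symbol w" if uw: "u \<in> C" "w \<in> C" "u \<le> w" for u w
  proof (rule ccontr)
    assume ne: "symbol u \<noteq> symbol w"
    define a :: real where "a = (if symbol u = 0 then 1/10 else if symbol u = 1 then 1/2 else 3/2)"
    have a: "a = 1/10 \<or> a = 1/2 \<or> a = 3/2" "u \<le> a" "a \<le> w"
      using ne uw(3) by (auto simp: symbol_def a_def split: if_splits)
    then have "a \<in> survivors"
      using connected_Icc_subset[OF assms(1) uw(1,2)] assms(2) by auto
    then have "a \<in> branch (symbol a)" by (rule survivors_branch)
    then show False using a(1) by (auto simp: branch_def symbol_def)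
  qed
  show ?thesis
  proof (cases "u \<le> w")
    case True
    then show ?thesis by (rule main[OF assms(3,4)])
  next
    case False
    then have "w \<le> u" by simp
    from main[OF assms(4,3) this] show ?thesis by simp
  qed
qed

text \<open>An interval of survivors longer than half the supremum of such lengths has points of one
  itinerary only. By the mean value theorem a common iterate at least doubles its length, beyond the
  supremum.\<close>

lemma survivors_no_interval:
  assumes "a < b" "{a..b} \<subseteq> survivors"
  shows False
proof -
  define X where "X = {b - a | a b. a \<le> b \<and> {a..b} \<subseteq> survivors}"
  have bound: "r \<le> 3" if "r \<in> X" for r
  proof -
    obtain a b where ab: "r = b - a" "a \<le> b" "{a..b} \<subseteq> survivors" using \<open>r \<in> X\<close> by (auto simp: X_def)
    then have "a \<in> survivors" "b \<in> survivors" by auto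
    then show ?thesis using survivors_bounds[of a] survivors_bounds[of b] ab(1) by linarith
  qed
  then have bdd: "bdd_above X" by (rule bdd_aboveI)
  have "b - a \<in> X" unfolding X_def using assms by (intro CollectI exI[of _ a] exI[of _ b]) auto
  then have S: "b - a \<le> Sup X" using bdd by (rule cSup_upper)
  then have "Sup X / 2 < Sup X" using assms(1) by simp
  then obtain r where "r \<in> X" "Sup X / 2 < r"
    using less_cSup_iff[of X "Sup X / 2"] \<open>b - a \<in> X\<close> bdd by auto
  then obtain c d where cd: "c \<le> d" "{c..d} \<subseteq> survivors" "Sup X / 2 < d - c" by (auto simp: X_def)
  have "c < d" using cd S assms(1) by linarith
  then have "infinite ({c..d} - {1, 2})" by simp
  then have "{c..d} - {1, 2} \<noteq> {}" by (rule infinite_imp_nonempty)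
  then obtain x where x: "x \<in> {c..d}" "x \<noteq> 1" "x \<noteq> 2" by blast
  then have "x \<in> survivors" using cd by blast
  from uniform_expansion[OF this x(2,3)] obtain t where t: "t \<ge> 1"
    "\<And>x'. x' \<in> survivors \<Longrightarrow> \<forall>n. symbol ((f0 ^^ n) x') = symbol ((f0 ^^ n) x) \<Longrightarrow>
      2 ^ (6 * t) \<le> expansion t x'" by blast
  have conn: "connected ((f0 ^^ n) ` {c..d})" for n
    by (rule connected_continuous_image[OF continuous_on_funpow]) simp
  have surv: "(f0 ^^ n) ` {c..d} \<subseteq> survivors" for n
    using cd(2) survivors_funpow by blast
  have exp: "2 ^ (6 * t) \<le> expansion t x'" if "x' \<in> {c..d}" for x'
  proof (rule t(2))
    show "x' \<in> survivors" using that cd by blast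
    show "\<forall>n. symbol ((f0 ^^ n) x') = symbol ((f0 ^^ n) x)"
      using connected_survivors_symbol[OF conn surv] that x(1) by blast
  qed
  have "\<exists>f'. \<forall>x. ((f0 ^^ t) has_real_derivative f' x) (at x) \<and> \<bar>f' x\<bar> = expansion t x"
    by (intro choice allI funpow_has_deriv)
  then obtain f' where f': "\<And>x. ((f0 ^^ t) has_real_derivative f' x) (at x)"
    "\<And>x. \<bar>f' x\<bar> = expansion t x" by blast
  obtain \<xi> where \<xi>: "c < \<xi>" "\<xi> < d" "(f0 ^^ t) d - (f0 ^^ t) c = (d - c) * f' \<xi>"
    using MVT2[OF \<open>c < d\<close>, of "f0 ^^ t" f'] f'(1) by blast
  define D where "D = f' \<xi>"
  have "\<bar>D\<bar> = expansion t \<xi>" using f'(2) by (simp add: D_def)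
  then have "2 ^ (6 * t) \<le> \<bar>D\<bar>" using exp[of \<xi>] \<xi> by simp
  moreover have "(2::real) ^ 1 \<le> 2 ^ (6 * t)" using t(1) by (intro power_increasing) auto
  ultimately have "2 \<le> \<bar>D\<bar>" by simp
  then have "(d - c) * 2 \<le> (d - c) * \<bar>D\<bar>" using \<open>c < d\<close> by (intro mult_left_mono) auto
  then have big: "(d - c) * 2 \<le> \<bar>(f0 ^^ t) d - (f0 ^^ t) c\<bar>"
    using \<xi>(3) \<open>c < d\<close> by (simp add: abs_mult D_def)
  let ?u = "min ((f0 ^^ t) c) ((f0 ^^ t) d)" and ?w = "max ((f0 ^^ t) c) ((f0 ^^ t) d)"
  have "{?u..?w} \<subseteq> (f0 ^^ t) ` {c..d}"
    using cd(1) by (intro connected_Icc_subset[OF conn]) (auto simp: min_def max_def)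
  then have "{?u..?w} \<subseteq> survivors" using surv by blast
  moreover have "?u \<le> ?w" by simp
  ultimately have "?w - ?u \<in> X" unfolding X_def by blast
  then have "?w - ?u \<le> Sup X" using bdd by (rule cSup_upper)
  moreover have "?w - ?u = \<bar>(f0 ^^ t) d - (f0 ^^ t) c\<bar>" by (auto simp: min_def max_def)
  ultimately have "\<bar>(f0 ^^ t) d - (f0 ^^ t) c\<bar> \<le> Sup X" by simp
  with big have "(d - c) * 2 \<le> Sup X" by (rule order_trans)
  then show False using cd(3) by simp
qed

section \<open>Openness away from the fold\<close>

lemma image_ball_between:
  assumes "f0 a < y" "y < f0 b" "connected U" "a \<in> U" "b \<in> U"
  shows "\<exists>e>0. ball y e \<subseteq> f0 ` U"
proof -
  have "{f0 a..f0 b} \<subseteq> f0 ` U"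
    using assms(4,5)
    by (intro connected_Icc_subset[OF connected_continuous_image[OF continuous_on_f0 assms(3)]]) auto
  moreover have "open {f0 a<..<f0 b}" "y \<in> {f0 a<..<f0 b}" using assms by auto
  then obtain e where "e > 0" "ball y e \<subseteq> {f0 a<..<f0 b}" by (rule openE)
  moreover have "{f0 a<..<f0 b} \<subseteq> {f0 a..f0 b}" by auto
  ultimately show ?thesis by (meson subset_trans)
qed

lemma image_ball_of_crossing:
  assumes "(f0 a < y \<and> y < f0 b) \<or> (f0 b < y \<and> y < f0 a)"
    and "connected U" "a \<in> U" "b \<in> U"
  shows "\<exists>e>0. ball y e \<subseteq> f0 ` U"
  using assms(1)
proof
  assume "f0 a < y \<and> y < f0 b"
  then show ?thesis using image_ball_between[of a y b U] assms by blast
next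
  assume "f0 b < y \<and> y < f0 a"
  then show ?thesis using image_ball_between[of b y a U] assms by blast
qed

text \<open>The map crosses its value at x: at 1 because the power is odd, elsewhere because
  \<open>uniform_expansion\<close> forces a nonzero derivative. At 2 the fold keeps only one
  side.\<close>

lemma f0_open_at:
  assumes "x \<in> survivors" "x \<noteq> 2" "e > 0"
  shows "\<exists>d>0. ball (f0 x) d \<subseteq> f0 ` ball x e"
proof (cases "x = 1")
  case True
  define h where "h = min (e / 2) (1/10)"
  have h: "0 < h" "h < e" "h \<le> 1/10" using assms(3) by (auto simp: h_def)
  have "f0 (1 - h) < f0 1" "f0 1 < f0 (1 + h)"
    using h slope_pos by (simp_all add: f0_eqs inflection_def power3_eq_cube)
  then show ?thesis
    using image_ball_of_crossing[of "1 - h" "f0 1" "1 + h" "ball x e"] True h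
    by (simp add: dist_real_def)
next
  case False
  from uniform_expansion[OF assms(1) False assms(2)] assms(1)
  obtain t where t: "t \<ge> 1" "2 ^ (6 * t) \<le> expansion t x" by blast
  have "deriv f0 x \<noteq> 0"
  proof
    assume "deriv f0 x = 0"
    moreover have "expansion t x = expansion 1 x * expansion (t - 1) (f0 x)"
      using expansion_add[of 1 "t - 1" x] t(1) by simp
    ultimately have "expansion t x = 0" by simp
    then show False using t(2) zero_less_power[of "2::real" "6 * t"] by linarith
  qed
  then consider "0 < deriv f0 x" | "deriv f0 x < 0" by linarith
  then have "\<exists>h>0. h < e \<and> ((f0 (x - h) < f0 x \<and> f0 x < f0 (x + h)) \<or>
      (f0 (x + h) < f0 x \<and> f0 x < f0 (x - h)))"
  proof cases
    case 1
    obtain d1 where d1: "d1 > 0" "\<And>h. 0 < h \<Longrightarrow> h < d1 \<Longrightarrow> f0 x < f0 (x + h)"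
      using DERIV_pos_inc_right[OF f0_has_deriv 1] by blast
    obtain d2 where d2: "d2 > 0" "\<And>h. 0 < h \<Longrightarrow> h < d2 \<Longrightarrow> f0 (x - h) < f0 x"
      using DERIV_pos_inc_left[OF f0_has_deriv 1] by blast
    define h where "h = min e (min d1 d2) / 2"
    have "0 < h" "h < e" "h < d1" "h < d2" using d1(1) d2(1) assms(3) by (auto simp: h_def min_def)
    then show ?thesis using d1(2) d2(2) by blast
  next
    case 2
    obtain d1 where d1: "d1 > 0" "\<And>h. 0 < h \<Longrightarrow> h < d1 \<Longrightarrow> f0 (x + h) < f0 x"
      using DERIV_neg_dec_right[OF f0_has_deriv 2] by blast
    obtain d2 where d2: "d2 > 0" "\<And>h. 0 < h \<Longrightarrow> h < d2 \<Longrightarrow> f0 x < f0 (x - h)"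
      using DERIV_neg_dec_left[OF f0_has_deriv 2] by blast
    define h where "h = min e (min d1 d2) / 2"
    have "0 < h" "h < e" "h < d1" "h < d2" using d1(1) d2(1) assms(3) by (auto simp: h_def min_def)
    then show ?thesis using d1(2) d2(2) by blast
  qed
  then obtain h where h: "h > 0" "h < e" "(f0 (x - h) < f0 x \<and> f0 x < f0 (x + h)) \<or>
      (f0 (x + h) < f0 x \<and> f0 x < f0 (x - h))" by blast
  then show ?thesis
    by (intro image_ball_of_crossing[of "x - h" _ "x + h"]) (auto simp: dist_real_def)
qed

lemma funpow_open_at:
  assumes "x \<in> survivors" "e > 0"
  shows "(\<exists>d>0. ball ((f0 ^^ n) x) d \<subseteq> (f0 ^^ n) ` ball x e) \<or> (\<exists>j<n. (f0 ^^ j) x = 2)"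
proof (induction n)
  case 0
  then show ?case using assms(2) by auto
next
  case (Suc n)
  then show ?case
  proof (elim disjE)
    assume "\<exists>d>0. ball ((f0 ^^ n) x) d \<subseteq> (f0 ^^ n) ` ball x e"
    then obtain d where d: "d > 0" "ball ((f0 ^^ n) x) d \<subseteq> (f0 ^^ n) ` ball x e" by blast
    show ?thesis
    proof (cases "(f0 ^^ n) x = 2")
      case False
      obtain r where r: "r > 0"
        "ball (f0 ((f0 ^^ n) x)) r \<subseteq> f0 ` ball ((f0 ^^ n) x) d"
        using f0_open_at[OF survivors_funpow[OF assms(1)] False d(1)] by blast
      have "f0 ` ball ((f0 ^^ n) x) d \<subseteq> (f0 ^^ Suc n) ` ball x e"
        using image_mono[OF d(2), of f0] by (simp add: image_image)
      with r(2) have "ball ((f0 ^^ Suc n) x) r \<subseteq> (f0 ^^ Suc n) ` ball x e"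
        by (metis subset_trans comp_apply funpow.simps(2))
      then show ?thesis using r(1) by blast
    qed blast
  next
    assume "\<exists>j<n. (f0 ^^ j) x = 2"
    then show ?thesis using less_SucI by blast
  qed
qed

text \<open>An orbit that returns to branch 2 at every visit is never absorbed by the fixed point
  0.\<close>

lemma crit_value2_orbit_bounds: "0 < (f0 ^^ j) crit_value2" "(f0 ^^ j) crit_value2 \<le> 2"
proof -
  have b: "(f0 ^^ j) crit_value2 \<in> branch (itin2 j)" by (rule crit_value2_orbit)
  then show "(f0 ^^ j) crit_value2 \<le> 2"
    using itin2_le[of j] by (auto simp: branch_def split: if_splits)
  have "(f0 ^^ j) crit_value2 \<noteq> 0"
  proof
    assume 0: "(f0 ^^ j) crit_value2 = 0"
    have "j \<le> visit j" by (rule seq_suble[OF strict_mono_visit])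
    then have "(f0 ^^ visit j) crit_value2 = 0"
      using 0 funpow_plus[of "visit j - j" j crit_value2] by (simp add: funpow_zero)
    then show False using visit_branch[of j] by (simp add: branch_def)
  qed
  then show "0 < (f0 ^^ j) crit_value2"
    using survivors_bounds[OF survivors_funpow[OF crit_value2_survivor, of j]] by linarith
qed

text \<open>After 2 the orbit is that of \<open>crit_value2\<close>. In the proof of exactness
  openness is needed only at orbit points that are 0 or exceed 2; such points have not passed
  through the fold before.\<close>

lemma hit_crit:
  assumes "j < n" "(f0 ^^ j) x = 2"
  shows "0 < (f0 ^^ n) x" "(f0 ^^ n) x \<le> 2"
proof -
  have "n = (n - Suc j) + Suc j" using assms(1) by simp
  then have "(f0 ^^ n) x = (f0 ^^ (n - Suc j)) ((f0 ^^ Suc j) x)"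
    by (metis funpow_plus)
  also have "(f0 ^^ Suc j) x = crit_value2" using assms(2) f0_crit_points by simp
  finally show "0 < (f0 ^^ n) x" "(f0 ^^ n) x \<le> 2"
    using crit_value2_orbit_bounds by simp_all
qed

section \<open>Exactness\<close>

text \<open>Images of an interval at the repelling fixed point 0 at least double until they contain
  branch 0, whose image covers {0..3}.\<close>

lemma cover_from_0:
  assumes "e > 0" "{0..e} \<subseteq> T" "connected T"
  shows "\<exists>m\<ge>1. {0..3} \<subseteq> (f0 ^^ m) ` T"
proof -
  have fixed: "f0 0 = 0" using funpow_zero[of 1] by simp
  have "\<exists>m. {0..1/20} \<subseteq> (f0 ^^ m) ` T"
  proof (rule ccontr)
    assume no: "\<nexists>m. {0..1/20} \<subseteq> (f0 ^^ m) ` T"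
    have conn: "connected ((f0 ^^ m) ` T)" for m
      by (rule connected_continuous_image[OF continuous_on_funpow assms(3)])
    have "{0..2 ^ m * e} \<subseteq> (f0 ^^ m) ` T" for m
    proof (induction m)
      case 0
      then show ?case using assms(2) by simp
    next
      case (Suc m)
      let ?r = "2 ^ m * e"
      have r: "0 < ?r" "?r < 1/20"
      proof -
        show "0 < ?r" using assms(1) by simp
        show "?r < 1/20"
        proof (rule ccontr)
          assume "\<not> ?r < 1/20"
          then have "{0..1/20} \<subseteq> {0..?r}" by auto
          then show False using Suc no by blast
        qed
      qed
      have "2 ^ 23 * \<bar>?r - 0\<bar> \<le> \<bar>f0 ?r - f0 0\<bar>"
        by (rule branch_expand[of _ 0]) (use r in \<open>auto simp: branch_def\<close>)
      moreover have "f0 0 \<le> f0 ?r"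
        by (rule branch_mono(1)[of _ 0]) (use r in \<open>auto simp: branch_def\<close>)
      ultimately have "2 * ?r \<le> f0 ?r" using r fixed by simp
      then have "{0..2 ^ Suc m * e} \<subseteq> {0..f0 ?r}" by auto
      also have "\<dots> \<subseteq> (f0 ^^ Suc m) ` T"
      proof (rule connected_Icc_subset[OF conn])
        have "0 \<in> (f0 ^^ m) ` T" "?r \<in> (f0 ^^ m) ` T" using Suc r by force+
        then show "0 \<in> (f0 ^^ Suc m) ` T" "f0 ?r \<in> (f0 ^^ Suc m) ` T"
          using fixed by (force simp flip: image_comp)+
      qed
      finally show ?case .
    qed
    moreover obtain m where "1 / e < 2 ^ m" using real_arch_pow[of 2 "1 / e"] by auto
    then have "1/20 \<le> 2 ^ m * e" using assms(1) by (simp add: field_simps)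
    then have "{0..1/20} \<subseteq> {0..2 ^ m * e}" by auto
    ultimately show False using no by blast
  qed
  then obtain m where m: "{0..1/20} \<subseteq> (f0 ^^ m) ` T" by blast
  have "{0..3} \<subseteq> hump ` branch 0" by (rule hump_branch) simp
  also have "hump ` branch 0 = f0 ` branch 0"
    by (intro image_cong) (simp_all add: f0_branch(1)[of 0])
  also have "\<dots> \<subseteq> f0 ` (f0 ^^ m) ` T" using m by (intro image_mono) (simp add: branch_def)
  also have "\<dots> = (f0 ^^ Suc m) ` T" by (simp add: image_image)
  finally show ?thesis by (intro exI[of _ "Suc m"]) simp
qed

text \<open>A connected set reaching from below 2 to above 3 contains {2..3}. Its image reaches from
  \<open>crit_value2\<close> to 3 and so contains branch 2, which covers {0..3} in one more
  step.\<close>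

lemma cover_from_right:
  assumes "connected T" "u \<in> T" "u \<le> 2" "w \<in> T" "3 \<le> w"
  shows "{0..3} \<subseteq> (f0 ^^ 2) ` T"
proof -
  have "{2..3} \<subseteq> T" using connected_Icc_subset[OF assms(1,2,4)] assms(3,5) by auto
  then have "2 \<in> T" "3 \<in> T" by (simp_all add: subset_eq)
  then have 2: "f0 2 \<in> f0 ` T" "f0 3 \<in> f0 ` T" by blast+
  have 3: "3 \<le> f0 3" using crit_value2_bounds by (simp add: f0_eqs valley_def slope_def)
  have "{f0 2..f0 3} \<subseteq> f0 ` T"
    by (rule connected_Icc_subset[OF connected_continuous_image[OF continuous_on_f0 assms(1)] 2])
  then have b: "branch 2 \<subseteq> f0 ` T"
    using crit_value2_bounds 3 by (auto simp: f0_crit_points branch_def subset_eq)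
  have "{0..3} \<subseteq> inflection crit_value1 ` branch 2"
    using crit_value1_bounds by (intro inflection_branch) auto
  also have "\<dots> = f0 ` branch 2"
    by (intro image_cong) (simp_all add: f0_branch(2))
  also have "\<dots> \<subseteq> f0 ` f0 ` T" using b by (rule image_mono)
  finally show ?thesis by (simp add: numeral_2_eq_2 image_image)
qed

lemma f0_above_3: "3 \<le> x \<Longrightarrow> 3 \<le> f0 x"
proof -
  assume x: "3 \<le> x"
  have "f0 3 \<le> f0 x"
  proof (rule DERIV_nonneg_imp_nondecreasing[OF x])
    fix y :: real assume "3 \<le> y" "y \<le> x"
    then show "\<exists>D. (f0 has_real_derivative D) (at y) \<and> 0 \<le> D"
      using f0_has_deriv[of y] f0_deriv_right[of y] by force
  qed
  then show ?thesis using crit_value2_bounds by (simp add: f0_eqs valley_def slope_def)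
qed

text \<open>An image above 2 keeps y away from the fold: slope (y - 2)^2 (y - 1) is at least 1,
  which gives slope (y - 2) at least 1 and derivative at least 2 from y on.\<close>

lemma right_arm_expand:
  assumes "2 < y" "y \<le> x" "x \<le> 21/10" "2 < f0 y"
  shows "2 * (x - y) \<le> f0 x - f0 y"
proof -
  have "f0 y = valley crit_value2 y" using assms by (intro f0_eqs) auto
  then have "1 \<le> slope * (y - 2)\<^sup>2 * (y - 1)" using assms(4) crit_value2_bounds by (simp add: valley_def)
  also have "\<dots> \<le> slope * (y - 2)\<^sup>2 * 2" using assms slope_pos by (intro mult_left_mono) auto
  finally have "slope * 1 \<le> slope * (slope * (y - 2)\<^sup>2 * 2)"
    by (rule mult_left_mono) (use slope_pos in simp)
  then have "1\<^sup>2 \<le> (slope * (y - 2))\<^sup>2"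
    by (simp add: power_mult_distrib) (simp add: slope_def power2_eq_square)
  then have big: "1 \<le> slope * (y - 2)"
    by (rule power2_le_imp_le) (use assms slope_pos in simp)
  show ?thesis
  proof (cases "y = x")
    case False
    then have "y < x" using assms by simp
    from MVT2[OF this, of f0 "deriv f0"] obtain z where z: "y < z" "z < x"
      "f0 x - f0 y = (x - y) * deriv f0 z" using f0_has_deriv by blast
    have "1 * 2 \<le> (slope * (z - 2)) * (3 * z - 4)"
    proof (rule mult_mono)
      have "slope * (y - 2) \<le> slope * (z - 2)" using z slope_pos by (intro mult_left_mono) auto
      then show "1 \<le> slope * (z - 2)" using big by simp
    qed (use assms z slope_pos in auto)
    then have "2 \<le> deriv f0 z" using f0_deriv_valley[of z] z assms by simp
    then have "(x - y) * 2 \<le> (x - y) * deriv f0 z" using assms by (intro mult_left_mono) auto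
    then show ?thesis using z(3) by simp
  qed simp
qed

text \<open>The ball contains an escaping point, so an image of it is an interval joining a
  surviving point to the outside of {0..3}. Escape to the left yields an interval starting at 0,
  escape to the right one that eventually spans {2..3}.\<close>

lemma survivors_exact:
  assumes "x \<in> survivors" "e > 0"
  shows "\<exists>n\<ge>1. {0..3} \<subseteq> (f0 ^^ n) ` ball x e"
proof -
  have "\<exists>u\<in>ball x e. u \<notin> survivors"
  proof (rule ccontr)
    assume "\<not> ?thesis"
    then have "{x - e / 2..x + e / 2} \<subseteq> survivors" using assms(2) by (auto simp: dist_real_def subset_eq)
    then show False using survivors_no_interval[of "x - e / 2" "x + e / 2"] assms(2) by simp
  qed
  then obtain u n where u: "u \<in> ball x e" "(f0 ^^ n) u \<notin> {0..3}"
    unfolding survivors_def by blast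
  define T where "T = (f0 ^^ n) ` ball x e"
  have T: "connected T" unfolding T_def by (rule connected_continuous_image[OF continuous_on_funpow]) simp
  have uT: "(f0 ^^ n) u \<in> T" "(f0 ^^ n) x \<in> T" using u assms(2) by (auto simp: T_def)
  have op: "(\<exists>d>0. ball ((f0 ^^ n) x) d \<subseteq> T) \<or> (\<exists>j<n. (f0 ^^ j) x = 2)"
    unfolding T_def by (rule funpow_open_at[OF assms])
  have lift: ?thesis if "\<exists>m\<ge>1. {0..3} \<subseteq> (f0 ^^ m) ` T"
  proof -
    from that obtain m where "m \<ge> 1" "{0..3} \<subseteq> (f0 ^^ (m + n)) ` ball x e"
      unfolding T_def image_funpow_plus by blast
    then show ?thesis by (intro exI[of _ "m + n"]) auto
  qed
  have xn: "(f0 ^^ m) x \<in> survivors" for m by (rule survivors_funpow[OF assms(1)])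
  consider "(f0 ^^ n) u < 0" | "3 < (f0 ^^ n) u" using u(2) by force
  then show ?thesis
  proof cases
    case 1
    have "\<exists>d>0. {0..d} \<subseteq> T"
    proof (cases "(f0 ^^ n) x = 0")
      case True
      then have "\<nexists>j. j < n \<and> (f0 ^^ j) x = 2" using hit_crit(1)[of _ n x] by force
      then obtain d where d: "d > 0" "ball 0 d \<subseteq> T" using op True by auto
      then have "{0..d / 2} \<subseteq> T" by (auto simp: subset_eq dist_real_def)
      then show ?thesis using d(1) half_gt_zero by blast
    next
      case False
      then have "0 < (f0 ^^ n) x" using survivors_bounds[OF xn[of n]] by simp
      moreover have "{0..(f0 ^^ n) x} \<subseteq> T" using connected_Icc_subset[OF T uT] 1 by auto
      ultimately show ?thesis by blast
    qed
    then show ?thesis using cover_from_0[OF _ _ T] lift by blast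
  next
    case 2
    have right: "3 \<le> (f0 ^^ m) ((f0 ^^ n) u)" for m
      by (induction m) (use 2 f0_above_3 in auto)
    \<comment> \<open>Otherwise the surviving point and a point slightly to its left stay on the
      right arm of the fold forever, and their distance doubles at each step.\<close>
    have "\<exists>m. \<exists>y\<in>T. (f0 ^^ m) y \<le> 2"
    proof (rule ccontr)
      assume no: "\<not> ?thesis"
      then have "(f0 ^^ 0) ((f0 ^^ n) x) > 2" using uT(2) by (meson not_le)
      then have "\<nexists>j. j < n \<and> (f0 ^^ j) x = 2" using hit_crit(2)[of _ n x] by force
      then obtain d where d: "d > 0" "ball ((f0 ^^ n) x) d \<subseteq> T" using op by blast
      let ?x = "(f0 ^^ n) x"
      define y where "y = ?x - d / 2"
      have y: "y \<in> T" using d by (auto simp: y_def subset_eq dist_real_def)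
      have gt: "2 < (f0 ^^ m) y" "2 < (f0 ^^ m) ?x" for m using no y uT(2) by (meson not_le)+
      have grow: "2 ^ m * (d / 2) \<le> (f0 ^^ m) ?x - (f0 ^^ m) y" for m
      proof (induction m)
        case 0
        then show ?case by (simp add: y_def)
      next
        case (Suc m)
        have "(f0 ^^ m) ?x \<in> survivors" using xn[of "m + n"] by (simp add: funpow_plus)
        then have "(f0 ^^ m) ?x \<in> branch (symbol ((f0 ^^ m) ?x))" by (rule survivors_branch)
        then have "(f0 ^^ m) ?x \<le> 21/10"
          using gt(2)[of m] by (auto simp: branch_def split: if_splits)
        moreover have "0 \<le> 2 ^ m * (d / 2)" using d(1) by simp
        then have "(f0 ^^ m) y \<le> (f0 ^^ m) ?x" using Suc by linarith
        ultimately have "2 * ((f0 ^^ m) ?x - (f0 ^^ m) y)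
            \<le> f0 ((f0 ^^ m) ?x) - f0 ((f0 ^^ m) y)"
          using right_arm_expand[of "(f0 ^^ m) y" "(f0 ^^ m) ?x"] gt(1)[of m] gt(1)[of "Suc m"]
          by simp
        then show ?case using Suc by simp
      qed
      obtain m where "6 / d < 2 ^ m" using real_arch_pow[of 2 "6 / d"] by auto
      then have "3 < 2 ^ m * (d / 2)" using d(1) by (simp add: field_simps)
      moreover have "(f0 ^^ m) ?x \<le> 3"
        using survivors_bounds[OF xn[of "m + n"]] by (simp add: funpow_plus)
      ultimately show False using gt(1)[of m] grow[of m] by linarith
    qed
    then obtain m y where y: "y \<in> T" "(f0 ^^ m) y \<le> 2" by blast
    have "{0..3} \<subseteq> (f0 ^^ 2) ` (f0 ^^ m) ` T"
      by (rule cover_from_right[OF connected_continuous_image[OF continuous_on_funpow T] _ y(2) _ right])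
         (use y uT in auto)
    then have "{0..3} \<subseteq> (f0 ^^ (2 + m)) ` T" unfolding image_funpow_plus .
    then show ?thesis by (intro lift exI[of _ "2 + m"]) simp
  qed
qed

lemma survivors_interval: "survivors \<subseteq> {0..3}"
  using survivors_bounds by auto

lemma openin_survivor_ball:
  assumes "openin (top_of_set I0) U" "x \<in> U" "x \<in> survivors"
  shows "\<exists>e>0. ball x e \<subseteq> U"
proof -
  obtain e where e: "e > 0" "ball x e \<inter> I0 \<subseteq> U"
    using assms(1,2) unfolding openin_contains_ball by blast
  have "ball x (min e 1) \<subseteq> ball x e \<inter> I0"
    using survivors_bounds[OF assms(3)] radius_ge by (auto simp: dist_real_def)
  then show ?thesis using e by (intro exI[of _ "min e 1"]) auto
qed

lemma openin_survivor_exact: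
  assumes "openin (top_of_set I0) U" "U \<inter> survivors \<noteq> {}"
  shows "\<exists>n\<ge>1. {0..3} \<subseteq> (f0 ^^ n) ` U"
proof -
  obtain x where x: "x \<in> U" "x \<in> survivors" using assms(2) by blast
  obtain e where "e > 0" "ball x e \<subseteq> U" using openin_survivor_ball[OF assms(1) x] by blast
  then show ?thesis using survivors_exact[OF x(2)] by (meson image_mono subset_trans)
qed

section \<open>Identification of the Fatou set\<close>

text \<open>By exactness some image of any small neighbourhood contains both 0 and 3, against
  equicontinuity at scale 1.\<close>

lemma survivors_disjoint_Fatou: "survivors \<inter> Fatou I0 f0 = {}"
proof (rule ccontr)
  assume "survivors \<inter> Fatou I0 f0 \<noteq> {}"
  then obtain x where x: "x \<in> survivors" "x \<in> Fatou I0 f0" by blast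
  obtain V where V: "openin (top_of_set (Fatou I0 f0)) V" "x \<in> V"
    "equicontinuous_on V (iterates f0)"
    using Fatou_greatest(2) x(2) unfolding locally_equicontinuous_on_def by blast
  have opV: "openin (top_of_set I0) V" by (rule openin_trans[OF V(1) Fatou_greatest(1)])
  obtain d where d: "d > 0" "\<And>g y. g \<in> iterates f0 \<Longrightarrow> y \<in> V \<Longrightarrow> dist y x < d \<Longrightarrow> dist (g y) (g x) < 1"
    using V(2,3) unfolding equicontinuous_on_def by (metis zero_less_one)
  have "openin (top_of_set I0) (V \<inter> ball x d)" by (rule openin_Int_open[OF opV]) simp
  moreover have "V \<inter> ball x d \<inter> survivors \<noteq> {}" using x(1) V(2) d(1) by auto
  ultimately obtain n where n: "n \<ge> 1" "{0..3} \<subseteq> (f0 ^^ n) ` (V \<inter> ball x d)"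
    using openin_survivor_exact by blast
  have "dist z ((f0 ^^ n) x) < 1" if "z \<in> {0..3}" for z
    using n d(2)[of "f0 ^^ n"] that by (force simp: iterates_def dist_commute)
  from this[of 0] this[of 3] show False by (auto simp: dist_real_def)
qed

text \<open>Large n are handled by the uniform contraction, the finitely many others by
  continuity.\<close>

lemma equicontinuous_of_contracting:
  assumes "\<And>e. e > 0 \<Longrightarrow> \<exists>n0. \<forall>n\<ge>n0. \<forall>y\<in>V. \<forall>y'\<in>V. \<bar>(f0 ^^ n) y - (f0 ^^ n) y'\<bar> < e"
  shows "equicontinuous_on V (iterates f0)"
  unfolding equicontinuous_on_def
proof (intro ballI allI impI)
  fix x e :: real assume x: "x \<in> V" "0 < e"
  obtain n0 where n0: "\<And>n y. n \<ge> n0 \<Longrightarrow> y \<in> V \<Longrightarrow> \<bar>(f0 ^^ n) y - (f0 ^^ n) x\<bar> < e"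
    using assms[OF x(2)] x(1) by blast
  have "\<forall>\<^sub>F y in nhds x. dist ((f0 ^^ n) y) ((f0 ^^ n) x) < e" for n
  proof -
    have "isCont (f0 ^^ n) x" using funpow_has_deriv[of n x] DERIV_isCont by blast
    then have "((f0 ^^ n) \<longlongrightarrow> (f0 ^^ n) x) (nhds x)"
      unfolding isCont_def tendsto_at_iff_tendsto_nhds .
    then show ?thesis using x(2) by (rule tendstoD)
  qed
  then have "\<forall>\<^sub>F y in nhds x. \<forall>n\<in>{..<n0}. dist ((f0 ^^ n) y) ((f0 ^^ n) x) < e"
    by (intro eventually_ball_finite) auto
  then obtain d where d: "d > 0" "\<And>y n. dist y x < d \<Longrightarrow> n < n0 \<Longrightarrow> dist ((f0 ^^ n) y) ((f0 ^^ n) x) < e"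
    unfolding eventually_nhds_metric by auto
  have "dist ((f0 ^^ n) y) ((f0 ^^ n) x) < e" if "y \<in> V" "dist y x < d" for n y
    using n0[of n y] d(2)[of y n] that by (cases "n < n0") (auto simp: dist_real_def)
  then show "\<exists>d>0. \<forall>g\<in>iterates f0. \<forall>y\<in>V. dist y x < d \<longrightarrow> dist (g y) (g x) < e"
    using d(1) by (auto simp: iterates_def)
qed

lemma f0_mono_outside:
  assumes "x \<le> y" "y \<le> 0 \<or> 3 \<le> x"
  shows "f0 x \<le> f0 y"
proof (rule DERIV_nonneg_imp_nondecreasing[OF assms(1)])
  fix z assume z: "x \<le> z" "z \<le> y"
  have "0 \<le> deriv f0 z"
    using f0_deriv_left[of z] f0_deriv_right[of z] f0_deriv_hump[of 0] slope_pos z assms(2)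
    by (cases "z = 0") auto
  then show "\<exists>D. (f0 has_real_derivative D) (at z) \<and> 0 \<le> D" using f0_has_deriv by blast
qed

lemma f0_less:
  assumes "- radius < x" "x < 0"
  shows "f0 x < x"
proof -
  have h: "hump x < x"
  proof -
    have "1 * (1 * 1) \<le> slope * ((1 - 4 * x) * (1 - x))"
      using assms by (intro mult_mono) (auto simp: slope_def)
    moreover have "slope * ((1 - 4 * x) * (1 - x)) \<noteq> 1"
    proof -
      have "1 * 1 \<le> (1 - 4 * x) * (1 - x)" using assms by (intro mult_mono) auto
      then have "slope * 1 \<le> slope * ((1 - 4 * x) * (1 - x))" using slope_pos by (intro mult_left_mono) auto
      then show ?thesis by (simp add: slope_def)
    qed
    ultimately have "1 < slope * ((1 - 4 * x) * (1 - x))" by simp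
    then have "x * (slope * ((1 - 4 * x) * (1 - x))) < x * 1"
      using assms by (intro mult_strict_left_mono_neg) auto
    then show ?thesis by (simp add: hump_def algebra_simps)
  qed
  consider "x \<le> -2" | "-2 \<le> x" "x \<le> -1" | "-1 \<le> x" by linarith
  then show ?thesis
  proof cases
    case 1
    then show ?thesis using assms by (simp add: f0_eqs left_line_def)
  next
    case 2
    then show ?thesis
      using h glue_bounds(2)[of "-2" "-1" left_line x hump] left_zone[of x] by (simp add: f0_left)
  next
    case 3
    then show ?thesis using h assms by (simp add: f0_eqs)
  qed
qed

lemma f0_greater:
  assumes "3 \<le> x" "x < radius"
  shows "x < f0 x"
proof -
  have v: "x < valley crit_value2 x"
  proof -
    have "x < slope * 1 * (x - 1)" using assms by (simp add: slope_def)
    also have "\<dots> \<le> slope * (x - 2)\<^sup>2 * (x - 1)"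
      using assms slope_pos by (intro mult_right_mono mult_left_mono) auto
    finally show ?thesis using crit_value2_bounds by (simp add: valley_def)
  qed
  consider "x = 3" | "3 \<le> x" "x \<le> 4" | "4 \<le> x" using assms by linarith
  then show ?thesis
  proof cases
    case 1
    then show ?thesis using v by (simp add: f0_eqs)
  next
    case 2
    then show ?thesis
      using v glue_bounds(1)[of 3 4 "valley crit_value2" x right_line] right_zone[of x] by (simp add: f0_right)
  next
    case 3
    then show ?thesis using assms by (simp add: f0_eqs right_line_def)
  qed
qed

lemma f0_ends: "f0 (- radius) = - radius" "f0 radius = radius"
  using radius_ge by (simp_all add: f0_eqs left_line_def right_line_def)

lemma funpow_bounds: "x \<in> I0 \<Longrightarrow> (f0 ^^ n) x \<in> I0"
  by (induction n) (use f0_bounds in auto)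

lemma limit_fixed:
  assumes "(\<lambda>n. (f0 ^^ n) c) \<longlonglongrightarrow> l"
  shows "f0 l = l"
proof -
  have "(\<lambda>n. f0 ((f0 ^^ n) c)) \<longlonglongrightarrow> f0 l"
    by (rule isCont_tendsto_compose[OF DERIV_isCont[OF f0_has_deriv] assms])
  moreover have "(\<lambda>n. (f0 ^^ Suc n) c) \<longlonglongrightarrow> l" using assms by (rule LIMSEQ_Suc)
  ultimately show ?thesis by (simp add: LIMSEQ_unique)
qed

text \<open>The orbit decreases, and its limit is a fixed point; by \<open>f0_less\<close> the
  endpoint is the only one available.\<close>

lemma left_attraction:
  assumes "- radius \<le> c" "c < 0"
  shows "(\<lambda>n. (f0 ^^ n) c) \<longlonglongrightarrow> - radius"
proof -
  have b: "- radius \<le> (f0 ^^ n) c \<and> (f0 ^^ n) c \<le> c \<and> (f0 ^^ Suc n) c \<le> (f0 ^^ n) c" for n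
  proof (induction n)
    case 0
    then show ?case using assms f0_less[of c] f0_ends by (cases "c = - radius") auto
  next
    case (Suc n)
    have "(f0 ^^ Suc n) c \<in> I0" by (rule funpow_bounds) (use assms radius_ge in auto)
    moreover have "(f0 ^^ Suc (Suc n)) c \<le> (f0 ^^ Suc n) c"
      using Suc assms f0_mono_outside[of "(f0 ^^ Suc n) c" "(f0 ^^ n) c"] by simp
    ultimately show ?case using Suc by auto
  qed
  then have "decseq (\<lambda>n. (f0 ^^ n) c)" by (intro decseq_SucI) blast
  then obtain l where l: "(\<lambda>n. (f0 ^^ n) c) \<longlonglongrightarrow> l" using b decseq_convergent by metis
  have "- radius \<le> l" by (rule LIMSEQ_le_const[OF l]) (use b in blast)
  moreover have "l \<le> c" by (rule LIMSEQ_le_const2[OF l]) (use b in blast)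
  ultimately have "l = - radius"
    using limit_fixed[OF l] f0_less[of l] assms by (cases "l = - radius") auto
  with l show ?thesis by simp
qed

lemma right_attraction: "(\<lambda>n. (f0 ^^ n) 3) \<longlonglongrightarrow> radius"
proof -
  have b: "3 \<le> (f0 ^^ n) 3 \<and> (f0 ^^ n) 3 \<le> radius \<and> (f0 ^^ n) 3 \<le> (f0 ^^ Suc n) 3" for n
  proof (induction n)
    case 0
    then show ?case using f0_greater[of 3] radius_ge by simp
  next
    case (Suc n)
    have "(f0 ^^ Suc n) 3 \<in> I0" by (rule funpow_bounds) (use radius_ge in auto)
    moreover have "(f0 ^^ Suc n) 3 \<le> (f0 ^^ Suc (Suc n)) 3"
      using Suc f0_mono_outside[of "(f0 ^^ n) 3" "(f0 ^^ Suc n) 3"] by simp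
    ultimately show ?case using Suc by auto
  qed
  then have "incseq (\<lambda>n. (f0 ^^ n) 3)" by (intro incseq_SucI) blast
  then obtain l where l: "(\<lambda>n. (f0 ^^ n) 3) \<longlonglongrightarrow> l" using b incseq_convergent by metis
  have "3 \<le> l" by (rule LIMSEQ_le_const[OF l]) (use b in blast)
  moreover have "l \<le> radius" by (rule LIMSEQ_le_const2[OF l]) (use b in blast)
  ultimately have "l = radius"
    using limit_fixed[OF l] f0_greater[of l] by (cases "l = radius") auto
  with l show ?thesis by simp
qed

lemma funpow_mono_left: "- radius \<le> y \<Longrightarrow> y \<le> c \<Longrightarrow> c < 0 \<Longrightarrow>
    - radius \<le> (f0 ^^ n) y \<and> (f0 ^^ n) y \<le> (f0 ^^ n) c \<and> (f0 ^^ n) c < 0"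
proof (induction n)
  case (Suc n)
  let ?y = "(f0 ^^ n) y" and ?c = "(f0 ^^ n) c"
  have IH: "- radius \<le> ?y" "?y \<le> ?c" "?c < 0" using Suc by auto
  have "f0 (- radius) \<le> f0 ?y" "f0 ?y \<le> f0 ?c"
    using IH by (auto intro: f0_mono_outside)
  moreover have "f0 ?c < 0"
    using f0_less[of ?c] IH f0_ends by (cases "?c = - radius") auto
  ultimately show ?case using f0_ends by simp
qed simp

lemma funpow_mono_right: "3 \<le> y \<Longrightarrow> y \<le> radius \<Longrightarrow>
    (f0 ^^ n) y \<le> radius \<and> (f0 ^^ n) 3 \<le> (f0 ^^ n) y \<and> 3 \<le> (f0 ^^ n) 3"
proof (induction n)
  case (Suc n)
  let ?y = "(f0 ^^ n) y" and ?c = "(f0 ^^ n) 3"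
  have IH: "?y \<le> radius" "?c \<le> ?y" "3 \<le> ?c" using Suc by auto
  have "f0 ?y \<le> f0 radius" "f0 ?c \<le> f0 ?y" "3 \<le> f0 ?c"
    using IH by (auto intro: f0_mono_outside f0_above_3)
  then show ?case using f0_ends by simp
qed simp

lemma open_preimage:
  assumes "open S"
  shows "openin (top_of_set I0) {y \<in> I0. (f0 ^^ m) y \<in> S}"
proof -
  have "open ((f0 ^^ m) -` S)"
    by (rule open_vimage[OF assms continuous_on_funpow])
  moreover have "{y \<in> I0. (f0 ^^ m) y \<in> S} = I0 \<inter> (f0 ^^ m) -` S" by auto
  ultimately show ?thesis by (auto intro: openin_open_Int)
qed

lemma Fatou_of_contracting:
  assumes "openin (top_of_set I0) V" "x \<in> V"
    and "\<And>e. e > 0 \<Longrightarrow> \<exists>n0. \<forall>n\<ge>n0. \<forall>y\<in>V. \<bar>(f0 ^^ n) y - l\<bar> < e"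
  shows "x \<in> Fatou I0 f0"
proof -
  have "equicontinuous_on V (iterates f0)"
  proof (rule equicontinuous_of_contracting)
    fix e :: real assume "e > 0"
    then obtain n0 where n0: "\<And>n y. n \<ge> n0 \<Longrightarrow> y \<in> V \<Longrightarrow> \<bar>(f0 ^^ n) y - l\<bar> < e / 2"
      using assms(3)[of "e / 2"] by auto
    have "\<bar>(f0 ^^ n) y - (f0 ^^ n) y'\<bar> < e" if "n \<ge> n0" "y \<in> V" "y' \<in> V" for n y y'
      using n0[OF that(1,2)] n0[OF that(1,3)] by linarith
    then show "\<exists>n0. \<forall>n\<ge>n0. \<forall>y\<in>V. \<forall>y'\<in>V. \<bar>(f0 ^^ n) y - (f0 ^^ n) y'\<bar> < e" by blast
  qed
  then have "locally_equicontinuous_on V (iterates f0)"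
    unfolding locally_equicontinuous_on_def by (intro ballI exI[of _ V]) auto
  then show ?thesis using Fatou_greatest(3)[OF assms(1)] assms(2) by blast
qed

text \<open>The map is monotone on either side of {0..3}. Nearby orbits are therefore squeezed
  between the attracting endpoint and the orbit of one comparison point.\<close>

lemma escaping_Fatou:
  assumes "x \<in> I0" "x \<notin> survivors"
  shows "x \<in> Fatou I0 f0"
proof -
  obtain m where "(f0 ^^ m) x \<notin> {0..3}" using assms(2) by (auto simp: survivors_def)
  then consider "(f0 ^^ m) x < 0" | "3 < (f0 ^^ m) x" by force
  then show ?thesis
  proof cases
    case 1
    \<comment> \<open>Half the escaped value is negative and strictly to its right, so
      \<open>?V\<close> is a neighbourhood of \<open>x\<close> and the orbit of \<open>c\<close>
      bounds all orbits from \<open>?V\<close>.\<close>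
    define c where "c = (f0 ^^ m) x / 2"
    let ?V = "{y \<in> I0. (f0 ^^ m) y \<in> {..<c}}"
    have mx: "(f0 ^^ m) x \<in> I0" by (rule funpow_bounds[OF assms(1)])
    have c: "c < 0" "- radius \<le> c" "(f0 ^^ m) x < c" using 1 mx by (auto simp: c_def)
    show ?thesis
    proof (rule Fatou_of_contracting[of ?V _ "- radius"])
      show "openin (top_of_set I0) ?V" by (rule open_preimage) simp
      show "x \<in> ?V" using assms(1) c by simp
      fix e :: real assume "e > 0"
      then obtain n0 where n0: "\<And>n. n \<ge> n0 \<Longrightarrow> \<bar>(f0 ^^ n) c + radius\<bar> < e"
        using LIMSEQ_D[OF left_attraction[OF c(2,1)]] by auto
      have "\<bar>(f0 ^^ n) y - - radius\<bar> < e" if "n \<ge> n0 + m" "y \<in> ?V" for n y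
      proof -
        have n: "n = (n - m) + m" using that by simp
        have "(f0 ^^ m) y \<in> I0" using that funpow_bounds by blast
        then have "- radius \<le> (f0 ^^ (n - m)) ((f0 ^^ m) y) \<and>
            (f0 ^^ (n - m)) ((f0 ^^ m) y) \<le> (f0 ^^ (n - m)) c"
          using funpow_mono_left[of "(f0 ^^ m) y" c "n - m"] that c by simp
        then have "- radius \<le> (f0 ^^ n) y" "(f0 ^^ n) y \<le> (f0 ^^ (n - m)) c"
          using n funpow_plus[of "n - m" m y] by auto
        then show ?thesis using n0[of "n - m"] that(1) by linarith
      qed
      then show "\<exists>n0. \<forall>n\<ge>n0. \<forall>y\<in>?V. \<bar>(f0 ^^ n) y - - radius\<bar> < e" by blast
    qed
  next
    case 2
    let ?V = "{y \<in> I0. (f0 ^^ m) y \<in> {3<..}}"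
    show ?thesis
    proof (rule Fatou_of_contracting[of ?V _ radius])
      show "openin (top_of_set I0) ?V" by (rule open_preimage) simp
      show "x \<in> ?V" using assms(1) 2 by simp
      fix e :: real assume "e > 0"
      then obtain n0 where n0: "\<And>n. n \<ge> n0 \<Longrightarrow> \<bar>(f0 ^^ n) 3 - radius\<bar> < e"
        using LIMSEQ_D[OF right_attraction] by auto
      have "\<bar>(f0 ^^ n) y - radius\<bar> < e" if "n \<ge> n0 + m" "y \<in> ?V" for n y
      proof -
        have n: "n = (n - m) + m" using that by simp
        have "(f0 ^^ m) y \<in> I0" using that funpow_bounds by blast
        then have "(f0 ^^ (n - m)) ((f0 ^^ m) y) \<le> radius \<and>
            (f0 ^^ (n - m)) 3 \<le> (f0 ^^ (n - m)) ((f0 ^^ m) y)"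
          using funpow_mono_right[of "(f0 ^^ m) y" "n - m"] that by simp
        then have "(f0 ^^ n) y \<le> radius" "(f0 ^^ (n - m)) 3 \<le> (f0 ^^ n) y"
          using n funpow_plus[of "n - m" m y] by auto
        then show ?thesis using n0[of "n - m"] that(1) by linarith
      qed
      then show "\<exists>n0. \<forall>n\<ge>n0. \<forall>y\<in>?V. \<bar>(f0 ^^ n) y - radius\<bar> < e" by blast
    qed
  qed
qed

lemma Fatou_eq: "Fatou I0 f0 = I0 - survivors"
proof
  show "Fatou I0 f0 \<subseteq> I0 - survivors"
    using survivors_disjoint_Fatou openin_imp_subset[OF Fatou_greatest(1), of I0 f0] by blast
  show "I0 - survivors \<subseteq> Fatou I0 f0"
    using escaping_Fatou by blast
qed

lemma Julia_eq: "Julia I0 f0 = survivors"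
proof -
  have "survivors \<subseteq> I0" using survivors_interval radius_ge by auto
  then show ?thesis unfolding Julia_def Fatou_eq by blast
qed

lemma zero_survivor: "0 \<in> survivors"
  by (simp add: survivors_def funpow_zero)

lemma f0_exact: "topologically_exact_on_Julia I0 f0"
proof -
  have "crit_value2 \<noteq> 0" using crit_value2_orbit_bounds(1)[of 0] by simp
  with zero_survivor crit_value2_survivor have "\<exists>x\<in>survivors. \<exists>y\<in>survivors. x \<noteq> y" by metis
  moreover have "\<exists>n\<ge>1. survivors \<subseteq> (f0 ^^ n) ` U"
    if "openin (top_of_set I0) U" "U \<inter> survivors \<noteq> {}" for U
    using openin_survivor_exact[OF that] survivors_interval by (meson subset_trans)
  ultimately show ?thesis unfolding topologically_exact_on_Julia_def Julia_eq by blast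
qed

section \<open>The fixed point on the boundary of a Fatou component\<close>

lemma zero_in_frontier:
  "\<exists>C\<in>components (Fatou I0 f0). 0 \<in> (top_of_set I0) frontier_of C"
proof -
  let ?F = "Fatou I0 f0"
  define C where "C = connected_component_set ?F (-1)"
  have sub: "{- radius..<0} \<subseteq> ?F"
  proof
    fix x assume x: "x \<in> {- radius..<0}"
    then have "x \<notin> survivors" using survivors_bounds[of x] by auto
    then show "x \<in> ?F" unfolding Fatou_eq using x radius_ge by simp
  qed
  have m1: "-1 \<in> {- radius..<0}" using radius_ge by simp
  then have "C \<in> components ?F" unfolding C_def components_def using sub by blast
  moreover have "{- radius..<0} \<subseteq> C"
    unfolding C_def by (rule connected_component_maximal[OF m1 _ sub]) simp
  moreover have "0 \<notin> C"
    using zero_survivor connected_component_subset[of ?F "-1"] unfolding C_def Fatou_eq by blast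
  moreover have "0 \<in> (top_of_set I0) frontier_of C"
    unfolding frontier_of_def
  proof
    show "0 \<in> (top_of_set I0) closure_of C"
      unfolding in_closure_of
    proof (intro conjI allI impI)
      show "0 \<in> topspace (top_of_set I0)" using radius_ge by simp
      fix T assume T: "0 \<in> T \<and> openin (top_of_set I0) T"
      then obtain e where e: "e > 0" "ball 0 e \<subseteq> T" using openin_survivor_ball[OF _ _ zero_survivor] by blast
      have "- min (e / 2) 1 \<in> T" using e by (auto simp: subset_eq dist_real_def)
      moreover have "- min (e / 2) 1 \<in> {- radius..<0}" using e radius_ge by auto
      ultimately show "\<exists>y. y \<in> C \<and> y \<in> T" using \<open>{- radius..<0} \<subseteq> C\<close> by blast
    qed
    show "0 \<notin> (top_of_set I0) interior_of C"
      using \<open>0 \<notin> C\<close> interior_of_subset[of "top_of_set I0" C] by blast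
  qed
  ultimately show ?thesis by blast
qed

section \<open>Lyapunov exponents\<close>

text \<open>The maximum of 0 and the first \<open>n\<close> ergodic sums; the recursion is the heart of Garsia's proof
  of the maximal ergodic inequality.\<close>

primrec max_partial_sum :: "('a \<Rightarrow> 'a) \<Rightarrow> ('a \<Rightarrow> real) \<Rightarrow> nat \<Rightarrow> 'a \<Rightarrow> real" where
  "max_partial_sum T h 0 = (\<lambda>_. 0)"
| "max_partial_sum T h (Suc n) = (\<lambda>x. max 0 (h x + max_partial_sum T h n (T x)))"

lemma max_partial_sum_nonneg: "0 \<le> max_partial_sum T h n x"
  by (cases n) auto

lemma max_partial_sum_Suc_le: "max_partial_sum T h n x \<le> max_partial_sum T h (Suc n) x"
proof (induction n arbitrary: x)
  case (Suc n)
  show ?case using Suc[of "T x"] by auto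
qed simp

lemma max_partial_sum_mono: "m \<le> n \<Longrightarrow> max_partial_sum T h m x \<le> max_partial_sum T h n x"
  using lift_Suc_mono_le[of "\<lambda>n. max_partial_sum T h n x"] max_partial_sum_Suc_le by metis

lemma sum_le_max_partial_sum: "(\<Sum>j<n. h ((T ^^ j) x)) \<le> max_partial_sum T h n x"
proof (induction n arbitrary: x)
  case (Suc n)
  have "(\<Sum>j<Suc n. h ((T ^^ j) x)) = h x + (\<Sum>j<n. h ((T ^^ j) (T x)))"
    by (simp add: sum.lessThan_Suc_shift funpow_swap1 del: sum.lessThan_Suc)
  then show ?case using Suc[of "T x"] by simp
qed simp

lemma max_partial_sum_bound:
  assumes "\<And>x. \<bar>h x\<bar> \<le> B"
  shows "max_partial_sum T h n x \<le> real n * B"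
proof (induction n arbitrary: x)
  case (Suc n)
  have "0 \<le> B" using assms[of x] by linarith
  then have "0 \<le> real n * B" by simp
  then show ?case using Suc[of "T x"] assms[of x] by (auto simp: algebra_simps abs_le_iff)
qed simp

text \<open>Where \<open>?m (Suc n)\<close> is positive, \<open>?m n x - ?m n (T x)\<close> is at
  most h x; elsewhere it is at most 0. By invariance the integral of this difference is 0, and by
  \<open>pos\<close> the sets of positivity increase to the whole space.\<close>

lemma maximal_ergodic:
  fixes h :: "'a \<Rightarrow> real"
  assumes "prob_space M" and T: "T \<in> M \<rightarrow>\<^sub>M M" and inv: "distr M M T = M"
    and h: "h \<in> borel_measurable M" and bound: "\<And>x. \<bar>h x\<bar> \<le> B"
    and pos: "\<And>x. x \<in> space M \<Longrightarrow> \<exists>n. 0 < (\<Sum>j<n. h ((T ^^ j) x))"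
  shows "0 \<le> (\<integral>x. h x \<partial>M)"
proof -
  interpret prob_space M by fact
  let ?m = "max_partial_sum T h"
  have m_meas: "?m n \<in> borel_measurable M" for n
  proof (induction n)
    case (Suc n)
    have "(\<lambda>x. ?m n (T x)) \<in> borel_measurable M" using measurable_compose[OF T Suc] .
    then show ?case using h by simp
  qed simp
  have m_bound: "\<bar>?m n x\<bar> \<le> real n * B" for n x
    using max_partial_sum_bound[of h B T n x] bound max_partial_sum_nonneg[of T h n x] by simp
  have m_int: "integrable M (?m n)" for n
    by (rule integrable_const_bound[of _ "real n * B"]) (use m_meas m_bound in auto)
  have mT_int: "integrable M (\<lambda>x. ?m n (T x))" for n
    by (rule integrable_const_bound[of _ "real n * B"])
       (use measurable_compose[OF T m_meas] m_bound in auto)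
  have m_inv: "(\<integral>x. ?m n (T x) \<partial>M) = (\<integral>x. ?m n x \<partial>M)" for n
    using integral_distr[OF T m_meas[of n]] inv by simp
  define a where "a n x = (if 0 < ?m (Suc n) x then h x else 0)" for n x
  have a_meas: "a n \<in> borel_measurable M" for n
    unfolding a_def using m_meas[of "Suc n"] h by (intro measurable_If_set measurable_If) (auto simp del: max_partial_sum.simps)
  have a_int: "integrable M (a n)" for n
    by (rule integrable_const_bound[of _ B]) (use a_meas bound in \<open>auto simp: a_def intro: order_trans[OF abs_ge_zero]\<close>)
  have "0 \<le> (\<integral>x. a n x \<partial>M)" for n
  proof -
    have "0 = (\<integral>x. ?m n x - ?m n (T x) \<partial>M)"
      using m_int mT_int m_inv by simp
    also have "\<dots> \<le> (\<integral>x. a n x \<partial>M)"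
    proof (rule integral_mono)
      show "?m n x - ?m n (T x) \<le> a n x" for x
        using max_partial_sum_Suc_le[of T h n x] max_partial_sum_nonneg[of T h n "T x"]
          max_partial_sum_nonneg[of T h n x]
        by (auto simp: a_def)
    qed (use m_int mT_int a_int in auto)
    finally show ?thesis .
  qed
  moreover have "(\<lambda>n. \<integral>x. a n x \<partial>M) \<longlonglongrightarrow> (\<integral>x. h x \<partial>M)"
  proof (rule integral_dominated_convergence[where w = "\<lambda>_. B"])
    show "AE x in M. (\<lambda>n. a n x) \<longlonglongrightarrow> h x"
    proof (rule AE_I2)
      fix x assume "x \<in> space M"
      then obtain n where "0 < ?m n x" using pos sum_le_max_partial_sum less_le_trans by metis
      then have "0 < ?m (Suc k) x" if "k \<ge> n" for k
        using max_partial_sum_mono[of n "Suc k" T h x] that by linarith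
      then have "\<forall>\<^sub>F k in sequentially. a k x = h x"
        unfolding eventually_sequentially a_def by (intro exI[of _ n]) auto
      then show "(\<lambda>n. a n x) \<longlonglongrightarrow> h x" by (rule tendsto_eventually)
    qed
    show "AE x in M. norm (a n x) \<le> B" for n
      using bound by (auto simp: a_def intro: order_trans[OF abs_ge_zero])
  qed (use a_meas h in auto)
  ultimately show ?thesis by (meson LIMSEQ_le_const)
qed

section \<open>Truncated exponents along orbits\<close>

text \<open>The truncation at \<open>- K\<close> makes the function bounded below; critical points
  need a clause of their own because \<open>ln 0\<close> is an ordinary real number.\<close>

definition log_deriv :: "real \<Rightarrow> real \<Rightarrow> real" where
  "log_deriv K x = (if deriv f0 x = 0 then - K else max (- K) (ln \<bar>deriv f0 x\<bar>))"

lemma sum_log_deriv_ge: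
  assumes "0 < expansion t x"
  shows "ln (expansion t x) \<le> (\<Sum>j<t. log_deriv K ((f0 ^^ j) x))"
proof -
  have ne: "deriv f0 ((f0 ^^ j) x) \<noteq> 0" if "j < t" for j
  proof
    assume "deriv f0 ((f0 ^^ j) x) = 0"
    then have "expansion t x = 0"
      unfolding expansion_def using that by (intro prod_zero) auto
    then show False using assms by simp
  qed
  have "ln (expansion t x) = (\<Sum>j<t. ln \<bar>deriv f0 ((f0 ^^ j) x)\<bar>)"
    unfolding expansion_def by (rule ln_prod) (use ne in auto)
  also have "\<dots> \<le> (\<Sum>j<t. log_deriv K ((f0 ^^ j) x))"
    using ne by (intro sum_mono) (auto simp: log_deriv_def)
  finally show ?thesis .
qed

lemma log_power_2_le: "2 ^ n \<le> x \<Longrightarrow> real n * ln 2 \<le> ln x" for x :: real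
  using ln_mono[of "2 ^ n" x] by (simp add: ln_realpow)

abbreviation exponent_bound :: real where "exponent_bound \<equiv> 11 / 2 * ln 2"

text \<open>For the critical points 1 and 2: the first term is at least \<open>- K\<close>, and a
  sufficiently long orbit piece of the critical value, growing at rate 18 against 11/2, makes up for
  it.\<close>

lemma crit_point_sum_pos:
  assumes "0 \<le> K" "\<And>m. \<exists>t\<ge>m. 2 ^ (18 * t) \<le> expansion t (f0 x)"
  shows "\<exists>n. 0 < (\<Sum>j<n. log_deriv K ((f0 ^^ j) x) - exponent_bound)"
proof -
  have l2: "0 < ln (2::real)" by simp
  obtain m :: nat where m: "K + exponent_bound < real m * ln 2"
    using reals_Archimedean3[OF l2] by blast
  obtain t where t: "t \<ge> m" "2 ^ (18 * t) \<le> expansion t (f0 x)" using assms(2) by blast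
  have pos: "0 < expansion t (f0 x)"
    using t(2) zero_less_power[of "2::real" "18 * t"] by linarith
  have "real (18 * t) * ln 2 \<le> (\<Sum>j<t. log_deriv K ((f0 ^^ j) (f0 x)))"
    using log_power_2_le[OF t(2)] sum_log_deriv_ge[OF pos, of K] by linarith
  moreover have "- K \<le> log_deriv K x" by (simp add: log_deriv_def)
  moreover have eq: "(\<Sum>j<Suc t. log_deriv K ((f0 ^^ j) x) - exponent_bound)
      = log_deriv K x + (\<Sum>j<t. log_deriv K ((f0 ^^ j) (f0 x))) - real (Suc t) * exponent_bound"
    by (simp add: sum_subtractf sum.lessThan_Suc_shift funpow_swap1 algebra_simps del: sum.lessThan_Suc)
  moreover have "real m * ln 2 \<le> real t * ln 2" using t(1) by (intro mult_right_mono) auto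
  moreover have "0 \<le> real t * ln 2" by simp
  moreover have "real (18 * t) * ln 2 = 18 * (real t * ln 2)"
    "real (Suc t) * exponent_bound = 11 / 2 * (real t * ln 2) + exponent_bound"
    by (simp_all add: algebra_simps)
  ultimately have "0 < (\<Sum>j<Suc t. log_deriv K ((f0 ^^ j) x) - exponent_bound)"
    unfolding eq using m by linarith
  then show ?thesis by blast
qed

lemma survivor_sum_pos:
  assumes "x \<in> survivors" "0 \<le> K"
  shows "\<exists>n. 0 < (\<Sum>j<n. log_deriv K ((f0 ^^ j) x) - exponent_bound)"
proof -
  consider "x = 1" | "x = 2" | "x \<noteq> 1" "x \<noteq> 2" by blast
  then show ?thesis
  proof cases
    case 1
    have "\<exists>t\<ge>m. 2 ^ (18 * t) \<le> expansion t crit_value1" for m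
      by (intro exI[of _ m] conjI order_trans[OF _ expansion_crit_value1] power_increasing) auto
    then show ?thesis by (intro crit_point_sum_pos[OF assms(2)]) (simp add: 1 f0_crit_points)
  next
    case 2
    have "\<exists>t\<ge>m. 2 ^ (18 * t) \<le> expansion t crit_value2" for m
      by (intro exI[of _ "visit m"] conjI expansion_crit_value2 seq_suble[OF strict_mono_visit])
    then show ?thesis by (intro crit_point_sum_pos[OF assms(2)]) (simp add: 2 f0_crit_points)
  next
    case 3
    from uniform_expansion[OF assms(1) 3] assms(1)
    obtain t where t: "t \<ge> 1" "2 ^ (6 * t) \<le> expansion t x" by blast
    have pos: "0 < expansion t x"
      using t(2) zero_less_power[of "2::real" "6 * t"] by linarith
    have "real (6 * t) * ln 2 \<le> (\<Sum>j<t. log_deriv K ((f0 ^^ j) x))"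
      using log_power_2_le[OF t(2)] sum_log_deriv_ge[OF pos, of K] by linarith
    moreover have "0 < real t * ln 2" using t(1) by simp
    ultimately have "0 < (\<Sum>j<t. log_deriv K ((f0 ^^ j) x) - exponent_bound)"
      by (simp add: sum_subtractf algebra_simps)
    then show ?thesis by blast
  qed
qed

lemma continuous_on_deriv: "continuous_on S (deriv f0)"
  using smooth_funs_deriv(2)[OF smooth_funs_deriv(1)[OF f0_smooth]]
  by (meson DERIV_isCont continuous_at_imp_continuous_on)

lemma deriv_bound: "\<exists>C\<ge>1. \<forall>x\<in>I0. \<bar>deriv f0 x\<bar> \<le> C"
proof -
  have "compact (deriv f0 ` I0)"
    by (rule compact_continuous_image[OF continuous_on_deriv]) simp
  then obtain C where "\<forall>y\<in>deriv f0 ` I0. norm y \<le> C"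
    using compact_imp_bounded bounded_iff by blast
  then show ?thesis by (intro exI[of _ "max 1 C"]) auto
qed

lemma SUP_min_of_nat:
  fixes r :: real
  shows "(SUP K. ennreal (min (real K) r)) = ennreal r"
proof (rule antisym)
  show "(SUP K. ennreal (min (real K) r)) \<le> ennreal r" by (intro SUP_least ennreal_leI) simp
  obtain K where "r \<le> real K" using real_arch_simple by blast
  then show "ennreal r \<le> (SUP K. ennreal (min (real K) r))"
    by (intro SUP_upper2[of K]) (auto simp: min_def)
qed

text \<open>The maximal inequality, applied for each truncation K, bounds the integrals of the
  truncated negative parts uniformly in K; monotone convergence then removes the truncation.
  Integrability of the logarithm is a consequence, not an assumption.\<close>

lemma exponent_ge:
  assumes "\<mu> \<in> invariant_measures I0 f0"
  shows "ereal exponent_bound \<le> eintegral \<mu> (\<lambda>x. eln \<bar>deriv_within I0 f0 x\<bar>)"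
proof -
  have sets: "sets \<mu> = sets (restrict_space borel survivors)" and "prob_space \<mu>"
    and T: "f0 \<in> \<mu> \<rightarrow>\<^sub>M \<mu>" and inv: "distr \<mu> \<mu> f0 = \<mu>"
    using assms by (auto simp: invariant_measures_def Julia_eq)
  interpret prob_space \<mu> by fact
  have space: "space \<mu> = survivors" using sets_eq_imp_space_eq[OF sets] by (simp add: space_restrict_space)
  have meas: "g \<in> borel_measurable \<mu>" if "g \<in> borel_measurable borel" for g :: "real \<Rightarrow> real"
    using measurable_restrict_space1[OF that, of survivors] measurable_cong_sets[OF sets refl] by blast
  have D[measurable]: "deriv f0 \<in> borel_measurable borel"
    by (rule borel_measurable_continuous_onI[OF continuous_on_deriv])
  have deriv: "deriv_within I0 f0 x = deriv f0 x" if "x \<in> survivors" for x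
    using nderiv_within_eq[OF f0_smooth, of "- radius" radius x 1] survivors_bounds[OF that] radius_ge
    by simp
  obtain C where C: "C \<ge> 1" "\<And>x. x \<in> I0 \<Longrightarrow> \<bar>deriv f0 x\<bar> \<le> C"
    using deriv_bound by blast
  define d where "d x = \<bar>deriv f0 x\<bar>" for x
  \<comment> \<open>The positive part is cut off outside {0..3}, since
    \<open>maximal_ergodic\<close> asks for a bound at every real number.\<close>
  define u where "u x = (if x \<in> {0..3} \<and> d x \<noteq> 0 then max 0 (ln (d x)) else 0)" for x
  define w where "w K x = (if d x = 0 then real K else min (real K) (max 0 (- ln (d x))))" for K x
  have d_meas[measurable]: "d \<in> borel_measurable borel" unfolding d_def by measurable
  have u_meas: "u \<in> borel_measurable borel" unfolding u_def by measurable
  have w_meas: "w K \<in> borel_measurable borel" for K unfolding w_def by measurable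
  have u_bound: "0 \<le> u x" "u x \<le> ln C" for x
  proof -
    show "0 \<le> u x" by (simp add: u_def)
    show "u x \<le> ln C"
    proof (cases "x \<in> {0..3} \<and> d x \<noteq> 0")
      case True
      then have "0 < d x" "d x \<le> C" using C(2)[of x] radius_ge by (auto simp: d_def)
      then have "ln (d x) \<le> ln C" by (intro ln_mono) auto
      then show ?thesis using C(1) True by (simp add: u_def)
    next
      case False
      then show ?thesis using C(1) by (auto simp: u_def)
    qed
  qed
  have w_bound: "0 \<le> w K x" "w K x \<le> real K" for K x by (auto simp: w_def)
  have u_int: "integrable \<mu> u"
    by (rule integrable_const_bound[of _ "ln C"]) (use meas[OF u_meas] u_bound in auto)
  have w_int: "integrable \<mu> (w K)" for K
    by (rule integrable_const_bound[of _ "real K"]) (use meas[OF w_meas] w_bound in auto)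
  have main: "(\<integral>x. w K x \<partial>\<mu>) \<le> (\<integral>x. u x \<partial>\<mu>) - exponent_bound" for K
  proof -
    have *: "log_deriv (real K) x = u x - w K x" if "x \<in> survivors" for x
    proof -
      have "max (- real K) l = max 0 l - min (real K) (max 0 (- l))" for l by (auto simp: max_def min_def)
      from this[of "ln (d x)"] show ?thesis
        using survivors_bounds[OF that] by (auto simp: log_deriv_def u_def w_def d_def)
    qed
    have "0 \<le> (\<integral>x. u x - w K x - exponent_bound \<partial>\<mu>)"
    proof (rule maximal_ergodic[OF \<open>prob_space \<mu>\<close> T inv])
      show "(\<lambda>x. u x - w K x - exponent_bound) \<in> borel_measurable \<mu>"
        using meas[OF u_meas] meas[OF w_meas[of K]] by simp
      show "\<bar>u x - w K x - exponent_bound\<bar> \<le> ln C + real K + exponent_bound" for x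
        using u_bound[of x] w_bound[of K x] ln_gt_zero[of "2::real"] unfolding abs_le_iff by linarith
      fix x assume "x \<in> space \<mu>"
      then have x: "x \<in> survivors" using space by simp
      have "log_deriv (real K) ((f0 ^^ j) x) = u ((f0 ^^ j) x) - w K ((f0 ^^ j) x)" for j
        by (rule *[OF survivors_funpow[OF x]])
      then show "\<exists>n. 0 < (\<Sum>j<n. u ((f0 ^^ j) x) - w K ((f0 ^^ j) x) - exponent_bound)"
        using survivor_sum_pos[OF x, of "real K"] by simp
    qed
    also have "\<dots> = (\<integral>x. u x \<partial>\<mu>) - (\<integral>x. w K x \<partial>\<mu>) - exponent_bound"
      using u_int w_int[of K] by (simp add: prob_space)
    finally show ?thesis by simp
  qed
  let ?g = "\<lambda>x. eln \<bar>deriv_within I0 f0 x\<bar>"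
  define P where "P = (\<integral>x. u x \<partial>\<mu>)"
  have "(\<integral>\<^sup>+x. e2ennreal (?g x) \<partial>\<mu>) = (\<integral>\<^sup>+x. ennreal (u x) \<partial>\<mu>)"
  proof (rule nn_integral_cong)
    fix x assume "x \<in> space \<mu>"
    then have x: "x \<in> survivors" using space by simp
    show "e2ennreal (?g x) = ennreal (u x)"
      using survivors_bounds[OF x] unfolding deriv[OF x] d_def[symmetric]
      by (auto simp: eln_def u_def d_def max_def ennreal_neg e2ennreal_neg)
  qed
  also have "\<dots> = ennreal P" unfolding P_def by (rule nn_integral_eq_integral[OF u_int]) (use u_bound in auto)
  finally have pos_part: "(\<integral>\<^sup>+x. e2ennreal (?g x) \<partial>\<mu>) = ennreal P" .
  \<comment> \<open>This makes \<open>P - exponent_bound\<close> nonnegative, so that passing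
    through \<open>ennreal\<close> does not truncate it.\<close>
  have P: "exponent_bound \<le> P"
  proof -
    have "0 \<le> (\<integral>x. w 0 x \<partial>\<mu>)" by (rule Bochner_Integration.integral_nonneg) (rule w_bound)
    then show ?thesis using main[of 0] unfolding P_def by linarith
  qed
  have "(\<integral>\<^sup>+x. e2ennreal (- ?g x) \<partial>\<mu>) = (\<integral>\<^sup>+x. (SUP K. ennreal (w K x)) \<partial>\<mu>)"
  proof (rule nn_integral_cong)
    fix x assume "x \<in> space \<mu>"
    then have x: "x \<in> survivors" using space by simp
    show "e2ennreal (- ?g x) = (SUP K. ennreal (w K x))"
    proof (cases "d x = 0")
      case True
      have "(SUP K. ennreal (w K x)) = (SUP K. of_nat K)"
        using True by (simp add: w_def ennreal_of_nat_eq_real_of_nat)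
      also have "\<dots> = top" by (rule ennreal_SUP_of_nat_eq_top)
      finally have "(SUP K. ennreal (w K x)) = top" .
      moreover have "e2ennreal (- ?g x) = top"
        using True unfolding deriv[OF x] d_def[symmetric] by (simp add: eln_def)
      ultimately show ?thesis by (rule trans[OF _ sym, rotated])
    next
      case False
      then have "0 < d x" by (simp add: d_def)
      then have "e2ennreal (- ?g x) = ennreal (max 0 (- ln (d x)))"
        unfolding deriv[OF x] d_def[symmetric] by (auto simp: eln_def max_def ennreal_neg)
      also have "\<dots> = (SUP K. ennreal (w K x))"
        using False SUP_min_of_nat by (simp add: w_def)
      finally show ?thesis .
    qed
  qed
  also have "\<dots> = (SUP K. \<integral>\<^sup>+x. ennreal (w K x) \<partial>\<mu>)"
  proof (rule nn_integral_monotone_convergence_SUP)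
    show "incseq (\<lambda>K x. ennreal (w K x))"
      by (intro incseq_SucI le_funI ennreal_leI) (auto simp: w_def)
    show "(\<lambda>x. ennreal (w K x)) \<in> borel_measurable \<mu>" for K using meas[OF w_meas[of K]] by simp
  qed
  also have "\<dots> \<le> ennreal (P - exponent_bound)"
  proof (rule SUP_least)
    fix K
    have "(\<integral>\<^sup>+x. ennreal (w K x) \<partial>\<mu>) = ennreal (\<integral>x. w K x \<partial>\<mu>)"
      by (rule nn_integral_eq_integral[OF w_int]) (use w_bound in auto)
    also have "\<dots> \<le> ennreal (P - exponent_bound)" using main[of K] by (intro ennreal_leI) (simp add: P_def)
    finally show "(\<integral>\<^sup>+x. ennreal (w K x) \<partial>\<mu>) \<le> ennreal (P - exponent_bound)" .
  qed
  finally have neg_part: "enn2ereal (\<integral>\<^sup>+x. e2ennreal (- ?g x) \<partial>\<mu>) \<le> ereal (P - exponent_bound)"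
    using P by (metis diff_ge_0_iff_ge enn2ereal_ennreal less_eq_ennreal.rep_eq)
  have "0 \<le> P" using P ln_gt_zero[of "2::real"] by linarith
  then have "eintegral \<mu> ?g = ereal P - enn2ereal (\<integral>\<^sup>+x. e2ennreal (- ?g x) \<partial>\<mu>)"
    unfolding eintegral_def pos_part by (simp add: enn2ereal_ennreal)
  also have "\<dots> \<ge> ereal P - ereal (P - exponent_bound)"
    by (rule ereal_minus_mono[OF order_refl neg_part])
  finally show ?thesis by simp
qed

lemma chi_inf_ge: "ereal exponent_bound \<le> chi_inf I0 f0"
  unfolding chi_inf_def by (rule INF_greatest) (rule exponent_ge)

section \<open>Long pullbacks\<close>

lemma powr_2_mult: "a + b = c \<Longrightarrow> 2 powr a * 2 powr b = (2::real) powr c"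
  by (simp flip: powr_add)

lemma powr_2_le_power: "e \<le> real m \<Longrightarrow> 2 powr e \<le> (2::real) ^ m"
  using powr_mono[of e "real m" 2] powr_realpow[of 2 m] by simp

text \<open>A crude constant from compactness is enough, as it is applied only over times that are
  short compared with \<open>half_run i\<close>.\<close>

lemma f0_lipschitz:
  "\<exists>b::nat. \<forall>n. \<forall>x\<in>I0. \<forall>y\<in>I0.
     \<bar>(f0 ^^ n) x - (f0 ^^ n) y\<bar> \<le> 2 powr (real b * real n) * \<bar>x - y\<bar>"
proof -
  have "compact (deriv f0 ` I0)"
    using smooth_funs_deriv(2)[OF smooth_funs_deriv(1)[OF f0_smooth]]
    by (intro compact_continuous_image) (auto intro: DERIV_isCont continuous_at_imp_continuous_on)
  then obtain C where C: "\<And>x. x \<in> I0 \<Longrightarrow> \<bar>deriv f0 x\<bar> \<le> C"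
    using compact_imp_bounded bounded_iff by (metis imageI real_norm_def)
  obtain b where b: "C < 2 ^ b" using real_arch_pow[of 2 C] by auto
  have lip: "\<bar>f0 x - f0 y\<bar> \<le> 2 ^ b * \<bar>x - y\<bar>" if "x \<in> I0" "y \<in> I0" for x y
  proof -
    have "norm (f0 x - f0 y) \<le> 2 ^ b * norm (x - y)"
    proof (rule field_differentiable_bound[of I0 f0 "deriv f0"])
      show "(f0 has_field_derivative deriv f0 z) (at z within I0)" for z
        by (rule has_field_derivative_at_within[OF f0_has_deriv])
      show "norm (deriv f0 z) \<le> 2 ^ b" if "z \<in> I0" for z
        using C[OF that] b by simp
    qed (use that in auto)
    then show ?thesis by simp
  qed
  have "\<bar>(f0 ^^ n) x - (f0 ^^ n) y\<bar> \<le> 2 powr (real b * real n) * \<bar>x - y\<bar>"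
    if "x \<in> I0" "y \<in> I0" for n x y
  proof (induction n)
    case (Suc n)
    have "\<bar>(f0 ^^ Suc n) x - (f0 ^^ Suc n) y\<bar> \<le> 2 ^ b * \<bar>(f0 ^^ n) x - (f0 ^^ n) y\<bar>"
      using lip[OF funpow_bounds[OF that(1)] funpow_bounds[OF that(2)]] by simp
    also have "\<dots> \<le> 2 ^ b * (2 powr (real b * real n) * \<bar>x - y\<bar>)" using Suc by (intro mult_left_mono) auto
    also have "\<dots> = 2 powr (real b * real (Suc n)) * \<bar>x - y\<bar>"
      by (simp add: powr_add powr_realpow distrib_left)
    finally show ?case .
  qed simp
  then show ?thesis by blast
qed

text \<open>Within distance 1/100 of 0 a step expands by at most 2 ^ 25, so 26 k - 25 k = k is left
  in the exponent, and the orbit stays that close for all k steps.\<close>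

lemma run_near_0:
  assumes "\<bar>u\<bar> \<le> 2 powr (- 26 * real k)" "1 \<le> k"
  shows "\<bar>(f0 ^^ k) u\<bar> \<le> 2 powr (- real k)"
proof -
  have "\<bar>(f0 ^^ j) u\<bar> \<le> 2 powr (25 * real j - 26 * real k)" if "j \<le> k" for j
    using that
  proof (induction j)
    case 0
    then show ?case using assms(1) by simp
  next
    case (Suc j)
    let ?y = "(f0 ^^ j) u"
    have IH: "\<bar>?y\<bar> \<le> 2 powr (25 * real j - 26 * real k)" using Suc by simp
    also have "\<dots> \<le> 2 powr (- 25)"
      by (intro powr_mono) (use Suc.prems in auto)
    also have "\<dots> \<le> 1/100" by (simp add: powr_minus powr_numeral)
    finally have small: "\<bar>?y\<bar> \<le> 1/100" .
    then have y: "-1/100 \<le> ?y" "?y \<le> 1/100" by auto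
    then have "f0 ?y = hump ?y" by (intro f0_eqs) auto
    moreover have "\<bar>1 - 4 * ?y\<bar> * \<bar>1 - ?y\<bar> \<le> 4/3 * (3/2)" using y by (intro mult_mono) auto
    then have "2 ^ 24 * \<bar>?y\<bar> * (\<bar>1 - 4 * ?y\<bar> * \<bar>1 - ?y\<bar>) \<le> 2 ^ 24 * \<bar>?y\<bar> * 2"
      by (intro mult_left_mono) auto
    ultimately have "\<bar>f0 ?y\<bar> \<le> 2 ^ 24 * \<bar>?y\<bar> * 2"
      by (simp add: hump_def abs_mult slope_def mult.assoc)
    also have "\<dots> \<le> 2 ^ 24 * 2 powr (25 * real j - 26 * real k) * 2" using IH by simp
    also have "\<dots> = 2 powr 25 * 2 powr (25 * real j - 26 * real k)" by (simp add: powr_numeral)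
    also have "\<dots> = 2 powr (25 * real (Suc j) - 26 * real k)" by (rule powr_2_mult) simp
    finally show ?case by simp
  qed
  from this[of k] show ?thesis by simp
qed

lemma cube_add_le:
  fixes a b :: real
  assumes "0 \<le> a" "0 \<le> b"
  shows "(a + b) ^ 3 \<le> 8 * (a ^ 3 + b ^ 3)"
proof -
  have "(a + b) ^ 3 \<le> (2 * max a b) ^ 3" using assms by (intro power_mono) auto
  also have "\<dots> = 8 * max a b ^ 3" by (simp add: power_mult_distrib)
  also have "\<dots> \<le> 8 * (a ^ 3 + b ^ 3)" using assms by (auto simp: max_def)
  finally show ?thesis .
qed

lemma powr_cube: "(2 powr a) ^ 3 = 2 powr (3 * a)" for a :: real
  by (simp add: powr_power mult.commute)

text \<open>The fold and the inflection point flatten the map, whence the small exponent 5 although each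
  of the last \<open>half_run i\<close> steps expands by about \<open>2 ^ 24\<close>.\<close>

lemma pullback_ball:
  assumes lip: "\<And>n x y. x \<in> I0 \<Longrightarrow> y \<in> I0 \<Longrightarrow>
      \<bar>(f0 ^^ n) x - (f0 ^^ n) y\<bar> \<le> 2 powr (real b * real n) * \<bar>x - y\<bar>"
    and i: "100 + 3 * b \<le> i"
    and x: "\<bar>x - 2\<bar> \<le> 2 powr (- 5 * real (half_run i))"
  shows "\<bar>(f0 ^^ (half_run i + (run_start i + Suc (visit i + 1)))) x\<bar> \<le> 2 powr (- real (half_run i))"
proof -
  define k where "k = half_run i"
  define n where "n = run_start i"
  define T where "T = visit i"
  have "Suc i * (T + n + 1) = k" by (simp add: k_def n_def T_def half_run_def)
  moreover have "(100 + 3 * b) * (T + n + 1) \<le> Suc i * (T + n + 1)" using i by (intro mult_right_mono) auto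
  \<comment> \<open>This uses the factor \<open>Suc i\<close> in \<open>half_run\<close>. The time
    \<open>T\<close> is counted three times because its Lipschitz factor gets cubed at the
    inflection point.\<close>
  ultimately have "100 + 3 * b * T + b * n \<le> k" by (simp add: algebra_simps)
  then have "real (100 + 3 * b * T + b * n) \<le> real k" by (rule of_nat_mono)
  then have kb: "100 + 3 * (real b * real T) + real b * real n \<le> real k" by (simp add: algebra_simps)
  have bT: "0 \<le> real b * real T" "0 \<le> real b * real n" by auto
  have k100: "100 \<le> real k" using kb bT by linarith
  have in_int: "y \<in> I0" if "y \<in> {0..3}" for y using that radius_ge by auto
  have surv_int: "y \<in> I0" if "y \<in> survivors" for y using that survivors_interval in_int by blast
  have x_int: "\<bar>x - 2\<bar> \<le> 1/2"
  proof -
    have "2 powr (- 5 * real k) \<le> 2 powr (-1)" by (rule powr_mono) (use k100 in auto)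
    then show ?thesis using x unfolding k_def[symmetric] by (simp add: powr_minus)
  qed
  define y0 where "y0 = f0 x"
  \<comment> \<open>The fold squares the distance, whence 10 = 2 * 5; the 25 comes from
    \<open>slope\<close> and from x - 1 being at most 2.\<close>
  have "\<bar>y0 - crit_value2\<bar> \<le> 2 powr (25 - 10 * real k)"
  proof -
    have x': "3/2 \<le> x" "x \<le> 5/2" using x_int unfolding abs_le_iff by auto
    have eq: "y0 - crit_value2 = slope * ((x - 2)\<^sup>2 * (x - 1))"
      using x' by (simp add: y0_def f0_eqs valley_def)
    have "\<bar>x - 2\<bar>\<^sup>2 \<le> (2 powr (- 5 * real k))\<^sup>2" using x unfolding k_def by (intro power_mono) auto
    also have "(2 powr (- 5 * real k))\<^sup>2 = 2 powr (- 10 * real k)" by (simp add: powr_power)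
    finally have "(x - 2)\<^sup>2 * (x - 1) \<le> 2 powr (- 10 * real k) * 2"
      using x' by (intro mult_mono) auto
    then have "slope * ((x - 2)\<^sup>2 * (x - 1)) \<le> slope * (2 powr (- 10 * real k) * 2)"
      using slope_pos by (intro mult_left_mono) auto
    also have "\<dots> = 2 powr 25 * 2 powr (- 10 * real k)" by (simp add: slope_def powr_numeral)
    also have "\<dots> = 2 powr (25 - 10 * real k)" by (rule powr_2_mult) simp
    finally show ?thesis using x' slope_pos unfolding eq by (simp add: abs_mult)
  qed
  have x_the_int: "x \<in> I0" using x_int radius_ge unfolding abs_le_iff by auto
  have y0_int: "y0 \<in> I0" unfolding y0_def by (rule f0_bounds[OF x_the_int])
  define y1 where "y1 = (f0 ^^ T) y0"
  define z where "z = (f0 ^^ T) crit_value2"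
  define r where "r = 2 powr (real b * real T + 25 - 10 * real k)"
  have "\<bar>y1 - z\<bar> \<le> 2 powr (real b * real T) * \<bar>y0 - crit_value2\<bar>"
    unfolding y1_def z_def by (rule lip[OF y0_int surv_int[OF crit_value2_survivor]])
  also have "\<dots> \<le> 2 powr (real b * real T) * 2 powr (25 - 10 * real k)"
    using \<open>\<bar>y0 - crit_value2\<bar> \<le> _\<close> by (intro mult_left_mono) auto
  also have "\<dots> = r" unfolding r_def by (rule powr_2_mult) simp
  finally have y1z: "\<bar>y1 - z\<bar> \<le> r" .
  have "r \<le> 2 powr (-5)" unfolding r_def by (rule powr_mono) (use kb bT k100 in \<open>linarith\<close>, simp)
  then have r_small: "r \<le> 1/20" by (simp add: powr_minus powr_numeral)
  have r0: "0 \<le> r" by (simp add: r_def)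
  have z_br: "z \<in> branch 2" unfolding z_def T_def by (rule visit_branch)
  then have z1: "\<bar>z - 1\<bar> \<le> 3/20" unfolding abs_le_iff by (auto simp: branch_def)
  have y1_near: "\<bar>y1 - 1\<bar> \<le> \<bar>z - 1\<bar> + r" using y1z by linarith
  then have "4/5 \<le> y1" "y1 \<le> 6/5" using z1 r_small by linarith+
  then have fy1: "f0 y1 - crit_value1 = slope * (y1 - 1) ^ 3" by (simp add: f0_eqs inflection_def)
  have fz: "f0 z - crit_value1 = slope * (z - 1) ^ 3" by (simp add: f0_branch(2)[OF z_br] inflection_def)
  \<comment> \<open>The run of \<open>itin1\<close> has length 2 k, not k, so that the critical
    orbit misses \<open>crit_value1\<close> by at most 2 ^ (- 46 k), negligible at the scale 2 ^ (-
    28 k) used below.\<close>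
  have "2 ^ (23 * (n + 2 * k)) * \<bar>f0 z - crit_value1\<bar> \<le> 1/4"
    using visit_image(3)[of i] by (simp add: z_def T_def n_def k_def)
  moreover have "2 powr (46 * real k) * \<bar>f0 z - crit_value1\<bar>
      \<le> 2 ^ (23 * (n + 2 * k)) * \<bar>f0 z - crit_value1\<bar>"
    by (intro mult_right_mono powr_2_le_power) auto
  ultimately have "2 powr (46 * real k) * \<bar>f0 z - crit_value1\<bar> \<le> 1" by linarith
  then have fz_small: "\<bar>f0 z - crit_value1\<bar> \<le> 2 powr (- 46 * real k)"
    by (simp add: powr_minus field_simps)
  have "\<bar>f0 y1 - crit_value1\<bar> = slope * \<bar>y1 - 1\<bar> ^ 3"
    unfolding fy1 using slope_pos by (simp add: abs_mult power_abs)
  also have "\<dots> \<le> slope * (\<bar>z - 1\<bar> + r) ^ 3"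
    using y1_near slope_pos by (intro mult_left_mono power_mono) auto
  also have "\<dots> \<le> slope * (8 * (\<bar>z - 1\<bar> ^ 3 + r ^ 3))"
    using cube_add_le[of "\<bar>z - 1\<bar>" r] r0 slope_pos by (intro mult_left_mono) auto
  also have "\<dots> = 8 * \<bar>f0 z - crit_value1\<bar> + 8 * slope * r ^ 3"
    unfolding fz using slope_pos by (simp add: abs_mult power_abs algebra_simps)
  \<comment> \<open>The cube turns 10 k into 30 k; both 46 and 30 exceed the 28 needed.\<close>
  also have "\<dots> \<le> 2 powr (3 - 46 * real k) + 2 powr (102 + 3 * (real b * real T) - 30 * real k)"
  proof (rule add_mono)
    have "8 * \<bar>f0 z - crit_value1\<bar> \<le> 2 powr 3 * 2 powr (- 46 * real k)"
      using fz_small by (simp add: powr_numeral)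
    also have "\<dots> = 2 powr (3 - 46 * real k)" by (rule powr_2_mult) simp
    finally show "8 * \<bar>f0 z - crit_value1\<bar> \<le> 2 powr (3 - 46 * real k)" .
    have "8 * slope * r ^ 3 = 2 powr 27 * 2 powr (3 * (real b * real T + 25 - 10 * real k))"
      unfolding r_def powr_cube by (simp add: slope_def powr_numeral)
    also have "\<dots> = 2 powr (102 + 3 * (real b * real T) - 30 * real k)"
      by (rule powr_2_mult) (simp add: algebra_simps)
    finally show "8 * slope * r ^ 3 \<le> 2 powr (102 + 3 * (real b * real T) - 30 * real k)" by simp
  qed
  also have "\<dots> \<le> 2 powr (- 28 * real k - 1) + 2 powr (- 28 * real k - 1)"
    by (intro add_mono powr_mono) (use kb bT k100 in \<open>linarith\<close>)+
  also have "\<dots> = 2 powr (- 28 * real k)" by (simp add: powr_diff)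
  finally have fy1_small: "\<bar>f0 y1 - crit_value1\<bar> \<le> 2 powr (- 28 * real k)" .
  have "2 powr (- 46 * real k) \<le> 2 powr (- 28 * real k)" by (rule powr_mono) auto
  then have "\<bar>f0 y1 - f0 z\<bar> \<le> 2 * 2 powr (- 28 * real k)"
    using fz_small fy1_small by linarith
  also have "\<dots> = 2 powr (1 - 28 * real k)" by (simp add: powr_diff powr_minus field_simps)
  finally have diff: "\<bar>f0 y1 - f0 z\<bar> \<le> 2 powr (1 - 28 * real k)" .
  have y1_int: "y1 \<in> I0" unfolding y1_def by (rule funpow_bounds[OF y0_int])
  have z_int: "z \<in> I0" unfolding z_def by (rule surv_int[OF survivors_funpow[OF crit_value2_survivor]])
  define u where "u = (f0 ^^ n) (f0 y1)"
  define p where "p = (f0 ^^ n) (f0 z)"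
  have "\<bar>u - p\<bar> \<le> 2 powr (real b * real n) * \<bar>f0 y1 - f0 z\<bar>"
    unfolding u_def p_def by (rule lip[OF f0_bounds[OF y1_int] f0_bounds[OF z_int]])
  also have "\<dots> \<le> 2 powr (real b * real n) * 2 powr (1 - 28 * real k)"
    using diff by (intro mult_left_mono) auto
  also have "\<dots> = 2 powr (real b * real n + 1 - 28 * real k)" by (rule powr_2_mult) simp
  also have "\<dots> \<le> 2 powr (- 27 * real k)"
    by (rule powr_mono) (use kb bT k100 in \<open>linarith\<close>, simp)
  finally have up: "\<bar>u - p\<bar> \<le> 2 powr (- 27 * real k)" .
  have p_eq: "p = (f0 ^^ (visit i + 1 + run_start i)) crit_value2"
  proof -
    have "visit i + 1 + run_start i = run_start i + Suc (visit i)" by simp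
    then show ?thesis unfolding p_def z_def n_def T_def by (simp only: funpow_plus funpow.simps comp_apply)
  qed
  \<comment> \<open>The critical orbit still has 32 k zeros ahead and is therefore extremely close
    to 0, although only k of these steps are used for \<open>u\<close>.\<close>
  have "2 powr (27 * real k) * \<bar>p - 0\<bar> \<le> 2 ^ (23 * (32 * k)) * \<bar>p - 0\<bar>"
    by (intro mult_right_mono powr_2_le_power) auto
  also have "\<dots> \<le> \<bar>(f0 ^^ (32 * k)) p - (f0 ^^ (32 * k)) 0\<bar>"
  proof (rule shadows_expand)
    show "shadows (\<lambda>_. 0) (32 * k) p"
      using shadows_shift[OF crit_value2_shadows, of "visit i + 1 + run_start i" "32 * k"] itin2_run[of _ i]
      unfolding p_eq by (simp add: shadows_def k_def)
    show "shadows (\<lambda>_. 0) (32 * k) 0" by (simp add: shadows_def branch_def funpow_zero)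
  qed simp
  also have "\<dots> \<le> 3"
  proof -
    have "(f0 ^^ (32 * k)) p \<in> survivors"
      unfolding p_eq by (intro survivors_funpow crit_value2_survivor)
    then show ?thesis using survivors_bounds[of "(f0 ^^ (32 * k)) p"] by (simp add: funpow_zero)
  qed
  finally have "\<bar>p\<bar> \<le> 3 * 2 powr (- 27 * real k)" by (simp add: powr_minus field_simps)
  then have "\<bar>u\<bar> \<le> 4 * 2 powr (- 27 * real k)" using up by linarith
  also have "\<dots> = 2 powr (2 - 27 * real k)" by (simp add: powr_diff powr_minus powr_numeral field_simps)
  also have "\<dots> \<le> 2 powr (- 26 * real k)" by (rule powr_mono) (use k100 in auto)
  finally have "\<bar>(f0 ^^ k) u\<bar> \<le> 2 powr (- real k)" by (rule run_near_0) (use k100 in auto)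
  moreover have "(f0 ^^ (half_run i + (run_start i + Suc (visit i + 1)))) x = (f0 ^^ k) u"
  proof -
    have "Suc (visit i + 1) = Suc (visit i + Suc 0)" by simp
    then have "(f0 ^^ Suc (visit i + 1)) x = f0 y1"
      unfolding y1_def y0_def T_def by (simp only: funpow_plus funpow.simps comp_apply id_apply)
    then show ?thesis unfolding u_def k_def n_def by (simp only: funpow_plus)
  qed
  ultimately show ?thesis by (simp add: k_def)
qed

section \<open>Lengths of components and the upper limit\<close>

lemma max_component_length_ge:
  assumes "S \<subseteq> I0" "{c - \<rho>..c + \<rho>} \<subseteq> S" "0 \<le> \<rho>"
  shows "2 * \<rho> \<le> max_component_length S"
proof -
  have c: "c \<in> {c - \<rho>..c + \<rho>}" using assms(3) by simp
  let ?W = "connected_component_set S c"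
  have W: "?W \<in> components S" unfolding components_def using c assms(2) by blast
  have sub: "{c - \<rho>..c + \<rho>} \<subseteq> ?W" by (rule connected_component_maximal[OF c _ assms(2)]) simp
  have Wsub: "?W \<subseteq> I0" using connected_component_subset assms(1) by blast
  have "is_interval ?W" by (simp add: is_interval_connected_1)
  then have meas: "?W \<in> sets borel" by (rule real_interval_borel_measurable)
  have "I0 \<in> fmeasurable lborel" using fmeasurable_cbox[of "- radius" radius] by simp
  then have fm: "?W \<in> fmeasurable lborel" using fmeasurableI2 Wsub meas by (metis sets_lborel)
  have "2 * \<rho> = measure lborel {c - \<rho>..c + \<rho>}" using assms(3) by simp
  also have "\<dots> \<le> measure lborel ?W" by (rule measure_mono_fmeasurable[OF sub _ fm]) simp
  also have "\<dots> \<le> max_component_length S"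
    using max_component_length_attained[of S "- radius" radius] assms(1) c assms(2) W by (metis empty_iff subset_iff)
  finally show ?thesis .
qed

lemma pullback_length:
  assumes "\<delta> > 0"
  shows "\<exists>n\<ge>N. 1 \<le> n \<and> - 5 * ln 2 * real n \<le>
    ln (max_component_length {x \<in> I0. (f0 ^^ n) x \<in> ball 0 \<delta> \<inter> I0}) \<and>
    0 < max_component_length {x \<in> I0. (f0 ^^ n) x \<in> ball 0 \<delta> \<inter> I0}"
proof -
  obtain b where lip: "\<And>n x y. x \<in> I0 \<Longrightarrow> y \<in> I0 \<Longrightarrow>
      \<bar>(f0 ^^ n) x - (f0 ^^ n) y\<bar> \<le> 2 powr (real b * real n) * \<bar>x - y\<bar>"
    using f0_lipschitz by blast
  obtain m where m: "1 / \<delta> < 2 ^ m" using real_arch_pow[of 2 "1 / \<delta>"] by auto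
  \<comment> \<open>The part 100 + 3 b is required by \<open>pullback_ball\<close>, \<open>m\<close>
    brings the image into the ball of radius \<delta>, and \<open>N\<close> makes n at least
    N.\<close>
  define i where "i = 100 + 3 * b + m + N"
  define k where "k = half_run i"
  define n where "n = k + (run_start i + Suc (visit i + 1))"
  have "Suc i * 1 \<le> k" unfolding k_def half_run_def by (intro mult_left_mono) auto
  then have ik: "i < k" by simp
  define \<rho> where "\<rho> = 2 powr (- 5 * real k)"
  let ?S = "{x \<in> I0. (f0 ^^ n) x \<in> ball 0 \<delta> \<inter> I0}"
  have "\<rho> \<le> 2 powr 0" unfolding \<rho>_def by (rule powr_mono) auto
  then have \<rho>: "0 < \<rho>" "\<rho> \<le> 1" by (auto simp: \<rho>_def)
  have small: "2 powr (- real k) < \<delta>"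
  proof -
    have "(2::real) ^ m \<le> 2 ^ k" by (rule power_increasing) (use ik in \<open>auto simp: i_def\<close>)
    then have "1 / \<delta> < 2 ^ k" using m by linarith
    then have "1 / \<delta> < 2 powr real k" by (simp add: powr_realpow)
    then show ?thesis using assms by (simp add: powr_minus field_simps)
  qed
  have "{2 - \<rho>..2 + \<rho>} \<subseteq> ?S"
  proof
    fix x assume x: "x \<in> {2 - \<rho>..2 + \<rho>}"
    then have "x \<in> I0" using \<rho> radius_ge by auto
    moreover have "\<bar>x - 2\<bar> \<le> 2 powr (- 5 * real (half_run i))"
      using x unfolding abs_le_iff by (auto simp: \<rho>_def k_def)
    then have "\<bar>(f0 ^^ n) x\<bar> \<le> 2 powr (- real k)"
      unfolding n_def k_def by (intro pullback_ball[OF lip]) (auto simp: i_def)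
    ultimately show "x \<in> ?S" using small funpow_bounds by simp
  qed
  then have "2 * \<rho> \<le> max_component_length ?S"
    by (intro max_component_length_ge) (use \<rho> in auto)
  then have len: "\<rho> \<le> max_component_length ?S" using \<rho> by linarith
  \<comment> \<open>The length bound is in terms of the k steps near 0 alone; counting all n steps
    only weakens it.\<close>
  have "real k \<le> real n" by (simp add: n_def)
  then have "- 5 * ln 2 * real n \<le> - 5 * ln 2 * real k" by simp
  also have "\<dots> = ln \<rho>" by (simp add: \<rho>_def ln_powr)
  also have "\<dots> \<le> ln (max_component_length ?S)" using \<rho> len by (intro ln_mono) auto
  finally show ?thesis
    using \<rho>(1) len ik by (intro exI[of _ n]) (auto simp: n_def i_def)
qed

lemma limsup_ge:
  assumes "\<delta> > 0"
  shows "ereal (- 5 * ln 2) \<le> limsup (\<lambda>n. ereal (1 / real n) *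
    eln (max_component_length {x \<in> I0. (f0 ^^ n) x \<in> ball 0 \<delta> \<inter> I0}))"
  (is "_ \<le> limsup ?X")
  unfolding limsup_INF_SUP
proof (rule INF_greatest)
  fix N :: nat
  let ?l = "\<lambda>n. max_component_length {x \<in> I0. (f0 ^^ n) x \<in> ball 0 \<delta> \<inter> I0}"
  obtain n where n: "n \<ge> N" "1 \<le> n" "- 5 * ln 2 * real n \<le> ln (?l n)" "0 < ?l n"
    using pullback_length[OF assms, of N] by blast
  have "?X n = ereal (1 / real n * ln (?l n))" using n(4) by (simp add: eln_def)
  moreover have "- 5 * ln 2 \<le> 1 / real n * ln (?l n)" using n(2,3) by (simp add: field_simps)
  ultimately have "ereal (- 5 * ln 2) \<le> ?X n" by simp
  then show "ereal (- 5 * ln 2) \<le> (SUP n\<in>{N..}. ?X n)" using n(1) by (intro SUP_upper2[of n]) auto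
qed

theorem propositionA:
  shows "\<exists>(I :: real set) (f :: real \<Rightarrow> real).
    (\<exists>a b. a < b \<and> I = {a..b}) \<and>
    nondegenerate_smooth_map I f \<and>
    topologically_exact_on_Julia I f \<and>
    chi_inf I f > 0 \<and>
    (\<exists>p\<in>I. f p = p \<and>
      (\<exists>C\<in>components (Fatou I f). p \<in> (top_of_set I) frontier_of C) \<and>
      (\<forall>\<delta>>0. limsup (\<lambda>n. ereal (1 / real n) *
          eln (max_component_length {x\<in>I. (f ^^ n) x \<in> ball p \<delta> \<inter> I}))
        > - chi_inf I f))"
proof (intro exI conjI)
  show "- radius < radius" using radius_ge by simp
  show "I0 = I0" ..
  show "nondegenerate_smooth_map I0 f0" by (rule f0_nondegenerate)
  show "topologically_exact_on_Julia I0 f0" by (rule f0_exact)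
  have chi: "ereal exponent_bound \<le> chi_inf I0 f0" by (rule chi_inf_ge)
  have "0 < ereal exponent_bound" by simp
  then show "0 < chi_inf I0 f0" using chi by (rule less_le_trans)
  have "- chi_inf I0 f0 \<le> - ereal exponent_bound"
    using chi by (simp only: ereal_minus_le_minus)
  also have "\<dots> < ereal (- 5 * ln 2)" by simp
  finally have less: "- chi_inf I0 f0 < ereal (- 5 * ln 2)" .
  have long: "\<forall>\<delta>>0. limsup (\<lambda>n. ereal (1 / real n) *
      eln (max_component_length {x\<in>I0. (f0 ^^ n) x \<in> ball 0 \<delta> \<inter> I0}))
    > - chi_inf I0 f0"
    using less_le_trans[OF less limsup_ge] by blast
  have "f0 0 = 0" "0 \<in> I0" using funpow_zero[of 1] radius_ge by simp_all
  with zero_in_frontier long show "\<exists>p\<in>I0. f0 p = p \<and>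
      (\<exists>C\<in>components (Fatou I0 f0). p \<in> (top_of_set I0) frontier_of C) \<and>
      (\<forall>\<delta>>0. limsup (\<lambda>n. ereal (1 / real n) *
          eln (max_component_length {x\<in>I0. (f0 ^^ n) x \<in> ball p \<delta> \<inter> I0}))
        > - chi_inf I0 f0)"
    by blast
qed

end
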